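(* Let $M\times_\lambda N$ be the singly warped product of Riemannian manifolds $(M,g)$ and $(N,h)$, $n=\dim N$, with smooth warping function $\lambda:M\to(0,+\infty)$. Suppose that $\psi:N\to N$ is a harmonic map and $f\in C^\infty(M\times_\lambda N)$ is a positive non-constant function. The product map $\Psi=\mathrm{Id}_M\times\psi:M\times_\lambda N\to(M\times N,g\oplus h)$, $\Psi(x,y)=(x,\psi(y))$, is a non-trivial $f$-bi-harmonic map if and only if the warping function $\lambda$ is a non-constant solution of $$\begin{aligned}0={}&f\,\mathrm{Tr}_g({}^M\nabla)^2\,\mathrm{grad}_g\log\lambda+\frac n2f\,\mathrm{grad}_g\big(|\mathrm{grad}_g\log\lambda|^2\big)+f\,{}^M\mathrm{Ric}(\mathrm{grad}_g\log\lambda)\\&+(\Delta_{M\times_\lambda N}f)\,\mathrm{grad}_g\log\lambda+2\,{}^M\nabla_{\mathrm{grad}_gf}\,\mathrm{grad}_g\log\lambda\end{aligned}$$ (at every $(x,y)\in M\times N$).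
   Context: $M\times_\lambda N$ is $M\times N$ with the metric $\bar g=g\oplus\lambda^2h$; $\Delta_{M\times_\lambda N}$ is its Laplacian $\mathrm{div}\,\mathrm{grad}$; $\mathrm{grad}_gf$ is the partial gradient of $f(x,y)$ along $M$ w.r.t. $g$. Curvature convention $R(X,Y)Z=\nabla_X\nabla_YZ-\nabla_Y\nabla_XZ-\nabla_{[X,Y]}Z$. For a local orthonormal frame $\{e_j\}$ of $(M,g)$: ${}^M\mathrm{Ric}(X)=\sum_jR^M(X,e_j)e_j$, $\mathrm{Tr}_g({}^M\nabla)^2X=\sum_j({}^M\nabla_{e_j}{}^M\nabla_{e_j}X-{}^M\nabla_{{}^M\nabla_{e_j}e_j}X)$. For a smooth map $\phi:(P,k)\to(Q,q)$ and positive smooth $f$ on $P$, $\tau(\phi)=\mathrm{Tr}_k\nabla d\phi$ ($\phi$ is harmonic iff it vanishes); $\phi$ is $f$-bi-harmonic if it is a critical point of $\frac12\int_\Omega f|\tau(\phi)|^2dv_k$ for every compact domain $\Omega\subset P$; equivalently $\tau_{2,f}(\phi)=-\mathrm{Tr}_k(\nabla^\phi)^2(f\tau(\phi))-f\sum_iR^Q(\tau(\phi),d\phi(\epsilon_i))d\phi(\epsilon_i)=0$, where $\nabla^\phi$ is the pull-back connection, $\{\epsilon_i\}$ a local orthonormal frame of $P$, $\mathrm{Tr}_k(\nabla^\phi)^2V=\sum_i(\nabla^\phi_{\epsilon_i}\nabla^\phi_{\epsilon_i}V-\nabla^\phi_{\nabla_{\epsilon_i}\epsilon_i}V)$. An $f$-bi-harmonic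 map is called non-trivial if $f$ is non-constant and the map is not harmonic.
   Formalization: M is assumed connected; on a disconnected M a locally constant but non-constant warping function λ solves the equation (grad log λ = 0) while the product map Ψ is harmonic, so the equivalence fails as stated. *)

theory Defs
  imports "HOL-Analysis.Analysis"
begin

section \<open>Smooth functions between Euclidean spaces\<close>

text \<open>The set \<open>S\<close> is open in all uses below.\<close>

fun Ck_on :: "nat \<Rightarrow> 'a::euclidean_space set \<Rightarrow> ('a \<Rightarrow> 'b::euclidean_space) \<Rightarrow> bool" where
  "Ck_on 0 S F \<longleftrightarrow> continuous_on S F"
| "Ck_on (Suc k) S F \<longleftrightarrow>
     (\<forall>x\<in>S. F differentiable (at x)) \<and>
     (\<forall>u. Ck_on k S (\<lambda>x. frechet_derivative F (at x) u))"

definition smooth_on :: "'a::euclidean_space set \<Rightarrow> ('a \<Rightarrow> 'b::euclidean_space) \<Rightarrow> bool" where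
  "smooth_on S F \<longleftrightarrow> (\<forall>k. Ck_on k S F)"


section \<open>Riemannian geometry in one coordinate domain\<close>

text \<open>A metric on an open subset of the model space \<open>'e\<close> assigns to each point \<open>x\<close> the form
  \<open>G x u v\<close>, and a vector field is a map \<open>'e \<Rightarrow> 'e\<close>.  The operators below only depend on
  the germs of their arguments at the point at which they are evaluated, so their arguments may be
  arbitrary outside the coordinate domain.\<close>

type_synonym 'e metric_field = "'e \<Rightarrow> 'e \<Rightarrow> 'e \<Rightarrow> real"
type_synonym 'e vector_field = "'e \<Rightarrow> 'e"

definition metric_field_on :: "'e::euclidean_space set \<Rightarrow> 'e metric_field \<Rightarrow> bool" where
  "metric_field_on S G \<longleftrightarrow>
     (\<forall>x\<in>S. bilinear (G x) \<and> (\<forall>u v. G x u v = G x v u) \<and> (\<forall>u. u \<noteq> 0 \<longrightarrow> G x u u > 0)) \<and>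
     (\<forall>u v. smooth_on S (\<lambda>x. G x u v))"

definition gradient :: "'e::euclidean_space metric_field \<Rightarrow> ('e \<Rightarrow> real) \<Rightarrow> 'e vector_field" where
  "gradient G F x = (THE w. \<forall>v. G x w v = frechet_derivative F (at x) v)"

text \<open>Christoffel symbols of the Levi-Civita connection as a vector-valued form:
  \<open>christoffel G x b\<^sub>i b\<^sub>j = (\<Sum>k. \<Gamma>\<^sup>k\<^sub>i\<^sub>j(x) b\<^sub>k)\<close> for the coordinate vectors \<open>b\<^sub>i\<close>.\<close>

definition christoffel :: "'e::euclidean_space metric_field \<Rightarrow> 'e \<Rightarrow> 'e \<Rightarrow> 'e \<Rightarrow> 'e" where
  "christoffel G x u v = (THE w. \<forall>z. G x w z =
     (frechet_derivative (\<lambda>y. G y v z) (at x) u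
      + frechet_derivative (\<lambda>y. G y u z) (at x) v
      - frechet_derivative (\<lambda>y. G y u v) (at x) z) / 2)"

definition nabla ::
  "'e::euclidean_space metric_field \<Rightarrow> 'e vector_field \<Rightarrow> 'e vector_field \<Rightarrow> 'e vector_field" where
  "nabla G X Y x = frechet_derivative Y (at x) (X x) + christoffel G x (X x) (Y x)"

definition lie_bracket :: "'e::euclidean_space vector_field \<Rightarrow> 'e vector_field \<Rightarrow> 'e vector_field" where
  "lie_bracket X Y x = frechet_derivative Y (at x) (X x) - frechet_derivative X (at x) (Y x)"

definition curvature ::
  "'e::euclidean_space metric_field \<Rightarrow> 'e vector_field \<Rightarrow> 'e vector_field \<Rightarrow> 'e vector_field \<Rightarrow> 'e vector_field"
  where
  "curvature G X Y Z x =
     nabla G X (nabla G Y Z) x - nabla G Y (nabla G X Z) x - nabla G (lie_bracket X Y) Z x"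

text \<open>Curvature on tangent vectors at a point; by tensoriality any extension to vector fields may
  be used, here the one with constant components.\<close>

definition curvature_at :: "'e::euclidean_space metric_field \<Rightarrow> 'e \<Rightarrow> 'e \<Rightarrow> 'e \<Rightarrow> 'e \<Rightarrow> 'e" where
  "curvature_at G x u v w = curvature G (\<lambda>_. u) (\<lambda>_. v) (\<lambda>_. w) x"

text \<open>Frames are indexed by the standard basis of the model space.\<close>

definition orthonormal_frame_on ::
  "'e::euclidean_space metric_field \<Rightarrow> 'e set \<Rightarrow> ('e \<Rightarrow> 'e vector_field) \<Rightarrow> bool" where
  "orthonormal_frame_on G W e \<longleftrightarrow>
     (\<forall>b\<in>Basis. smooth_on W (e b)) \<and>
     (\<forall>x\<in>W. \<forall>b\<in>Basis. \<forall>c\<in>Basis. G x (e b x) (e c x) = (if b = c then 1 else 0))"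

text \<open>A local orthonormal frame near \<open>x\<close>; the traces below do not depend on the choice.\<close>

definition frame_near :: "'e::euclidean_space metric_field \<Rightarrow> 'e \<Rightarrow> 'e \<Rightarrow> 'e vector_field" where
  "frame_near G x = (SOME e. \<exists>W. open W \<and> x \<in> W \<and> orthonormal_frame_on G W e)"

definition divergence :: "'e::euclidean_space metric_field \<Rightarrow> 'e vector_field \<Rightarrow> 'e \<Rightarrow> real" where
  "divergence G X x = (let e = frame_near G x in \<Sum>b\<in>Basis. G x (nabla G (e b) X x) (e b x))"

definition laplacian :: "'e::euclidean_space metric_field \<Rightarrow> ('e \<Rightarrow> real) \<Rightarrow> 'e \<Rightarrow> real" where
  "laplacian G F = divergence G (gradient G F)"

definition ricci :: "'e::euclidean_space metric_field \<Rightarrow> 'e vector_field \<Rightarrow> 'e vector_field" where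
  "ricci G X x = (let e = frame_near G x in \<Sum>b\<in>Basis. curvature_at G x (X x) (e b x) (e b x))"

definition trace_nabla2 :: "'e::euclidean_space metric_field \<Rightarrow> 'e vector_field \<Rightarrow> 'e vector_field" where
  "trace_nabla2 G X x = (let e = frame_near G x in
     \<Sum>b\<in>Basis. nabla G (e b) (nabla G (e b) X) x - nabla G (nabla G (e b) (e b)) X x)"

text \<open>Maps between coordinate domains: \<open>K\<close> is the metric of the source, \<open>H\<close> that of the
  target, \<open>F\<close> the map, and \<open>V\<close> a vector field along \<open>F\<close>.\<close>

definition pullback_nabla ::
  "'b::euclidean_space metric_field \<Rightarrow> ('a::euclidean_space \<Rightarrow> 'b) \<Rightarrow> 'a vector_field \<Rightarrow> ('a \<Rightarrow> 'b) \<Rightarrow> 'a \<Rightarrow> 'b"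
  where
  "pullback_nabla H F X V x =
     frechet_derivative V (at x) (X x)
     + christoffel H (F x) (frechet_derivative F (at x) (X x)) (V x)"

definition pullback_trace_nabla2 ::
  "'a::euclidean_space metric_field \<Rightarrow> 'b::euclidean_space metric_field \<Rightarrow> ('a \<Rightarrow> 'b) \<Rightarrow> ('a \<Rightarrow> 'b) \<Rightarrow> 'a \<Rightarrow> 'b"
  where
  "pullback_trace_nabla2 K H F V x = (let e = frame_near K x in
     \<Sum>b\<in>Basis. pullback_nabla H F (e b) (pullback_nabla H F (e b) V) x
                 - pullback_nabla H F (nabla K (e b) (e b)) V x)"

definition tension ::
  "'a::euclidean_space metric_field \<Rightarrow> 'b::euclidean_space metric_field \<Rightarrow> ('a \<Rightarrow> 'b) \<Rightarrow> 'a \<Rightarrow> 'b" where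
  "tension K H F x = (let e = frame_near K x in
     \<Sum>b\<in>Basis. pullback_nabla H F (e b) (\<lambda>y. frechet_derivative F (at y) (e b y)) x
                 - frechet_derivative F (at x) (nabla K (e b) (e b) x))"

definition f_bitension ::
  "'a::euclidean_space metric_field \<Rightarrow> 'b::euclidean_space metric_field \<Rightarrow> ('a \<Rightarrow> real) \<Rightarrow> ('a \<Rightarrow> 'b) \<Rightarrow> 'a \<Rightarrow> 'b"
  where
  "f_bitension K H w F x =
     - pullback_trace_nabla2 K H F (\<lambda>y. w y *\<^sub>R tension K H F y) x
     - w x *\<^sub>R (let e = frame_near K x in
         \<Sum>b\<in>Basis. curvature_at H (F x) (tension K H F x)
                       (frechet_derivative F (at x) (e b x)) (frechet_derivative F (at x) (e b x)))"


section \<open>Riemannian manifolds\<close>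

text \<open>The underlying space is the whole type \<open>'m\<close>, the atlas is a family of charts indexed by
  the type \<open>'i\<close>, and the metric is given by its components in each chart, as a function on the
  image of that chart.  The dimension is \<open>DIM('e)\<close>.\<close>

record ('i, 'm, 'e) rmanifold =
  chart_dom :: "'i \<Rightarrow> 'm set"
  chart_map :: "'i \<Rightarrow> 'm \<Rightarrow> 'e"
  chart_metric :: "'i \<Rightarrow> 'e metric_field"

definition chart_img :: "('i, 'm, 'e) rmanifold \<Rightarrow> 'i \<Rightarrow> 'e set" where
  "chart_img M i = chart_map M i ` chart_dom M i"

definition chart_inv :: "('i, 'm, 'e) rmanifold \<Rightarrow> 'i \<Rightarrow> 'e \<Rightarrow> 'm" where
  "chart_inv M i = inv_into (chart_dom M i) (chart_map M i)"

definition smooth_atlas :: "('i, 'm::topological_space, 'e::euclidean_space) rmanifold \<Rightarrow> bool" where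
  "smooth_atlas M \<longleftrightarrow>
     (\<Union>i. chart_dom M i) = UNIV \<and>
     (\<forall>i. open (chart_dom M i) \<and> open (chart_img M i) \<and>
          homeomorphism (chart_dom M i) (chart_img M i) (chart_map M i) (chart_inv M i)) \<and>
     (\<forall>i j. smooth_on (chart_map M i ` (chart_dom M i \<inter> chart_dom M j))
              (chart_map M j \<circ> chart_inv M i))"

definition riemannian_manifold :: "('i, 'm::topological_space, 'e::euclidean_space) rmanifold \<Rightarrow> bool" where
  "riemannian_manifold M \<longleftrightarrow>
     smooth_atlas M \<and>
     (\<forall>i. metric_field_on (chart_img M i) (chart_metric M i)) \<and>
     (\<forall>i j. \<forall>x \<in> chart_map M i ` (chart_dom M i \<inter> chart_dom M j). \<forall>u v.
        let T = chart_map M j \<circ> chart_inv M i; D = frechet_derivative T (at x)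
        in chart_metric M i x u v = chart_metric M j (T x) (D u) (D v))"

definition product_manifold ::
  "('i, 'm, 'e::euclidean_space) rmanifold \<Rightarrow> ('j, 'n, 'f::euclidean_space) rmanifold
    \<Rightarrow> ('i \<times> 'j, 'm \<times> 'n, 'e \<times> 'f) rmanifold" where
  "product_manifold M N =
     \<lparr>chart_dom = (\<lambda>(i, j). chart_dom M i \<times> chart_dom N j),
      chart_map = (\<lambda>(i, j). map_prod (chart_map M i) (chart_map N j)),
      chart_metric = (\<lambda>(i, j) (x, y) (u, v) (u', v').
         chart_metric M i x u u' + chart_metric N j y v v')\<rparr>"

definition warped_product ::
  "('i, 'm, 'e::euclidean_space) rmanifold \<Rightarrow> ('m \<Rightarrow> real) \<Rightarrow> ('j, 'n, 'f::euclidean_space) rmanifold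
    \<Rightarrow> ('i \<times> 'j, 'm \<times> 'n, 'e \<times> 'f) rmanifold" where
  "warped_product M l N =
     \<lparr>chart_dom = (\<lambda>(i, j). chart_dom M i \<times> chart_dom N j),
      chart_map = (\<lambda>(i, j). map_prod (chart_map M i) (chart_map N j)),
      chart_metric = (\<lambda>(i, j) (x, y) (u, v) (u', v').
         chart_metric M i x u u' + (l (chart_inv M i x))\<^sup>2 * chart_metric N j y v v')\<rparr>"

definition fun_rep :: "('i, 'm, 'e) rmanifold \<Rightarrow> ('m \<Rightarrow> real) \<Rightarrow> 'i \<Rightarrow> 'e \<Rightarrow> real" where
  "fun_rep M F i = F \<circ> chart_inv M i"

definition smooth_function ::
  "('i, 'm::topological_space, 'e::euclidean_space) rmanifold \<Rightarrow> ('m \<Rightarrow> real) \<Rightarrow> bool" where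
  "smooth_function M F \<longleftrightarrow> (\<forall>i. smooth_on (chart_img M i) (fun_rep M F i))"

definition map_rep ::
  "('i, 'p, 'a) rmanifold \<Rightarrow> ('j, 'q, 'b) rmanifold \<Rightarrow> ('p \<Rightarrow> 'q) \<Rightarrow> 'i \<Rightarrow> 'j \<Rightarrow> 'a \<Rightarrow> 'b" where
  "map_rep P Q \<phi> i j = chart_map Q j \<circ> \<phi> \<circ> chart_inv P i"

definition map_rep_dom ::
  "('i, 'p, 'a) rmanifold \<Rightarrow> ('j, 'q, 'b) rmanifold \<Rightarrow> ('p \<Rightarrow> 'q) \<Rightarrow> 'i \<Rightarrow> 'j \<Rightarrow> 'a set" where
  "map_rep_dom P Q \<phi> i j = chart_map P i ` (chart_dom P i \<inter> \<phi> -` chart_dom Q j)"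

definition smooth_map ::
  "('i, 'p::topological_space, 'a::euclidean_space) rmanifold
    \<Rightarrow> ('j, 'q::topological_space, 'b::euclidean_space) rmanifold \<Rightarrow> ('p \<Rightarrow> 'q) \<Rightarrow> bool" where
  "smooth_map P Q \<phi> \<longleftrightarrow> continuous_on UNIV \<phi> \<and>
     (\<forall>i j. smooth_on (map_rep_dom P Q \<phi> i j) (map_rep P Q \<phi> i j))"

definition harmonic_map ::
  "('i, 'p::topological_space, 'a::euclidean_space) rmanifold
    \<Rightarrow> ('j, 'q::topological_space, 'b::euclidean_space) rmanifold \<Rightarrow> ('p \<Rightarrow> 'q) \<Rightarrow> bool" where
  "harmonic_map P Q \<phi> \<longleftrightarrow> smooth_map P Q \<phi> \<and>
     (\<forall>i j. \<forall>x \<in> map_rep_dom P Q \<phi> i j.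
        tension (chart_metric P i) (chart_metric Q j) (map_rep P Q \<phi> i j) x = 0)"

text \<open>\<open>f\<close>-bi-harmonicity is expressed by the Euler-Lagrange equation of
  \<open>1/2 \<integral> f |\<tau>(\<phi>)|\<^sup>2\<close>, that is, by \<open>\<tau>\<^sub>2\<^sub>,\<^sub>f(\<phi>) = 0\<close>.\<close>

definition f_biharmonic_map ::
  "('i, 'p::topological_space, 'a::euclidean_space) rmanifold
    \<Rightarrow> ('j, 'q::topological_space, 'b::euclidean_space) rmanifold
    \<Rightarrow> ('p \<Rightarrow> real) \<Rightarrow> ('p \<Rightarrow> 'q) \<Rightarrow> bool" where
  "f_biharmonic_map P Q f \<phi> \<longleftrightarrow>
     smooth_map P Q \<phi> \<and> smooth_function P f \<and> (\<forall>p. f p > 0) \<and>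
     (\<forall>i j. \<forall>x \<in> map_rep_dom P Q \<phi> i j.
        f_bitension (chart_metric P i) (chart_metric Q j) (fun_rep P f i) (map_rep P Q \<phi> i j) x = 0)"

definition nontrivial_f_biharmonic_map ::
  "('i, 'p::topological_space, 'a::euclidean_space) rmanifold
    \<Rightarrow> ('j, 'q::topological_space, 'b::euclidean_space) rmanifold
    \<Rightarrow> ('p \<Rightarrow> real) \<Rightarrow> ('p \<Rightarrow> 'q) \<Rightarrow> bool" where
  "nontrivial_f_biharmonic_map P Q f \<phi> \<longleftrightarrow>
     f_biharmonic_map P Q f \<phi> \<and> \<not> f constant_on UNIV \<and> \<not> harmonic_map P Q \<phi>"

end

(*
  The frame sums defining tension, bitension, Laplacian and Ricci curvature are traces of bilinear
  forms, hence may be computed in any basis that is orthonormal at the point under consideration.  In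
  charts, Psi is the product of a change of chart T of M, which is an isometry, and of a representative
  of psi.  Put X = grad log lambda.  Since psi is harmonic, only the fibre part of the
  Levi-Civita connection of the warped product contributes to the tension field, which is (n dT X, 0).
  Hence Psi is harmonic iff X = 0, that is, iff lambda is constant.  Inserting this tension field into
  the f-bitension, and using nabla_X X = 1/2 grad |X|^2, gives (- n dT E, 0), where E is the
  right-hand side of the equation and dT is injective.
*)

theory Submission
  imports Defs
begin


section \<open>Calculus of smooth functions\<close>

text \<open>The definitions sum over a frame fixed by choice, about whose derivatives nothing is
  known, and they quantify over all pairs of charts, so that the identity of M appears as a change
  of coordinates. What helps is that in D(A e) e - A(nabla e e) the derivative of the frame e
  cancels: the trace of the covariant derivative of any smooth field A of linear maps sees e at one
  point only. This serves the tension field (A = dF), the second derivative along a map (A = nabla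
  V) and, via the identity map, the trace for vector fields on M. It also permits vertical frame
  vectors scaled by the constant 1/lambda(x). The constants come from the fibre. The Levi-Civita
  correction of each of the n unit vertical vectors has horizontal part -X; this gives n copies of
  dT X in the tension field and n f nabla_X X in the bitension, whence n/2 before grad |X|^2. The
  Ricci term is curvature of M alone, because the target has no mixed curvature and the tension
  field is horizontal. Connectedness of M leads from X = 0 to a constant lambda.\<close>

abbreviation D :: "('a::euclidean_space \<Rightarrow> 'b::euclidean_space) \<Rightarrow> 'a \<Rightarrow> 'a \<Rightarrow> 'b" where
  "D f x \<equiv> frechet_derivative f (at x)"

text \<open>\<open>frechet_derivative\<close> is a choice among the derivatives at the point, and
  \<open>f\<close> and \<open>g\<close> have the same ones. So the two choices agree even where no
  derivative exists, and local formulas can be substituted under \<open>D\<close>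
  throughout.\<close>

lemma D_cong:
  assumes "open S" "x \<in> S" "\<And>y. y \<in> S \<Longrightarrow> f y = g y"
  shows "D f x = D g x"
proof -
  have "(f has_derivative f') (at x) \<longleftrightarrow> (g has_derivative f') (at x)" for f'
  proof
    assume "(f has_derivative f') (at x)"
    then show "(g has_derivative f') (at x)"
      using assms by (rule has_derivative_transform_within_open)
  next
    assume "(g has_derivative f') (at x)"
    then show "(f has_derivative f') (at x)"
      using assms(1,2) assms(3)[symmetric] by (rule has_derivative_transform_within_open)
  qed
  then show ?thesis by (simp add: frechet_derivative_def)
qed

lemma D_eqI: "(f has_derivative f') (at x) \<Longrightarrow> D f x = f'"
  by (rule frechet_derivative_at[symmetric])

lemma D_eqI_apply: "(f has_derivative f') (at x) \<Longrightarrow> D f x u = f' u"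
  by (simp add: D_eqI)

lemma differentiable_cong_open:
  assumes "open S" "x \<in> S" "\<And>y. y \<in> S \<Longrightarrow> f y = g y" "f differentiable (at x)"
  shows "g differentiable (at x)"
proof -
  obtain f' where "(f has_derivative f') (at x)"
    using assms(4) by (auto simp: differentiable_def)
  then have "(g has_derivative f') (at x)"
    using assms(1,2,3) by (rule has_derivative_transform_within_open)
  then show ?thesis by (auto simp: differentiable_def)
qed

lemma Ck_on_cong:
  assumes "open S" "\<And>x. x \<in> S \<Longrightarrow> f x = g x" "Ck_on k S f"
  shows "Ck_on k S g"
  using assms(2,3)
proof (induction k arbitrary: f g)
  case 0
  show ?case using continuous_on_eq[of S f g] 0(2) 0(1) unfolding Ck_on.simps by blast
next
  case (Suc k)
  have d: "D f x = D g x" if "x \<in> S" for x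
    by (rule D_cong[OF assms(1) that Suc.prems(1)])
  have "Ck_on k S (\<lambda>x. D g x u)" for u
    by (rule Suc.IH[of "\<lambda>x. D f x u"]) (use Suc.prems(2) d in simp_all)
  moreover have "g differentiable (at x)" if "x \<in> S" for x
    using Suc.prems(2) that by (simp add: differentiable_cong_open[OF assms(1) that Suc.prems(1)])
  ultimately show ?case by simp
qed

lemma Ck_on_continuous: "Ck_on k S f \<Longrightarrow> continuous_on S f"
  by (cases k) (auto intro!: continuous_at_imp_continuous_on dest!: bspec
      dest: differentiable_imp_continuous_within)

lemma Ck_on_subset: "Ck_on k S f \<Longrightarrow> T \<subseteq> S \<Longrightarrow> Ck_on k T f"
  by (induction k arbitrary: f) (auto intro: continuous_on_subset)

lemma Ck_on_SucD: "Ck_on (Suc k) S f \<Longrightarrow> Ck_on k S f"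
proof (induction k arbitrary: f)
  case 0
  then show ?case using Ck_on_continuous[of "Suc 0" S f] by simp
next
  case (Suc k)
  have "Ck_on k S (\<lambda>x. D f x u)" for u
    using Suc.prems by (intro Suc.IH) (subst (asm) Ck_on.simps(2), blast)
  then show ?case using Suc.prems by simp
qed

lemma Ck_on_const [simp]: "Ck_on k S (\<lambda>x. c)"
  by (induction k arbitrary: c) auto

lemma Ck_on_bounded_linear:
  assumes "bounded_linear f"
  shows "Ck_on k S f"
proof (cases k)
  case 0
  then show ?thesis using assms by (simp add: linear_continuous_on)
next
  case (Suc n)
  have "(f has_derivative f) (at x)" for x using assms by (rule bounded_linear_imp_has_derivative)
  then have "D f x = f" for x by (rule D_eqI)
  moreover have "f differentiable at x" for x
    using \<open>(f has_derivative f) (at x)\<close> differentiable_def by blast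
  ultimately show ?thesis using Suc by simp
qed

lemma Ck_on_add:
  assumes "open S" "Ck_on k S f" "Ck_on k S g"
  shows "Ck_on k S (\<lambda>x. f x + g x)"
  using assms(2,3)
proof (induction k arbitrary: f g)
  case 0
  then show ?case by (simp add: continuous_on_add)
next
  case (Suc k)
  have d: "D (\<lambda>x. f x + g x) x u = D f x u + D g x u" if "x \<in> S" for x u
  proof -
    have "((\<lambda>x. f x + g x) has_derivative (\<lambda>u. D f x u + D g x u)) (at x)"
      using Suc.prems that by (intro has_derivative_add) (simp_all add: frechet_derivative_works[symmetric])
    then show ?thesis by (rule D_eqI_apply)
  qed
  have "Ck_on k S (\<lambda>x. D (\<lambda>x. f x + g x) x u)" for u
  proof (rule Ck_on_cong[OF assms(1), of "\<lambda>x. D f x u + D g x u"])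
    show "Ck_on k S (\<lambda>x. D f x u + D g x u)" by (rule Suc.IH) (use Suc.prems in simp_all)
  qed (simp add: d)
  then show ?case using Suc.prems by simp
qed

lemma Ck_on_sum:
  assumes "open S" "\<And>i. i \<in> I \<Longrightarrow> Ck_on k S (f i)"
  shows "Ck_on k S (\<lambda>x. \<Sum>i\<in>I. f i x)"
  using assms(2) by (induction I rule: infinite_finite_induct) (simp_all add: Ck_on_add[OF assms(1)])

lemma D_bilinear:
  assumes "bounded_bilinear bl" "f differentiable (at x)" "g differentiable (at x)"
  shows "D (\<lambda>x. bl (f x) (g x)) x u = bl (f x) (D g x u) + bl (D f x u) (g x)"
proof -
  have "((\<lambda>x. bl (f x) (g x)) has_derivative (\<lambda>u. bl (f x) (D g x u) + bl (D f x u) (g x))) (at x)"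
    using assms(2,3) unfolding frechet_derivative_works
    by (rule bounded_bilinear.FDERIV[OF assms(1)])
  then show ?thesis by (rule D_eqI_apply)
qed

lemma Ck_on_bilinear:
  assumes "open S" "bounded_bilinear bl" "Ck_on k S f" "Ck_on k S g"
  shows "Ck_on k S (\<lambda>x. bl (f x) (g x))"
  using assms(3,4)
proof (induction k arbitrary: f g)
  case 0
  then show ?case using bounded_bilinear.continuous_on[OF assms(2)] by auto
next
  case (Suc k)
  have diff: "(\<lambda>x. bl (f x) (g x)) differentiable at x" if "x \<in> S" for x
  proof -
    have "((\<lambda>x. bl (f x) (g x)) has_derivative (\<lambda>u. bl (f x) (D g x u) + bl (D f x u) (g x))) (at x)"
      using Suc.prems that
      by (intro bounded_bilinear.FDERIV[OF assms(2)]) (simp_all add: frechet_derivative_works[symmetric])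
    then show ?thesis using differentiable_def by blast
  qed
  have "Ck_on k S f" "Ck_on k S g" using Suc.prems Ck_on_SucD by blast+
  have "Ck_on k S (\<lambda>x. D (\<lambda>x. bl (f x) (g x)) x u)" for u
  proof (rule Ck_on_cong[OF assms(1), of "\<lambda>x. bl (f x) (D g x u) + bl (D f x u) (g x)"])
    show "bl (f x) (D g x u) + bl (D f x u) (g x) = D (\<lambda>x. bl (f x) (g x)) x u" if "x \<in> S" for x
      using Suc.prems that by (intro D_bilinear[OF assms(2), symmetric]) simp_all
    show "Ck_on k S (\<lambda>x. bl (f x) (D g x u) + bl (D f x u) (g x))"
      using Suc.prems \<open>Ck_on k S f\<close> \<open>Ck_on k S g\<close>
      by (intro Ck_on_add[OF assms(1)] Suc.IH) simp_all
  qed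
  then show ?case using diff by simp
qed

lemma D_compose:
  assumes "f differentiable (at x)" "g differentiable (at (f x))"
  shows "D (\<lambda>x. g (f x)) x u = D g (f x) (D f x u)"
proof -
  have "((\<lambda>x. g (f x)) has_derivative (\<lambda>u. D g (f x) (D f x u))) (at x)"
    using assms by (intro has_derivative_compose[of f _ _ _ g]) (simp_all add: frechet_derivative_works[symmetric])
  then show ?thesis by (rule D_eqI_apply)
qed

lemma D_linear: "f differentiable (at x) \<Longrightarrow> linear (D f x)"
  by (simp add: linear_frechet_derivative)

lemma linear_basis_expansion:
  assumes "linear A"
  shows "A u = (\<Sum>b\<in>Basis. (u \<bullet> b) *\<^sub>R A b)"
  using assms by (subst (1) euclidean_representation[of u, symmetric])
    (simp add: linear_sum linear_scale)

text \<open>The chain rule evaluates \<open>D g (f x)\<close> in a direction that moves with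
  \<open>x\<close>. Expanding this direction in the standard basis leaves derivatives of
  \<open>g\<close> in fixed directions, to which the induction hypothesis applies.\<close>

lemma Ck_on_compose:
  assumes "open S" "Ck_on k S f" "Ck_on k T g" "f ` S \<subseteq> T"
  shows "Ck_on k S (\<lambda>x. g (f x))"
  using assms(2,3)
proof (induction k arbitrary: g)
  case 0
  then show ?case using assms(4) continuous_on_compose2 by (metis Ck_on.simps(1))
next
  case (Suc k)
  have f: "Ck_on k S f" using Suc.prems Ck_on_SucD by blast
  have d: "f differentiable (at x)" "g differentiable (at (f x))" if "x \<in> S" for x
    using Suc.prems that assms(4) by auto
  have diff: "(\<lambda>x. g (f x)) differentiable at x" if "x \<in> S" for x
    using differentiable_chain_at[OF d[OF that]] by (simp add: o_def)
  have "Ck_on k S (\<lambda>x. D (\<lambda>x. g (f x)) x u)" for u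
  proof (rule Ck_on_cong[OF assms(1), of "\<lambda>x. \<Sum>b\<in>Basis. (D f x u \<bullet> b) *\<^sub>R D g (f x) b"])
    show "(\<Sum>b\<in>Basis. (D f x u \<bullet> b) *\<^sub>R D g (f x) b) = D (\<lambda>x. g (f x)) x u" if "x \<in> S" for x
      using linear_basis_expansion[OF D_linear[OF d(2)[OF that]]] D_compose[OF d[OF that]] by metis
    show "Ck_on k S (\<lambda>x. \<Sum>b\<in>Basis. (D f x u \<bullet> b) *\<^sub>R D g (f x) b)"
      using Suc.prems f
      by (intro Ck_on_sum[OF assms(1)] Ck_on_bilinear[OF assms(1) bounded_bilinear_scaleR]
           Ck_on_bilinear[OF assms(1) bounded_bilinear_inner] Ck_on_const Suc.IH) simp_all
  qed
  then show ?case using diff by simp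
qed

section \<open>Closure properties of smooth functions\<close>

lemma smooth_on_cong:
  "open S \<Longrightarrow> (\<And>x. x \<in> S \<Longrightarrow> f x = g x) \<Longrightarrow> smooth_on S f \<Longrightarrow> smooth_on S g"
  unfolding smooth_on_def using Ck_on_cong by blast

lemma smooth_on_subset: "smooth_on S f \<Longrightarrow> T \<subseteq> S \<Longrightarrow> smooth_on T f"
  unfolding smooth_on_def using Ck_on_subset by blast

lemma smooth_on_const [simp]: "smooth_on S (\<lambda>x. c)"
  by (simp add: smooth_on_def)

lemma smooth_on_bounded_linear: "bounded_linear f \<Longrightarrow> smooth_on S f"
  by (simp add: smooth_on_def Ck_on_bounded_linear)

lemma smooth_on_ident [simp]: "smooth_on S (\<lambda>x. x)"
  by (simp add: smooth_on_bounded_linear)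

lemma smooth_on_fst [simp]: "smooth_on S fst" and smooth_on_snd [simp]: "smooth_on S snd"
  by (simp_all add: smooth_on_bounded_linear bounded_linear_fst bounded_linear_snd)

lemma smooth_on_add:
  "open S \<Longrightarrow> smooth_on S f \<Longrightarrow> smooth_on S g \<Longrightarrow> smooth_on S (\<lambda>x. f x + g x)"
  unfolding smooth_on_def using Ck_on_add by blast

lemma smooth_on_sum:
  "open S \<Longrightarrow> (\<And>i. i \<in> I \<Longrightarrow> smooth_on S (f i)) \<Longrightarrow> smooth_on S (\<lambda>x. \<Sum>i\<in>I. f i x)"
  unfolding smooth_on_def by (intro allI Ck_on_sum) simp_all

lemma smooth_on_bilinear:
  "bounded_bilinear bl \<Longrightarrow> open S \<Longrightarrow> smooth_on S f \<Longrightarrow> smooth_on S g \<Longrightarrow> smooth_on S (\<lambda>x. bl (f x) (g x))"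
  unfolding smooth_on_def using Ck_on_bilinear by blast

lemmas smooth_on_scaleR = smooth_on_bilinear[OF bounded_bilinear_scaleR]
lemmas smooth_on_inner = smooth_on_bilinear[OF bounded_bilinear_inner]

lemma smooth_on_mult:
  fixes f g :: "'a::euclidean_space \<Rightarrow> real"
  shows "open S \<Longrightarrow> smooth_on S f \<Longrightarrow> smooth_on S g \<Longrightarrow> smooth_on S (\<lambda>x. f x * g x)"
  using smooth_on_scaleR[of S f g] by simp

lemma smooth_on_power2:
  fixes f :: "'a::euclidean_space \<Rightarrow> real"
  shows "open S \<Longrightarrow> smooth_on S f \<Longrightarrow> smooth_on S (\<lambda>x. (f x)\<^sup>2)"
  by (simp add: power2_eq_square smooth_on_mult)

lemma smooth_on_compose:
  "open S \<Longrightarrow> smooth_on S f \<Longrightarrow> smooth_on T g \<Longrightarrow> f ` S \<subseteq> T \<Longrightarrow> smooth_on S (\<lambda>x. g (f x))"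
  unfolding smooth_on_def using Ck_on_compose by blast

lemma smooth_on_linear_image:
  "bounded_linear h \<Longrightarrow> open S \<Longrightarrow> smooth_on S f \<Longrightarrow> smooth_on S (\<lambda>x. h (f x))"
  using smooth_on_compose[of S f UNIV h] by (simp add: smooth_on_bounded_linear)

lemma smooth_on_minus: "open S \<Longrightarrow> smooth_on S f \<Longrightarrow> smooth_on S (\<lambda>x. - f x)"
  using smooth_on_linear_image[of uminus] bounded_linear_minus[OF bounded_linear_ident] by auto

lemma smooth_on_diff:
  "open S \<Longrightarrow> smooth_on S f \<Longrightarrow> smooth_on S g \<Longrightarrow> smooth_on S (\<lambda>x. f x - g x)"
  using smooth_on_add[of S f "\<lambda>x. - g x"] smooth_on_minus by auto

lemma smooth_on_Pair:
  assumes "open S" "smooth_on S f" "smooth_on S g"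
  shows "smooth_on S (\<lambda>x. (f x, g x))"
proof -
  have "smooth_on S (\<lambda>x. (f x, 0) + (0, g x))"
    using assms
    by (intro smooth_on_add smooth_on_linear_image[of "\<lambda>a. (a, 0)"] smooth_on_linear_image[of "\<lambda>a. (0, a)"])
      (auto intro!: bounded_linear_Pair)
  then show ?thesis by simp
qed

lemma smooth_on_differentiable: "smooth_on S f \<Longrightarrow> x \<in> S \<Longrightarrow> f differentiable (at x)"
  unfolding smooth_on_def by (metis Ck_on.simps(2))

lemma smooth_on_D: "smooth_on S f \<Longrightarrow> smooth_on S (\<lambda>x. D f x u)"
  unfolding smooth_on_def by (metis Ck_on.simps(2))

lemma smooth_on_continuous: "smooth_on S f \<Longrightarrow> continuous_on S f"
  unfolding smooth_on_def by (metis Ck_on.simps(1))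

lemma smooth_on_has_derivative: "smooth_on S f \<Longrightarrow> x \<in> S \<Longrightarrow> (f has_derivative D f x) (at x)"
  using smooth_on_differentiable frechet_derivative_works by blast

text \<open>A bootstrap: if the derivative is at least as regular as the function, each order of
  differentiability yields the next. This treats \<open>inverse\<close>, \<open>ln\<close> and
  \<open>sqrt\<close>, whose derivatives are expressed through \<open>inverse\<close> and
  \<open>sqrt\<close>.\<close>

lemma smooth_on_open_DERIV:
  fixes f :: "real \<Rightarrow> real"
  assumes "\<And>x. x \<in> S \<Longrightarrow> (f has_field_derivative f' x) (at x)" "open S"
    and "\<And>k. Ck_on k S f \<Longrightarrow> Ck_on k S f'"
  shows "smooth_on S f"
proof -
  have h: "(f has_derivative (\<lambda>u. f' x * u)) (at x)" if "x \<in> S" for x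
    using assms(1)[OF that] by (simp add: has_field_derivative_def)
  have "Ck_on k S f" for k
  proof (induction k)
    case 0
    then show ?case using assms(1) by (auto intro!: continuous_at_imp_continuous_on DERIV_isCont)
  next
    case (Suc k)
    have "Ck_on k S (\<lambda>x. D f x u)" for u
    proof (rule Ck_on_cong[OF assms(2), of "\<lambda>x. f' x * u"])
      show "f' x * u = D f x u" if "x \<in> S" for x using D_eqI[OF h[OF that]] by simp
      show "Ck_on k S (\<lambda>x. f' x * u)"
        using Ck_on_bilinear[OF assms(2) bounded_bilinear_mult assms(3)[OF Suc] Ck_on_const] .
    qed
    then show ?case using h by (auto simp: differentiable_def)
  qed
  then show ?thesis by (simp add: smooth_on_def)
qed

lemma smooth_on_inverse: "smooth_on {0<..} (inverse :: real \<Rightarrow> real)"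
proof (rule smooth_on_open_DERIV[where f' = "\<lambda>x. - (inverse x * inverse x)"])
  show "(inverse has_field_derivative - (inverse x * inverse x)) (at x)" if "x \<in> {0<..}" for x :: real
    using that by (auto intro!: derivative_eq_intros simp: power2_eq_square)
  show "Ck_on k {0<..} (\<lambda>x::real. - (inverse x * inverse x))" if "Ck_on k {0<..} (inverse::real\<Rightarrow>real)" for k
    using Ck_on_bilinear[OF _ bounded_bilinear_mult Ck_on_const[of _ _ "-1::real"]
        Ck_on_bilinear[OF _ bounded_bilinear_mult that that]] by simp
qed simp

lemma smooth_on_divide:
  fixes f g :: "'a::euclidean_space \<Rightarrow> real"
  assumes "open S" "smooth_on S f" "smooth_on S g" "\<And>x. x \<in> S \<Longrightarrow> g x > 0"
  shows "smooth_on S (\<lambda>x. f x / g x)"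
  using smooth_on_mult[OF assms(1,2) smooth_on_compose[OF assms(1,3) smooth_on_inverse]] assms(4)
  by (auto simp: divide_inverse)

lemma smooth_on_ln:
  assumes "open S" "smooth_on S f" "\<And>x. x \<in> S \<Longrightarrow> f x > (0::real)"
  shows "smooth_on S (\<lambda>x. ln (f x))"
proof (rule smooth_on_compose[OF assms(1,2), of "{0<..}" ln])
  show "smooth_on {0<..} (ln :: real \<Rightarrow> real)"
    using smooth_on_inverse unfolding smooth_on_def
    by (intro smooth_on_open_DERIV[where f' = inverse, unfolded smooth_on_def]) (auto intro!: derivative_eq_intros simp: inverse_eq_divide)
qed (use assms in auto)

lemma smooth_on_sqrt:
  assumes "open S" "smooth_on S f" "\<And>x. x \<in> S \<Longrightarrow> f x > (0::real)"
  shows "smooth_on S (\<lambda>x. sqrt (f x))"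
proof (rule smooth_on_compose[OF assms(1,2), of "{0<..}" sqrt])
  show "smooth_on {0<..} sqrt"
  proof (rule smooth_on_open_DERIV[where f' = "\<lambda>x. inverse (sqrt x) * (1/2)"])
    show "(sqrt has_field_derivative inverse (sqrt x) * (1/2)) (at x)" if "x \<in> {0<..}" for x :: real
      using that by (auto intro!: derivative_eq_intros)
    show "Ck_on k {0<..} (\<lambda>x. inverse (sqrt x) * (1/2))" if "Ck_on k {0<..} sqrt" for k
      using that smooth_on_inverse
      by (intro Ck_on_bilinear[OF _ bounded_bilinear_mult] Ck_on_const
          Ck_on_compose[of "{0<..}" k sqrt "{0<..}" inverse]) (auto simp: smooth_on_def)
  qed simp
qed (use assms in auto)

section \<open>Rules for computing derivatives\<close>

lemma D_add:
  "f differentiable (at x) \<Longrightarrow> g differentiable (at x) \<Longrightarrow> D (\<lambda>x. f x + g x) x u = D f x u + D g x u"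
  using D_eqI[OF has_derivative_add[of f "D f x" "at x" g "D g x"]]
  by (simp add: frechet_derivative_works[symmetric])

lemma D_bounded_linear:
  assumes "bounded_linear h" "f differentiable (at x)"
  shows "D (\<lambda>x. h (f x)) x u = h (D f x u)"
proof -
  have "((\<lambda>x. h (f x)) has_derivative (\<lambda>u. h (D f x u))) (at x)"
    using assms(2) unfolding frechet_derivative_works
    by (rule bounded_linear.has_derivative[OF assms(1)])
  then show ?thesis by (rule D_eqI_apply)
qed

lemma D_sum:
  assumes "\<And>i. i \<in> I \<Longrightarrow> f i differentiable (at x)"
  shows "D (\<lambda>x. \<Sum>i\<in>I. f i x) x u = (\<Sum>i\<in>I. D (f i) x u)"
proof -
  have "((\<lambda>x. \<Sum>i\<in>I. f i x) has_derivative (\<lambda>u. \<Sum>i\<in>I. D (f i) x u)) (at x)"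
    using assms by (intro has_derivative_sum) (simp add: frechet_derivative_works[symmetric])
  then show ?thesis by (rule D_eqI_apply)
qed

lemma D_scaleR:
  "f differentiable (at x) \<Longrightarrow> g differentiable (at x) \<Longrightarrow>
   D (\<lambda>x. f x *\<^sub>R g x) x u = f x *\<^sub>R D g x u + D f x u *\<^sub>R g x"
  by (rule D_bilinear[OF bounded_bilinear_scaleR])

lemma D_mult:
  fixes f g :: "'a::euclidean_space \<Rightarrow> real"
  shows "f differentiable (at x) \<Longrightarrow> g differentiable (at x) \<Longrightarrow>
   D (\<lambda>x. f x * g x) x u = f x * D g x u + D f x u * g x"
  by (rule D_bilinear[OF bounded_bilinear_mult])

lemma D_power2:
  fixes f :: "'a::euclidean_space \<Rightarrow> real"
  shows "f differentiable (at x) \<Longrightarrow> D (\<lambda>x. (f x)\<^sup>2) x u = 2 * f x * D f x u"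
  by (simp add: power2_eq_square D_mult)

lemma D_Pair:
  assumes "f differentiable (at x)" "g differentiable (at x)"
  shows "D (\<lambda>x. (f x, g x)) x u = (D f x u, D g x u)"
proof -
  have "((\<lambda>x. (f x, g x)) has_derivative (\<lambda>u. (D f x u, D g x u))) (at x)"
    using assms by (intro has_derivative_Pair) (simp_all add: frechet_derivative_works[symmetric])
  then show ?thesis by (rule D_eqI_apply)
qed

lemma D_ln:
  assumes "f differentiable (at x)" "f x > (0::real)"
  shows "D (\<lambda>x. ln (f x)) x u = D f x u / f x"
proof -
  have "((\<lambda>x. ln (f x)) has_derivative (\<lambda>u. D f x u * inverse (f x))) (at x)"
    using assms by (intro has_derivative_ln) (simp_all add: frechet_derivative_works[symmetric])
  then show ?thesis using D_eqI by (metis divide_inverse)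
qed

lemma D_compose_fst:
  "f differentiable (at (fst z)) \<Longrightarrow> D (\<lambda>z. f (fst z)) z u = D f (fst z) (fst u)"
  using D_compose[of fst z f u] D_eqI[OF bounded_linear_imp_has_derivative[OF bounded_linear_fst, of "at z"]]
  by (auto simp: differentiable_def intro: bounded_linear_imp_has_derivative bounded_linear_fst)

lemma D_compose_snd:
  "f differentiable (at (snd z)) \<Longrightarrow> D (\<lambda>z. f (snd z)) z u = D f (snd z) (snd u)"
  using D_compose[of snd z f u] D_eqI[OF bounded_linear_imp_has_derivative[OF bounded_linear_snd, of "at z"]]
  by (auto simp: differentiable_def intro: bounded_linear_imp_has_derivative bounded_linear_snd)

lemma D_partial_fst:
  assumes "f differentiable (at (x, y))"
  shows "D (\<lambda>x. f (x, y)) x u = D f (x, y) (u, 0)"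
proof -
  have "((\<lambda>x. (x, y)) has_derivative (\<lambda>u. (u, 0))) (at x)"
    by (auto intro!: derivative_eq_intros)
  then show ?thesis
    using D_compose[of "\<lambda>x. (x, y)" x f u] assms D_eqI by (metis (no_types, lifting) differentiable_def)
qed


section \<open>Symmetry of second derivatives\<close>

lemma DERIV_along_line:
  fixes f :: "'a::euclidean_space \<Rightarrow> real"
  assumes "f differentiable (at (p + a *\<^sub>R u))"
  shows "((\<lambda>a. f (p + a *\<^sub>R u)) has_real_derivative D f (p + a *\<^sub>R u) u) (at a)"
proof -
  have "((\<lambda>a. p + a *\<^sub>R u) has_derivative (\<lambda>t. t *\<^sub>R u)) (at a)"
    by (auto intro!: derivative_eq_intros)
  moreover have "(f has_derivative D f (p + a *\<^sub>R u)) (at (p + a *\<^sub>R u))"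
    using assms by (simp add: frechet_derivative_works[symmetric])
  ultimately have "((\<lambda>a. f (p + a *\<^sub>R u)) has_derivative (\<lambda>t. D f (p + a *\<^sub>R u) (t *\<^sub>R u))) (at a)"
    by (rule has_derivative_compose)
  moreover have "(\<lambda>t. D f (p + a *\<^sub>R u) (t *\<^sub>R u)) = (*) (D f (p + a *\<^sub>R u) u)"
    using linear_scale[OF D_linear[OF assms]] by auto
  ultimately show ?thesis by (simp add: has_field_derivative_def)
qed

text \<open>The mean value theorem is used twice: along \<open>u\<close> for the difference between
  \<open>f\<close> shifted by \<open>s *\<^sub>R v\<close> and \<open>f\<close> itself, then along
  \<open>v\<close> for the derivative of \<open>f\<close> in direction \<open>u\<close>.\<close>

lemma second_difference_mean_value:
  fixes f :: "'a::euclidean_space \<Rightarrow> real"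
  assumes "smooth_on S f" "s > 0"
    and S: "\<And>a b. 0 \<le> a \<Longrightarrow> a \<le> s \<Longrightarrow> 0 \<le> b \<Longrightarrow> b \<le> s \<Longrightarrow> x + a *\<^sub>R u + b *\<^sub>R v \<in> S"
  obtains a b where "0 \<le> a" "a \<le> s" "0 \<le> b" "b \<le> s"
    "f (x + s *\<^sub>R u + s *\<^sub>R v) - f (x + s *\<^sub>R u) - f (x + s *\<^sub>R v) + f x
      = s * (s * D (\<lambda>y. D f y u) (x + a *\<^sub>R u + b *\<^sub>R v) v)"
proof -
  have dv: "((\<lambda>a. f (x + a *\<^sub>R u + b *\<^sub>R v)) has_real_derivative D f (x + a *\<^sub>R u + b *\<^sub>R v) u) (at a)"
    if "0 \<le> a" "a \<le> s" "0 \<le> b" "b \<le> s" for a b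
    using DERIV_along_line[of f "x + b *\<^sub>R v" a u] smooth_on_differentiable[OF assms(1) S[OF that]]
    by (simp add: algebra_simps)
  have "((\<lambda>a. f (x + a *\<^sub>R u + s *\<^sub>R v) - f (x + a *\<^sub>R u)) has_real_derivative
      D f (x + a *\<^sub>R u + s *\<^sub>R v) u - D f (x + a *\<^sub>R u) u) (at a)" if "0 \<le> a" "a \<le> s" for a
    using DERIV_diff[OF dv[OF that, of s] dv[OF that, of 0]] assms(2) by simp
  from MVT2[OF assms(2) this] obtain a where a: "0 < a" "a < s" and
    1: "f (x + s *\<^sub>R u + s *\<^sub>R v) - f (x + s *\<^sub>R u) - (f (x + s *\<^sub>R v) - f x)
        = s * (D f (x + a *\<^sub>R u + s *\<^sub>R v) u - D f (x + a *\<^sub>R u) u)"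
    by auto
  have "((\<lambda>b. D f (x + a *\<^sub>R u + b *\<^sub>R v) u) has_real_derivative
      D (\<lambda>y. D f y u) (x + a *\<^sub>R u + b *\<^sub>R v) v) (at b)" if "0 \<le> b" "b \<le> s" for b
    using smooth_on_differentiable[OF smooth_on_D[OF assms(1)] S[of a b]] that a
    by (intro DERIV_along_line) auto
  from MVT2[OF assms(2) this] obtain b where "0 < b" "b < s" and
    2: "D f (x + a *\<^sub>R u + s *\<^sub>R v) u - D f (x + a *\<^sub>R u) u = s * D (\<lambda>y. D f y u) (x + a *\<^sub>R u + b *\<^sub>R v) v"
    by auto
  show ?thesis using that[of a b] 1 2 a \<open>0 < b\<close> \<open>b < s\<close> by simp
qed

text \<open>The second difference over a small parallelogram does not depend on the order of its
  sides. It equals, up to the factor \<open>s * s\<close>, either mixed derivative at some nearby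
  point, and continuity of both rules out a gap at \<open>x\<close>.\<close>

lemma D_symmetric_real:
  fixes f :: "'a::euclidean_space \<Rightarrow> real"
  assumes "open S" "smooth_on S f" "x \<in> S"
  shows "D (\<lambda>y. D f y v) x u = D (\<lambda>y. D f y u) x v"
proof (rule ccontr)
  assume ne: "\<not> ?thesis"
  define P where "P = (\<lambda>y. D (\<lambda>y. D f y u) y v)"
  define Q where "Q = (\<lambda>y. D (\<lambda>y. D f y v) y u)"
  \<comment> \<open>Half the gap: if a common value lies within \<open>e\<close> of both
    \<open>P x\<close> and \<open>Q x\<close>, the gap is smaller than itself.\<close>
  define e where "e = \<bar>P x - Q x\<bar> / 2"
  have e: "e > 0" using ne by (auto simp: e_def P_def Q_def)
  have "continuous_on S P" "continuous_on S Q"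
    unfolding P_def Q_def using assms(2) by (simp_all add: smooth_on_continuous smooth_on_D)
  then have "continuous (at x) P" "continuous (at x) Q"
    using assms by (simp_all add: continuous_on_eq_continuous_at)
  then have "\<exists>d>0. \<forall>y. dist y x < d \<longrightarrow> dist (P y) (P x) < e"
    and "\<exists>d>0. \<forall>y. dist y x < d \<longrightarrow> dist (Q y) (Q x) < e"
    using e by (simp_all add: continuous_at_eps_delta)
  then obtain d1 d2 where d1: "d1 > 0" "\<And>y. dist y x < d1 \<Longrightarrow> dist (P y) (P x) < e"
    and d2: "d2 > 0" "\<And>y. dist y x < d2 \<Longrightarrow> dist (Q y) (Q x) < e"
    by blast
  obtain d3 where d3: "d3 > 0" "ball x d3 \<subseteq> S" using assms openE by blast
  define d where "d = min d1 (min d2 d3)"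
  \<comment> \<open>With this side length the whole parallelogram stays at distance less than
    \<open>d\<close> from \<open>x\<close>; the summand 1 covers \<open>u = v = 0\<close> and makes
    the estimate strict.\<close>
  define s where "s = d / (norm u + norm v + 1)"
  have pos: "norm u + norm v + 1 > 0" using norm_ge_zero[of u] norm_ge_zero[of v] by linarith
  have d: "d > 0" using d1 d2 d3 by (simp add: d_def)
  then have s: "s > 0" using pos by (simp add: s_def)
  have near: "dist (x + a *\<^sub>R u + b *\<^sub>R v) x < d" if "0 \<le> a" "a \<le> s" "0 \<le> b" "b \<le> s" for a b
  proof -
    have "dist (x + a *\<^sub>R u + b *\<^sub>R v) x \<le> a * norm u + b * norm v"
      using norm_triangle_ineq[of "a *\<^sub>R u" "b *\<^sub>R v"] that by (simp add: dist_norm add.assoc)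
    also have "\<dots> \<le> s * norm u + s * norm v" using that by (intro add_mono mult_right_mono) auto
    also have "\<dots> < s * (norm u + norm v + 1)" using s by (simp add: algebra_simps)
    also have "\<dots> = d" using pos by (simp add: s_def)
    finally show ?thesis .
  qed
  have S: "x + a *\<^sub>R u + b *\<^sub>R v \<in> S" if "0 \<le> a" "a \<le> s" "0 \<le> b" "b \<le> s" for a b
  proof -
    have "x + a *\<^sub>R u + b *\<^sub>R v \<in> ball x d3"
      using near[OF that] by (simp add: d_def mem_ball dist_commute)
    then show ?thesis using d3(2) by blast
  qed
  obtain a b where ab: "0 \<le> a" "a \<le> s" "0 \<le> b" "b \<le> s"
    and 1: "f (x + s *\<^sub>R u + s *\<^sub>R v) - f (x + s *\<^sub>R u) - f (x + s *\<^sub>R v) + f x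
      = s * (s * P (x + a *\<^sub>R u + b *\<^sub>R v))"
    using second_difference_mean_value[OF assms(2) s S] unfolding P_def by blast
  have S': "x + a *\<^sub>R v + b *\<^sub>R u \<in> S" if "0 \<le> a" "a \<le> s" "0 \<le> b" "b \<le> s" for a b
    using S[OF that(3,4) that(1,2)] by (simp add: algebra_simps)
  obtain a' b' where ab': "0 \<le> a'" "a' \<le> s" "0 \<le> b'" "b' \<le> s"
    and 2: "f (x + s *\<^sub>R v + s *\<^sub>R u) - f (x + s *\<^sub>R v) - f (x + s *\<^sub>R u) + f x
      = s * (s * Q (x + a' *\<^sub>R v + b' *\<^sub>R u))"
    using second_difference_mean_value[OF assms(2) s S'] unfolding Q_def by blast
  have comm: "x + s *\<^sub>R v + s *\<^sub>R u = x + s *\<^sub>R u + s *\<^sub>R v"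
    "x + a' *\<^sub>R v + b' *\<^sub>R u = x + b' *\<^sub>R u + a' *\<^sub>R v" by (simp_all add: algebra_simps)
  have "s * (s * P (x + a *\<^sub>R u + b *\<^sub>R v)) = s * (s * Q (x + b' *\<^sub>R u + a' *\<^sub>R v))"
    using 1 2 unfolding comm by linarith
  then have "P (x + a *\<^sub>R u + b *\<^sub>R v) = Q (x + b' *\<^sub>R u + a' *\<^sub>R v)" using s by simp
  moreover have "dist (P (x + a *\<^sub>R u + b *\<^sub>R v)) (P x) < e"
    using near[OF ab] by (intro d1) (simp add: d_def)
  moreover have "dist (Q (x + b' *\<^sub>R u + a' *\<^sub>R v)) (Q x) < e"
    using near[OF ab'(3,4,1,2)] by (intro d2) (simp add: d_def)
  ultimately have "\<bar>P x - Q x\<bar> < 2 * e" by (simp add: dist_real_def)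
  then show False by (simp add: e_def)
qed

lemma D_symmetric:
  fixes f :: "'a::euclidean_space \<Rightarrow> 'b::euclidean_space"
  assumes "open S" "smooth_on S f" "x \<in> S"
  shows "D (\<lambda>y. D f y v) x u = D (\<lambda>y. D f y u) x v"
proof (rule euclidean_eqI)
  fix b :: 'b assume "b \<in> Basis"
  let ?g = "\<lambda>y. f y \<bullet> b"
  have bl: "bounded_linear (\<lambda>z::'b. z \<bullet> b)" by (rule bounded_linear_inner_left)
  have g: "smooth_on S ?g" by (rule smooth_on_linear_image[OF bl assms(1,2)])
  have 1: "D ?g y w = D f y w \<bullet> b" if "y \<in> S" for y w
    using D_bounded_linear[OF bl smooth_on_differentiable[OF assms(2) that]] .
  have 2: "D (\<lambda>y. D ?g y w) x z = D (\<lambda>y. D f y w) x z \<bullet> b" for w z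
  proof -
    have "D (\<lambda>y. D ?g y w) x z = D (\<lambda>y. D f y w \<bullet> b) x z"
      using D_cong[OF assms(1,3), of "\<lambda>y. D ?g y w" "\<lambda>y. D f y w \<bullet> b"] 1 by simp
    also have "\<dots> = D (\<lambda>y. D f y w) x z \<bullet> b"
      by (rule D_bounded_linear[OF bl smooth_on_differentiable[OF smooth_on_D[OF assms(2)] assms(3)]])
    finally show ?thesis .
  qed
  show "D (\<lambda>y. D f y v) x u \<bullet> b = D (\<lambda>y. D f y u) x v \<bullet> b"
    using D_symmetric_real[OF assms(1) g assms(3), of v u] 2 by simp
qed

section \<open>Fields of linear and bilinear maps\<close>

text \<open>Smoothness is tested on constant vectors, so that every function to be differentiated
  has values in a Euclidean space; arguments varying with the point are recovered by
  \<open>linear_field_smooth\<close> and \<open>D_linear_field\<close>.\<close>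

definition linear_field_on :: "'a::euclidean_space set \<Rightarrow> ('a \<Rightarrow> 'b::euclidean_space \<Rightarrow> 'c::euclidean_space) \<Rightarrow> bool"
  where "linear_field_on S A \<longleftrightarrow> (\<forall>x\<in>S. linear (A x)) \<and> (\<forall>u. smooth_on S (\<lambda>x. A x u))"

definition bilinear_field_on ::
  "'a::euclidean_space set \<Rightarrow> ('a \<Rightarrow> 'b::euclidean_space \<Rightarrow> 'c::euclidean_space \<Rightarrow> 'd::euclidean_space) \<Rightarrow> bool"
  where "bilinear_field_on S B \<longleftrightarrow> (\<forall>x\<in>S. bilinear (B x)) \<and> (\<forall>u v. smooth_on S (\<lambda>x. B x u v))"

lemma linear_field_smooth:
  assumes "open S" "linear_field_on S A" "smooth_on S f"
  shows "smooth_on S (\<lambda>x. A x (f x))"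
proof (rule smooth_on_cong[OF assms(1), of "\<lambda>x. \<Sum>b\<in>Basis. (f x \<bullet> b) *\<^sub>R A x b"])
  show "(\<Sum>b\<in>Basis. (f x \<bullet> b) *\<^sub>R A x b) = A x (f x)" if "x \<in> S" for x
    using assms(2) that linear_basis_expansion[of "A x" "f x"] by (simp add: linear_field_on_def)
  show "smooth_on S (\<lambda>x. \<Sum>b\<in>Basis. (f x \<bullet> b) *\<^sub>R A x b)"
    using assms by (intro smooth_on_sum smooth_on_scaleR smooth_on_inner) (auto simp: linear_field_on_def)
qed

text \<open>In a basis the varying argument turns into finitely many scalar coefficients, and the
  product rule applies to each term.\<close>

lemma D_linear_field_expansion:
  assumes "open S" "linear_field_on S A" "smooth_on S f" "x \<in> S"
  shows "D (\<lambda>y. A y (f y)) x u = (\<Sum>b\<in>Basis. (f x \<bullet> b) *\<^sub>R D (\<lambda>y. A y b) x u) + A x (D f x u)"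
proof -
  have lin: "linear (A y)" if "y \<in> S" for y using assms(2) that by (simp add: linear_field_on_def)
  have dA: "(\<lambda>y. A y b) differentiable (at x)" for b
    using assms(2,4) smooth_on_differentiable[of S "\<lambda>y. A y b" x] by (simp add: linear_field_on_def)
  have df: "f differentiable (at x)" using assms smooth_on_differentiable by blast
  have dfb: "(\<lambda>y. f y \<bullet> b) differentiable (at x)" for b
    by (rule smooth_on_differentiable[OF smooth_on_linear_image[OF bounded_linear_inner_left assms(1,3)] assms(4)])
  have "D (\<lambda>y. A y (f y)) x u = D (\<lambda>y. \<Sum>b\<in>Basis. (f y \<bullet> b) *\<^sub>R A y b) x u"
    by (rule fun_cong[OF D_cong[OF assms(1,4)]]) (rule linear_basis_expansion[OF lin])
  also have "\<dots> = (\<Sum>b\<in>Basis. D (\<lambda>y. (f y \<bullet> b) *\<^sub>R A y b) x u)"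
    using dA dfb by (intro D_sum differentiable_scaleR)
  also have "\<dots> = (\<Sum>b\<in>Basis. (f x \<bullet> b) *\<^sub>R D (\<lambda>y. A y b) x u + (D f x u \<bullet> b) *\<^sub>R A x b)"
    using dA dfb df by (simp add: D_scaleR D_bounded_linear[OF bounded_linear_inner_left])
  also have "\<dots> = (\<Sum>b\<in>Basis. (f x \<bullet> b) *\<^sub>R D (\<lambda>y. A y b) x u) + A x (D f x u)"
    by (subst linear_basis_expansion[OF lin[OF assms(4)], of "D f x u"]) (simp add: sum.distrib)
  finally show ?thesis .
qed

lemma D_linear_field_const:
  assumes "open S" "linear_field_on S A" "x \<in> S"
  shows "D (\<lambda>y. A y v) x u = (\<Sum>b\<in>Basis. (v \<bullet> b) *\<^sub>R D (\<lambda>y. A y b) x u)"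
proof -
  have "linear (A x)" using assms by (simp add: linear_field_on_def)
  then show ?thesis
    using D_linear_field_expansion[OF assms(1,2) smooth_on_const assms(3), of v u] by (simp add: linear_0)
qed

text \<open>The Leibniz rule behind all later covariant computations: the first term keeps the
  argument frozen at \<open>x\<close>, the second keeps the linear map frozen.\<close>

lemma D_linear_field:
  assumes "open S" "linear_field_on S A" "smooth_on S f" "x \<in> S"
  shows "D (\<lambda>y. A y (f y)) x u = D (\<lambda>y. A y (f x)) x u + A x (D f x u)"
  using D_linear_field_expansion[OF assms] D_linear_field_const[OF assms(1,2,4), of "f x"] by simp

lemma linear_D_linear_field:
  assumes "open S" "linear_field_on S A" "x \<in> S"
  shows "linear (\<lambda>v. D (\<lambda>y. A y v) x u)"
proof -
  have "(\<lambda>v. D (\<lambda>y. A y v) x u) = (\<lambda>v. \<Sum>b\<in>Basis. (v \<bullet> b) *\<^sub>R D (\<lambda>y. A y b) x u)"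
    by (rule ext, rule D_linear_field_const) (rule assms)+
  moreover have "linear (\<lambda>v. \<Sum>b\<in>Basis. (v \<bullet> b) *\<^sub>R D (\<lambda>y. A y b) x u)"
    by (auto intro!: linearI simp: inner_add_left scaleR_add_left sum.distrib scaleR_sum_right)
  ultimately show ?thesis by (simp only:)
qed

lemma linear_field_D_const:
  assumes "open S" "linear_field_on S A"
  shows "linear_field_on S (\<lambda>x v. D (\<lambda>y. A y v) x u)"
  unfolding linear_field_on_def
proof (intro conjI ballI allI)
  show "linear (\<lambda>v. D (\<lambda>y. A y v) x u)" if "x \<in> S" for x
    by (rule linear_D_linear_field[OF assms that])
  show "smooth_on S (\<lambda>x. D (\<lambda>y. A y v) x u)" for v
    using assms(2) by (intro smooth_on_D) (simp add: linear_field_on_def)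
qed

lemma linear_field_D:
  assumes "smooth_on S f"
  shows "linear_field_on S (D f)"
  using assms by (auto simp: linear_field_on_def intro: D_linear smooth_on_differentiable smooth_on_D)

lemma bilinear_field_left:
  assumes "open S" "bilinear_field_on S B" "smooth_on S g"
  shows "linear_field_on S (\<lambda>x u. B x u (g x))"
proof -
  have "linear_field_on S (\<lambda>x. B x u)" for u
    using assms(2) by (simp add: bilinear_field_on_def linear_field_on_def bilinear_def)
  from linear_field_smooth[OF assms(1) this assms(3)]
  show ?thesis using assms(2) by (simp add: bilinear_field_on_def linear_field_on_def bilinear_def)
qed

lemma bilinear_field_right:
  assumes "open S" "bilinear_field_on S B" "smooth_on S f"
  shows "linear_field_on S (\<lambda>x v. B x (f x) v)"
proof -
  have "bilinear_field_on S (\<lambda>x u v. B x v u)"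
    using assms(2) by (simp add: bilinear_field_on_def bilinear_def)
  from bilinear_field_left[OF assms(1) this assms(3)] show ?thesis .
qed

lemma bilinear_field_smooth:
  assumes "open S" "bilinear_field_on S B" "smooth_on S f" "smooth_on S g"
  shows "smooth_on S (\<lambda>x. B x (f x) (g x))"
  using linear_field_smooth[OF assms(1) bilinear_field_left[OF assms(1,2,4)] assms(3)] .

lemma D_bilinear_field:
  assumes "open S" "bilinear_field_on S B" "smooth_on S f" "smooth_on S g" "x \<in> S"
  shows "D (\<lambda>y. B y (f y) (g y)) x u
    = D (\<lambda>y. B y (f x) (g x)) x u + B x (D f x u) (g x) + B x (f x) (D g x u)"
  using D_linear_field[OF assms(1) bilinear_field_left[OF assms(1,2,4)] assms(3,5), of u]
    D_linear_field[OF assms(1) bilinear_field_right[OF assms(1,2) smooth_on_const] assms(4,5), of "f x" u]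
  by simp

lemma bilinear_D_bilinear_field:
  assumes "open S" "bilinear_field_on S B" "x \<in> S"
  shows "bilinear (\<lambda>a b. D (\<lambda>y. B y a b) x u)"
  unfolding bilinear_def
  using linear_D_linear_field[OF assms(1) bilinear_field_left[OF assms(1,2) smooth_on_const] assms(3)]
    linear_D_linear_field[OF assms(1) bilinear_field_right[OF assms(1,2) smooth_on_const] assms(3)]
  by blast

lemma linear_field_compose:
  assumes "open W" "linear_field_on S A" "smooth_on W f" "f ` W \<subseteq> S"
  shows "linear_field_on W (\<lambda>x. A (f x))"
  unfolding linear_field_on_def
proof (intro conjI ballI allI)
  show "linear (A (f x))" if "x \<in> W" for x
    using assms(2,4) that by (auto simp: linear_field_on_def)
  show "smooth_on W (\<lambda>x. A (f x) u)" for u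
    using assms(2) by (intro smooth_on_compose[OF assms(1,3) _ assms(4)]) (simp add: linear_field_on_def)
qed

lemma bilinear_field_compose:
  assumes "open W" "bilinear_field_on S B" "smooth_on W f" "f ` W \<subseteq> S"
  shows "bilinear_field_on W (\<lambda>x. B (f x))"
  unfolding bilinear_field_on_def
proof (intro conjI ballI allI)
  show "bilinear (B (f x))" if "x \<in> W" for x
    using assms(2,4) that by (auto simp: bilinear_field_on_def)
  show "smooth_on W (\<lambda>x. B (f x) u v)" for u v
    using assms(2) by (intro smooth_on_compose[OF assms(1,3) _ assms(4), of "\<lambda>z. B z u v"])
      (simp add: bilinear_field_on_def)
qed

lemma D_field_compose:
  assumes "smooth_on W f" "x \<in> W" "smooth_on S (\<lambda>x. B x a b)" "f x \<in> S"
  shows "D (\<lambda>y. B (f y) a b) x u = D (\<lambda>z. B z a b) (f x) (D f x u)"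
  by (rule D_compose[of f x "\<lambda>z. B z a b" u])
    (rule smooth_on_differentiable[OF assms(1,2)] smooth_on_differentiable[OF assms(3,4)])+

section \<open>Orthonormal frames and traces\<close>

definition inner_form :: "('e::euclidean_space \<Rightarrow> 'e \<Rightarrow> real) \<Rightarrow> bool" where
  "inner_form Q \<longleftrightarrow> bilinear Q \<and> (\<forall>u v. Q u v = Q v u) \<and> (\<forall>u. u \<noteq> 0 \<longrightarrow> Q u u > 0)"

text \<open>A condition at a single point, in contrast to \<open>orthonormal_frame_on\<close>; it
  lets a basis be adapted to the point at which a trace is taken.\<close>

definition orthonormal_for :: "('e::euclidean_space \<Rightarrow> 'e \<Rightarrow> real) \<Rightarrow> ('e \<Rightarrow> 'e) \<Rightarrow> bool" where
  "orthonormal_for Q e \<longleftrightarrow> (\<forall>b\<in>Basis. \<forall>c\<in>Basis. Q (e b) (e c) = (if b = c then 1 else 0))"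

lemma inner_form_eqI:
  assumes "inner_form Q" "\<And>z. Q w z = Q w' z"
  shows "w = w'"
proof -
  have "bilinear Q" using assms(1) by (simp add: inner_form_def)
  then have "Q (w - w') (w - w') = 0"
    using assms(2)[of "w - w'"] bilinear_lsub[of Q w w' "w - w'"] by simp
  then show ?thesis using assms(1) unfolding inner_form_def by (metis less_irrefl right_minus_eq)
qed

lemma bilinear_sum_left: "bilinear Q \<Longrightarrow> Q (\<Sum>i\<in>I. f i) v = (\<Sum>i\<in>I. Q (f i) v)"
  unfolding bilinear_def using linear_sum[of "\<lambda>u. Q u v" f I] by auto

text \<open>Pairing with \<open>e\<close> recovers the coefficients of a linear combination, so the
  map \<open>L\<close> sending the standard basis to \<open>e\<close> is injective. Between equal
  dimensions it is then surjective, and every \<open>u\<close> is such a combination.\<close>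

lemma orthonormal_expansion:
  assumes "inner_form Q" "orthonormal_for Q e"
  shows "u = (\<Sum>b\<in>Basis. Q u (e b) *\<^sub>R e b)"
proof -
  have bl: "bilinear Q" using assms by (simp add: inner_form_def)
  have coeff: "Q (\<Sum>b\<in>Basis. c b *\<^sub>R e b) (e a) = c a" if "a \<in> Basis" for c a
  proof -
    have "Q (\<Sum>b\<in>Basis. c b *\<^sub>R e b) (e a) = (\<Sum>b\<in>Basis. c b * (if b = a then 1 else 0))"
      using assms(2) that unfolding bilinear_sum_left[OF bl] 
      by (intro sum.cong) (auto simp: bilinear_lmul[OF bl] orthonormal_for_def)
    also have "\<dots> = c a" using that by (simp add: sum.delta if_distrib[of "(*) _"] cong: if_cong)
    finally show ?thesis .
  qed
  define L where "L = (\<lambda>w. \<Sum>b\<in>Basis. (w \<bullet> b) *\<^sub>R e b)"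
  have lin: "linear L" unfolding L_def
    by (auto intro!: linearI simp: inner_add_left scaleR_add_left sum.distrib scaleR_sum_right)
  have "w = 0" if "L w = 0" for w
  proof -
    have "w \<bullet> a = 0" if "a \<in> Basis" for a
      using coeff[OF that, of "\<lambda>b. w \<bullet> b"] \<open>L w = 0\<close> bilinear_lzero[OF bl] by (simp add: L_def)
    then show ?thesis using euclidean_all_zero_iff by blast
  qed
  then have "inj L" using lin linear_injective_0 by blast
  then have "surj L" using lin linear_injective_imp_surjective by blast
  then obtain w where w: "u = L w" by auto
  have "(\<Sum>b\<in>Basis. Q u (e b) *\<^sub>R e b) = (\<Sum>b\<in>Basis. (w \<bullet> b) *\<^sub>R e b)"
    unfolding w L_def by (intro sum.cong) (simp_all add: coeff)
  then show ?thesis using w by (simp add: L_def)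
qed

text \<open>Expand \<open>e\<close> in terms of \<open>e'\<close>. The coefficient of
  \<open>B (e' c) (e' d)\<close> is a sum of products of inner products with the vectors
  \<open>e b\<close>; by Parseval's identity it equals \<open>Q (e' c) (e' d)\<close>, a Kronecker
  delta.\<close>

lemma trace_independent:
  fixes B :: "'e::euclidean_space \<Rightarrow> 'e \<Rightarrow> 'v::real_vector"
  assumes "inner_form Q" "orthonormal_for Q e" "orthonormal_for Q e'"
    and lin: "\<And>v. linear (\<lambda>u. B u v)" "\<And>u. linear (B u)"
  shows "(\<Sum>b\<in>Basis. B (e b) (e b)) = (\<Sum>b\<in>Basis. B (e' b) (e' b))"
proof -
  have bl: "bilinear Q" and sym: "\<And>u v. Q u v = Q v u" using assms(1) by (auto simp: inner_form_def)
  have exp: "B (e b) (e b) = (\<Sum>c\<in>Basis. \<Sum>d\<in>Basis. (Q (e b) (e' c) * Q (e b) (e' d)) *\<^sub>R B (e' c) (e' d))" for b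
  proof -
    have "B (e b) (e b) = B (\<Sum>c\<in>Basis. Q (e b) (e' c) *\<^sub>R e' c) (\<Sum>d\<in>Basis. Q (e b) (e' d) *\<^sub>R e' d)"
      using orthonormal_expansion[OF assms(1,3), of "e b"] by simp
    also have "\<dots> = (\<Sum>c\<in>Basis. \<Sum>d\<in>Basis. (Q (e b) (e' c) * Q (e b) (e' d)) *\<^sub>R B (e' c) (e' d))"
      by (simp add: linear_sum[OF lin(1)] linear_sum[OF lin(2)] linear_scale[OF lin(1)] linear_scale[OF lin(2)]
          scaleR_sum_right) (subst sum.swap, simp add: mult.commute)
    finally show ?thesis .
  qed
  have "(\<Sum>b\<in>Basis. B (e b) (e b))
      = (\<Sum>c\<in>Basis. \<Sum>d\<in>Basis. (\<Sum>b\<in>Basis. Q (e b) (e' c) * Q (e b) (e' d)) *\<^sub>R B (e' c) (e' d))"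
    unfolding exp scaleR_sum_left by (rule trans[OF sum.swap]) (intro sum.cong refl sum.swap)
  also have "\<dots> = (\<Sum>c\<in>Basis. \<Sum>d\<in>Basis. Q (e' c) (e' d) *\<^sub>R B (e' c) (e' d))"
  proof (intro sum.cong refl arg_cong2[where f = scaleR])
    fix c d :: 'e
    have "Q (e' c) (e' d) = Q (\<Sum>b\<in>Basis. Q (e' c) (e b) *\<^sub>R e b) (e' d)"
      using orthonormal_expansion[OF assms(1,2), of "e' c"] by simp
    then show "(\<Sum>b\<in>Basis. Q (e b) (e' c) * Q (e b) (e' d)) = Q (e' c) (e' d)"
      by (simp add: bilinear_sum_left[OF bl] bilinear_lmul[OF bl] sym[of "e' c"])
  qed
  also have "\<dots> = (\<Sum>c\<in>Basis. \<Sum>d\<in>Basis. if c = d then B (e' c) (e' d) else 0)"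
    using assms(3) by (intro sum.cong) (auto simp: orthonormal_for_def)
  also have "\<dots> = (\<Sum>b\<in>Basis. B (e' b) (e' b))" by simp
  finally show ?thesis .
qed

text \<open>The representing vector is given by a formula and not just shown to exist; smoothness of
  gradients and Christoffel symbols is read off from it.\<close>

lemma riesz_orthonormal:
  assumes "inner_form Q" "orthonormal_for Q e" "linear \<phi>"
  shows "Q (\<Sum>b\<in>Basis. \<phi> (e b) *\<^sub>R e b) v = \<phi> v"
proof -
  have bl: "bilinear Q" and sym: "\<And>u v. Q u v = Q v u" using assms(1) by (auto simp: inner_form_def)
  have "\<phi> v = \<phi> (\<Sum>b\<in>Basis. Q v (e b) *\<^sub>R e b)" using orthonormal_expansion[OF assms(1,2)] by simp
  also have "\<dots> = (\<Sum>b\<in>Basis. Q v (e b) * \<phi> (e b))"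
    by (simp add: linear_sum[OF assms(3)] linear_scale[OF assms(3)])
  finally show ?thesis by (simp add: bilinear_sum_left[OF bl] bilinear_lmul[OF bl] sym[of v] mult.commute)
qed

lemma the_riesz:
  assumes "inner_form Q" "\<And>v. Q w v = \<phi> v"
  shows "(THE w. \<forall>v. Q w v = \<phi> v) = w"
  using assms inner_form_eqI[OF assms(1)] by (intro the_equality) auto

lemma metric_inner_form: "metric_field_on S G \<Longrightarrow> x \<in> S \<Longrightarrow> inner_form (G x)"
  by (simp add: metric_field_on_def inner_form_def)

lemma metric_bilinear_field: "metric_field_on S G \<Longrightarrow> bilinear_field_on S G"
  by (simp add: metric_field_on_def bilinear_field_on_def)

text \<open>The choice in \<open>frame_near\<close> is meaningful only once some frame exists. The
  Gram-Schmidt process runs by induction over sets \<open>C\<close> of standard basis vectors. The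
  invariant that the frame stays in \<open>span C\<close> prevents the next residue \<open>w\<close>
  from vanishing: otherwise the new basis vector \<open>a\<close> would lie in
  \<open>span C\<close>.\<close>

lemma gram_schmidt:
  assumes "open S" "metric_field_on S G"
  shows "\<exists>e. orthonormal_frame_on G S e"
proof -
  have bl: "bilinear (G x)" and sym: "G x u v = G x v u" and pos: "u \<noteq> 0 \<Longrightarrow> G x u u > 0"
    if "x \<in> S" for x u v using assms(2) that by (auto simp: metric_field_on_def)
  have "\<exists>e. (\<forall>b\<in>C. smooth_on S (e b)) \<and>
        (\<forall>x\<in>S. \<forall>b\<in>C. \<forall>c\<in>C. G x (e b x) (e c x) = (if b = c then 1 else 0)) \<and>
        (\<forall>x\<in>S. \<forall>b\<in>C. e b x \<in> span C)" if "finite C" "C \<subseteq> Basis" for C :: "'a set"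
    using that
  proof (induction C rule: finite_induct)
    case empty
    then show ?case by simp
  next
    case (insert a C)
    have "C \<subseteq> Basis" using insert.prems by simp
    from insert.IH[OF this] obtain e where e: "\<forall>b\<in>C. smooth_on S (e b)"
      "\<forall>x\<in>S. \<forall>b\<in>C. \<forall>c\<in>C. G x (e b x) (e c x) = (if b = c then 1 else 0)"
      "\<forall>x\<in>S. \<forall>b\<in>C. e b x \<in> span C" by (elim exE conjE) (rule that)
    have e1: "smooth_on S (e b)" if "b \<in> C" for b using e(1) that by simp
    have e2: "G x (e b x) (e c x) = (if b = c then 1 else 0)" if "x \<in> S" "b \<in> C" "c \<in> C" for x b c
      using e(2) that by simp
    have e3: "e b x \<in> span C" if "x \<in> S" "b \<in> C" for x b using e(3) that by simp
    define w where "w = (\<lambda>x. a - (\<Sum>b\<in>C. G x a (e b x) *\<^sub>R e b x))"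
    have ws: "smooth_on S w" unfolding w_def
      using e1 assms(1)
      by (intro smooth_on_diff smooth_on_sum smooth_on_scaleR smooth_on_const
          bilinear_field_smooth[OF assms(1) metric_bilinear_field[OF assms(2)]]) simp_all
    have wspan: "w x \<in> span (insert a C)" if "x \<in> S" for x
      unfolding w_def using e3[OF that] span_mono[of C "insert a C"]
      by (intro span_diff span_sum span_scale) (auto intro: span_base)
    have "independent (insert a C)" using insert.prems independent_Basis independent_mono by blast
    then have anot: "a \<notin> span C"
      using insert.hyps by (metis Diff_insert_absorb dependent_def insertI1)
    have w0: "w x \<noteq> 0" if "x \<in> S" for x
    proof
      assume "w x = 0"
      then have "a = (\<Sum>b\<in>C. G x a (e b x) *\<^sub>R e b x)" by (simp add: w_def)
      also have "\<dots> \<in> span C" using e3[OF that] by (intro span_sum span_scale)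
      finally show False using anot by blast
    qed
    have orth: "G x (w x) (e c x) = 0" if x: "x \<in> S" and c: "c \<in> C" for x c
    proof -
      have "G x (\<Sum>b\<in>C. G x a (e b x) *\<^sub>R e b x) (e c x) = (\<Sum>b\<in>C. if b = c then G x a (e b x) else 0)"
        unfolding bilinear_sum_left[OF bl[OF x]]
        using e2[OF x _ c] by (intro sum.cong) (auto simp: bilinear_lmul[OF bl[OF x]])
      also have "\<dots> = G x a (e c x)" using c insert.hyps by simp
      finally show ?thesis by (simp add: w_def bilinear_lsub[OF bl[OF x]])
    qed
    define E where "E = (\<lambda>x. (1 / sqrt (G x (w x) (w x))) *\<^sub>R w x)"
    have Es: "smooth_on S E" unfolding E_def
      using assms(1) ws pos w0
      by (intro smooth_on_scaleR smooth_on_divide smooth_on_sqrt smooth_on_const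
          bilinear_field_smooth[OF assms(1) metric_bilinear_field[OF assms(2)]]) simp_all
    have EE: "G x (E x) (E x) = 1" if x: "x \<in> S" for x
      using pos[OF x w0[OF x]] by (simp add: E_def bilinear_lmul[OF bl[OF x]] bilinear_rmul[OF bl[OF x]])
    have Ec: "G x (E x) (e c x) = 0" "G x (e c x) (E x) = 0" if x: "x \<in> S" and c: "c \<in> C" for x c
      using orth[OF x c] sym[OF x] by (simp_all add: E_def bilinear_lmul[OF bl[OF x]] bilinear_rmul[OF bl[OF x]])
    have span: "E x \<in> span (insert a C)" if "x \<in> S" for x
      unfolding E_def using wspan[OF that] by (rule span_scale)
    have span': "e b x \<in> span (insert a C)" if "x \<in> S" "b \<in> C" for x b
      using e3[OF that] span_mono[of C "insert a C"] by blast
    have ne: "(e(a := E)) b = e b" if "b \<in> C" for b using that insert.hyps by auto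
    show ?case
    proof (intro exI[of _ "e(a := E)"] conjI ballI)
      show "smooth_on S ((e(a := E)) b)" if "b \<in> insert a C" for b
        using that Es e1 ne by (cases "b = a") simp_all
      show "(e(a := E)) b x \<in> span (insert a C)" if "x \<in> S" "b \<in> insert a C" for x b
        using that span span' ne by (cases "b = a") simp_all
      show "G x ((e(a := E)) b x) ((e(a := E)) c x) = (if b = c then 1 else 0)"
        if "x \<in> S" "b \<in> insert a C" "c \<in> insert a C" for x b c
        using that EE Ec e2 ne by (cases "b = a"; cases "c = a") simp_all
    qed
  qed
  from this[of Basis] show ?thesis by (simp add: orthonormal_frame_on_def)
qed

text \<open>The chosen frame comes with an unknown neighbourhood, which may be cut down to lie
  inside \<open>S\<close>.\<close>

lemma frame_near_orthonormal:
  assumes "open S" "metric_field_on S G" "x \<in> S"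
  obtains W where "open W" "x \<in> W" "W \<subseteq> S" "orthonormal_frame_on G W (frame_near G x)"
proof -
  obtain e where "orthonormal_frame_on G S e" using gram_schmidt[OF assms(1,2)] by blast
  then have "\<exists>e W. open W \<and> x \<in> W \<and> orthonormal_frame_on G W e"
    using assms(1,3) by (intro exI[of _ e] exI[of _ S]) simp
  from someI_ex[OF this] obtain W
    where W: "open W" "x \<in> W" "orthonormal_frame_on G W (frame_near G x)"
    unfolding frame_near_def by auto
  have "orthonormal_frame_on G (W \<inter> S) (frame_near G x)"
    using W(3) unfolding orthonormal_frame_on_def by (auto intro: smooth_on_subset)
  then show ?thesis using that[of "W \<inter> S"] W assms by auto
qed

lemma orthonormal_frame_at: "orthonormal_frame_on G W e \<Longrightarrow> x \<in> W \<Longrightarrow> orthonormal_for (G x) (\<lambda>b. e b x)"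
  by (simp add: orthonormal_frame_on_def orthonormal_for_def)


section \<open>The Levi-Civita connection\<close>

text \<open>The value of \<open>nabla G X Y\<close> at \<open>x\<close> depends on \<open>X\<close>
  only through \<open>X x\<close>; taking that vector as the argument \<open>u\<close> exposes a
  linear map.\<close>

abbreviation cov :: "'e::euclidean_space metric_field \<Rightarrow> 'e vector_field \<Rightarrow> 'e \<Rightarrow> 'e \<Rightarrow> 'e" where
  "cov G Y x u \<equiv> D Y x u + christoffel G x u (Y x)"

text \<open>The Koszul formula for fields with constant components, whose brackets vanish; in other
  words, the Christoffel symbols of the first kind.\<close>

definition koszul :: "'e::euclidean_space metric_field \<Rightarrow> 'e \<Rightarrow> 'e \<Rightarrow> 'e \<Rightarrow> 'e \<Rightarrow> real" where
  "koszul G x u v z = (D (\<lambda>y. G y v z) x u + D (\<lambda>y. G y u z) x v - D (\<lambda>y. G y u v) x z) / 2"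

locale metric_domain =
  fixes S :: "'e::euclidean_space set" and G :: "'e metric_field"
  assumes open_dom: "open S" and metric: "metric_field_on S G"
begin

lemmas bilinear_field = metric_bilinear_field[OF metric]
lemmas inner_form_at = metric_inner_form[OF metric]

lemma bilinear_at: "x \<in> S \<Longrightarrow> bilinear (G x)"
  and sym: "x \<in> S \<Longrightarrow> G x u v = G x v u"
  and smooth_const: "smooth_on S (\<lambda>x. G x u v)"
  using metric by (auto simp: metric_field_on_def)

lemma eqI: "x \<in> S \<Longrightarrow> (\<And>z. G x w z = G x w' z) \<Longrightarrow> w = w'"
  using inner_form_eqI[OF inner_form_at] .

lemma D_metric_sym: "x \<in> S \<Longrightarrow> D (\<lambda>y. G y u v) x = D (\<lambda>y. G y v u) x"
  by (rule D_cong[OF open_dom]) (auto intro: sym)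

lemma linear_D_metric: "x \<in> S \<Longrightarrow> linear (D (\<lambda>y. G y u v) x)"
  by (rule D_linear[OF smooth_on_differentiable[OF smooth_const]])

lemma bilinear_D_metric: "x \<in> S \<Longrightarrow> bilinear (\<lambda>a b. D (\<lambda>y. G y a b) x u)"
  by (rule bilinear_D_bilinear_field[OF open_dom bilinear_field])

lemma exists_orthonormal:
  "\<exists>e. (\<forall>b\<in>Basis. smooth_on S (e b)) \<and> (\<forall>x\<in>S. orthonormal_for (G x) (\<lambda>b. e b x))"
  using gram_schmidt[OF open_dom metric] by (simp add: orthonormal_frame_on_def orthonormal_for_def)

lemma exists_riesz:
  assumes "x \<in> S" "linear \<phi>"
  obtains w where "\<And>v. G x w v = \<phi> v"
proof -
  obtain e where "\<forall>x\<in>S. orthonormal_for (G x) (\<lambda>b. e b x)"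
    using exists_orthonormal by blast
  then have "orthonormal_for (G x) (\<lambda>b. e b x)" using assms(1) by blast
  from that[OF riesz_orthonormal[OF inner_form_at[OF assms(1)] this assms(2)]] show ?thesis .
qed

lemma linear_koszul:
  assumes "x \<in> S"
  shows "linear (koszul G x u v)"
proof -
  note B = bilinear_D_metric[OF assms] and L = linear_D_metric[OF assms]
  show ?thesis unfolding koszul_def
    by (intro linearI) (simp_all add: bilinear_radd[OF B] bilinear_rmul[OF B] linear_add[OF L] linear_scale[OF L]
      field_simps)
qed

text \<open>The definite description denotes something because the Koszul expression is linear in
  \<open>z\<close>, hence represented by exactly one vector.\<close>

lemma christoffel_koszul:
  assumes "x \<in> S"
  shows "G x (christoffel G x u v) z = koszul G x u v z"
proof -
  obtain w where w: "\<And>z. G x w z = koszul G x u v z"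
    using exists_riesz[OF assms linear_koszul[OF assms]] by blast
  have "christoffel G x u v = w"
    unfolding christoffel_def using the_riesz[OF inner_form_at[OF assms] w] by (simp add: koszul_def)
  then show ?thesis by (simp add: w)
qed

lemma christoffel_eqI:
  assumes "x \<in> S" "\<And>z. G x w z = koszul G x u v z"
  shows "christoffel G x u v = w"
  by (rule eqI[OF assms(1)]) (simp add: christoffel_koszul[OF assms(1)] assms(2))

lemma christoffel_sym:
  assumes "x \<in> S"
  shows "christoffel G x u v = christoffel G x v u"
  by (rule christoffel_eqI[OF assms])
    (simp add: christoffel_koszul[OF assms] koszul_def D_metric_sym[OF assms, of u v])

lemma christoffel_linear_right:
  assumes "x \<in> S"
  shows "linear (christoffel G x u)"
proof (rule linearI)
  have bl: "bilinear (G x)" by (rule bilinear_at[OF assms])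
  note B = bilinear_D_metric[OF assms] and L = linear_D_metric[OF assms]
  show "christoffel G x u (v + w) = christoffel G x u v + christoffel G x u w" for v w
    by (rule christoffel_eqI[OF assms])
      (simp add: bilinear_ladd[OF bl] christoffel_koszul[OF assms] koszul_def linear_add[OF L]
        bilinear_ladd[OF B] bilinear_radd[OF B] field_simps)
  show "christoffel G x u (c *\<^sub>R v) = c *\<^sub>R christoffel G x u v" for c v
    by (rule christoffel_eqI[OF assms])
      (simp add: bilinear_lmul[OF bl] christoffel_koszul[OF assms] koszul_def linear_scale[OF L]
        bilinear_lmul[OF B] bilinear_rmul[OF B] field_simps)
qed

lemma christoffel_bilinear:
  assumes "x \<in> S"
  shows "bilinear (christoffel G x)"
proof -
  have "(\<lambda>u. christoffel G x u v) = christoffel G x v" for v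
    using christoffel_sym[OF assms] by auto
  then show ?thesis using christoffel_linear_right[OF assms] by (simp add: bilinear_def)
qed

text \<open>A definite description cannot be differentiated directly. In a smooth orthonormal frame
  the Riesz formula rewrites it as a finite sum of smooth terms.\<close>

lemma smooth_christoffel: "smooth_on S (\<lambda>x. christoffel G x u v)"
proof -
  obtain e where e': "\<forall>b\<in>Basis. smooth_on S (e b)"
    and on': "\<forall>x\<in>S. orthonormal_for (G x) (\<lambda>b. e b x)"
    using exists_orthonormal by blast
  have e: "smooth_on S (e b)" if "b \<in> Basis" for b using e' that by blast
  have on: "orthonormal_for (G x) (\<lambda>b. e b x)" if "x \<in> S" for x using on' that by blast
  have lf: "linear_field_on S (\<lambda>y z. G y w z)" for w
    by (rule bilinear_field_right[OF open_dom bilinear_field smooth_on_const])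
  have k: "smooth_on S (\<lambda>x. koszul G x u v (e b x))" if "b \<in> Basis" for b
  proof -
    have 1: "smooth_on S (\<lambda>x. D (\<lambda>y. G y w (e b x)) x w')" for w w'
      by (rule linear_field_smooth[OF open_dom linear_field_D_const[OF open_dom lf] e[OF that]])
    have 2: "smooth_on S (\<lambda>x. D (\<lambda>y. G y u v) x (e b x))"
      by (rule linear_field_smooth[OF open_dom linear_field_D[OF smooth_const] e[OF that]])
    have "smooth_on S (\<lambda>x. (1/2) * (D (\<lambda>y. G y v (e b x)) x u + D (\<lambda>y. G y u (e b x)) x v
        - D (\<lambda>y. G y u v) x (e b x)))"
      by (intro smooth_on_mult smooth_on_diff smooth_on_add smooth_on_const open_dom 1 2)
    then show ?thesis by (simp add: koszul_def)
  qed
  show ?thesis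
  proof (rule smooth_on_cong[OF open_dom, of "\<lambda>x. \<Sum>b\<in>Basis. koszul G x u v (e b x) *\<^sub>R e b x"])
    show "(\<Sum>b\<in>Basis. koszul G x u v (e b x) *\<^sub>R e b x) = christoffel G x u v" if x: "x \<in> S" for x
      using riesz_orthonormal[OF inner_form_at[OF x] on[OF x] linear_koszul[OF x]]
      by (intro christoffel_eqI[OF x, symmetric]) simp
    show "smooth_on S (\<lambda>x. \<Sum>b\<in>Basis. koszul G x u v (e b x) *\<^sub>R e b x)"
      using k e open_dom by (intro smooth_on_sum smooth_on_scaleR) simp_all
  qed
qed

lemma christoffel_field: "bilinear_field_on S (christoffel G)"
  by (simp add: bilinear_field_on_def christoffel_bilinear smooth_christoffel)

text \<open>In the sum of the two Koszul expressions the derivatives in the directions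
  \<open>a\<close> and \<open>b\<close> cancel by symmetry of the metric.\<close>

lemma metric_compatible:
  assumes "x \<in> S"
  shows "D (\<lambda>y. G y a b) x u = G x (christoffel G x u a) b + G x a (christoffel G x u b)"
proof -
  have "G x a (christoffel G x u b) = G x (christoffel G x u b) a" by (rule sym[OF assms])
  then show ?thesis
    using D_metric_sym[OF assms, of b a] D_metric_sym[OF assms, of u a] D_metric_sym[OF assms, of u b]
    by (simp add: christoffel_koszul[OF assms] koszul_def field_simps)
qed

section \<open>Gradient, Hessian, Laplacian and curvature\<close>

lemma gradient_eqI:
  assumes "x \<in> S" "\<And>v. G x w v = D F x v"
  shows "gradient G F x = w"
  unfolding gradient_def by (rule the_riesz[OF inner_form_at[OF assms(1)] assms(2)])

lemma gradient_metric:
  assumes "x \<in> S" "F differentiable (at x)"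
  shows "G x (gradient G F x) v = D F x v"
proof -
  obtain w where w: "\<And>z. G x w z = D F x z"
    using exists_riesz[OF assms(1) D_linear[OF assms(2)]] by blast
  then show ?thesis using gradient_eqI[OF assms(1) w] by simp
qed

lemma smooth_gradient:
  assumes "smooth_on S F"
  shows "smooth_on S (gradient G F)"
proof -
  obtain e where e': "\<forall>b\<in>Basis. smooth_on S (e b)"
    and on': "\<forall>x\<in>S. orthonormal_for (G x) (\<lambda>b. e b x)"
    using exists_orthonormal by blast
  have e: "smooth_on S (e b)" if "b \<in> Basis" for b using e' that by blast
  have on: "orthonormal_for (G x) (\<lambda>b. e b x)" if "x \<in> S" for x using on' that by blast
  show ?thesis
  proof (rule smooth_on_cong[OF open_dom, of "\<lambda>x. \<Sum>b\<in>Basis. D F x (e b x) *\<^sub>R e b x"])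
    show "(\<Sum>b\<in>Basis. D F x (e b x) *\<^sub>R e b x) = gradient G F x" if x: "x \<in> S" for x
      using riesz_orthonormal[OF inner_form_at[OF x] on[OF x] D_linear[OF smooth_on_differentiable[OF assms x]]]
      by (intro gradient_eqI[OF x, symmetric]) simp
    show "smooth_on S (\<lambda>x. \<Sum>b\<in>Basis. D F x (e b x) *\<^sub>R e b x)"
      using e open_dom linear_field_smooth[OF open_dom linear_field_D[OF assms]]
      by (intro smooth_on_sum smooth_on_scaleR) simp_all
  qed
qed

text \<open>The bridge from the frame hidden in the definitions to a basis of one's own: the trace
  of a bilinear form involves the frame at \<open>x\<close> alone, where one orthonormal basis may
  be exchanged for another.\<close>

lemma frame_near_trace:
  assumes "x \<in> S" "orthonormal_for (G x) e" "\<And>v. linear (\<lambda>u. B u v)" "\<And>u. linear (B u)"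
  shows "(\<Sum>b\<in>Basis. B (frame_near G x b x) (frame_near G x b x)) = (\<Sum>b\<in>Basis. B (e b) (e b))"
proof -
  obtain W where "x \<in> W" "orthonormal_frame_on G W (frame_near G x)"
    using frame_near_orthonormal[OF open_dom metric assms(1)] .
  then have "orthonormal_for (G x) (\<lambda>b. frame_near G x b x)"
    by (intro orthonormal_frame_at)
  from trace_independent[OF inner_form_at[OF assms(1)] this assms(2), of B, OF assms(3,4)]
  show ?thesis .
qed

lemma frame_near_smooth:
  assumes "x \<in> S"
  obtains W where "open W" "x \<in> W" "W \<subseteq> S" "\<forall>b\<in>Basis. smooth_on W (frame_near G x b)"
proof -
  obtain W where "open W" "x \<in> W" "W \<subseteq> S" "orthonormal_frame_on G W (frame_near G x)"
    using frame_near_orthonormal[OF open_dom metric assms] .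
  then show ?thesis using that[of W] by (simp add: orthonormal_frame_on_def)
qed

lemma linear_field_cov:
  assumes "smooth_on S X"
  shows "linear_field_on S (cov G X)"
proof -
  have "linear_field_on S (\<lambda>x u. christoffel G x u (X x))"
    by (rule bilinear_field_left[OF open_dom christoffel_field assms])
  then show ?thesis
    using linear_field_D[OF assms] open_dom
    by (simp add: linear_field_on_def linear_compose_add smooth_on_add)
qed

text \<open>The right-hand side is the Hessian of \<open>\<phi>\<close>. It arises by
  differentiating the defining equation of the gradient with \<open>v\<close> constant; metric
  compatibility supplies the Christoffel terms.\<close>

lemma cov_gradient:
  assumes "smooth_on S \<phi>" "x \<in> S"
  shows "G x (cov G (gradient G \<phi>) x u) v = D (\<lambda>y. D \<phi> y v) x u - D \<phi> x (christoffel G x u v)"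
proof -
  let ?X = "gradient G \<phi>"
  have X: "smooth_on S ?X" by (rule smooth_gradient[OF assms(1)])
  have met: "G y (?X y) w = D \<phi> y w" if "y \<in> S" for y w
    by (rule gradient_metric[OF that smooth_on_differentiable[OF assms(1) that]])
  have "D (\<lambda>y. D \<phi> y v) x u = D (\<lambda>y. G y (?X y) v) x u"
    by (rule fun_cong[OF D_cong[OF open_dom assms(2)]]) (simp add: met)
  also have "\<dots> = D (\<lambda>y. G y (?X x) v) x u + G x (D ?X x u) v"
    by (rule D_linear_field[OF open_dom bilinear_field_left[OF open_dom bilinear_field smooth_on_const] X assms(2)])
  finally show ?thesis
    by (simp add: metric_compatible[OF assms(2)] met[OF assms(2)] bilinear_ladd[OF bilinear_at[OF assms(2)]])
qed

text \<open>Symmetry of the Hessian exchanges the two slots: g(nabla_X X, u) = g(nabla_u X, X),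
  which is half the derivative of g(X, X) along u.\<close>

lemma nabla_gradient_self:
  assumes "smooth_on S \<phi>" "x \<in> S"
  defines "X \<equiv> gradient G \<phi>"
  shows "nabla G X X x = (1/2) *\<^sub>R gradient G (\<lambda>y. G y (X y) (X y)) x"
proof -
  have X: "smooth_on S X" unfolding X_def by (rule smooth_gradient[OF assms(1)])
  note bl = bilinear_at[OF assms(2)]
  have symm: "G x (cov G X x u) v = G x (cov G X x v) u" for u v
    using D_symmetric[OF open_dom assms(1,2), of u v]
    by (simp add: X_def cov_gradient[OF assms(1,2)] christoffel_sym[OF assms(2), of u v])
  have "gradient G (\<lambda>y. G y (X y) (X y)) x = 2 *\<^sub>R nabla G X X x"
  proof (rule gradient_eqI[OF assms(2)])
    fix u
    have "D (\<lambda>y. G y (X y) (X y)) x u = 2 * G x (cov G X x u) (X x)"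
      using sym[OF assms(2), of "X x"]
      by (simp add: D_bilinear_field[OF open_dom bilinear_field X X assms(2)] metric_compatible[OF assms(2)]
        bilinear_ladd[OF bl])
    then show "G x (2 *\<^sub>R nabla G X X x) u = D (\<lambda>y. G y (X y) (X y)) x u"
      by (simp add: nabla_def bilinear_lmul[OF bl] symm[of u])
  qed
  then show ?thesis by simp
qed

text \<open>The divergence of a gradient is the trace of the Hessian, which is bilinear and can be
  traced in any basis orthonormal at \<open>x\<close>.\<close>

lemma laplacian_trace:
  assumes "smooth_on S F" "x \<in> S" "orthonormal_for (G x) e"
  shows "laplacian G F x = (\<Sum>b\<in>Basis. D (\<lambda>y. D F y (e b)) x (e b) - D F x (christoffel G x (e b) (e b)))"
proof -
  let ?B = "\<lambda>u v. G x (cov G (gradient G F) x u) v"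
  have "linear (cov G (gradient G F) x)"
    using linear_field_cov[OF smooth_gradient[OF assms(1)]] assms(2) by (simp add: linear_field_on_def)
  then have lin: "linear (\<lambda>u. ?B u v)" "linear (?B u)" for u v
    using bilinear_at[OF assms(2)] linear_compose[of "cov G (gradient G F) x" "\<lambda>w. G x w v"]
    by (simp_all add: bilinear_def o_def)
  show ?thesis
    using frame_near_trace[where B = ?B, OF assms(2,3) lin]
    by (simp add: laplacian_def divergence_def nabla_def Let_def cov_gradient[OF assms(1,2)])
qed

text \<open>For constant components the bracket vanishes and \<open>nabla\<close> reduces to the
  Christoffel form, which leaves the classical coordinate expression.\<close>

lemma curvature_at_christoffel:
  assumes "x \<in> S"
  shows "curvature_at G x u v w = D (\<lambda>y. christoffel G y v w) x u - D (\<lambda>y. christoffel G y u w) x v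
    + christoffel G x u (christoffel G x v w) - christoffel G x v (christoffel G x u w)"
proof -
  have "nabla G (\<lambda>_. a) (\<lambda>_. b) = (\<lambda>y. christoffel G y a b)" for a b by (auto simp: nabla_def)
  then show ?thesis
    using bilinear_lzero[OF christoffel_bilinear[OF assms]]
    by (simp add: curvature_at_def curvature_def nabla_def lie_bracket_def)
qed

lemma curvature_at_linear:
  assumes "x \<in> S"
  shows "linear (\<lambda>u. curvature_at G x u v w)" "linear (\<lambda>v. curvature_at G x u v w)"
    "linear (\<lambda>w. curvature_at G x u v w)"
proof -
  have L: "linear (D (\<lambda>y. christoffel G y a b) x)" for a b
    by (rule D_linear[OF smooth_on_differentiable[OF smooth_christoffel assms]])
  have B: "bilinear (\<lambda>a b. D (\<lambda>y. christoffel G y a b) x c)" for c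
    by (rule bilinear_D_bilinear_field[OF open_dom christoffel_field assms])
  note C = christoffel_bilinear[OF assms]
  show "linear (\<lambda>u. curvature_at G x u v w)" "linear (\<lambda>v. curvature_at G x u v w)"
    "linear (\<lambda>w. curvature_at G x u v w)"
    unfolding curvature_at_christoffel[OF assms]
    by (intro linearI; simp add: linear_add[OF L] linear_scale[OF L] bilinear_ladd[OF B] bilinear_radd[OF B]
        bilinear_lmul[OF B] bilinear_rmul[OF B] bilinear_ladd[OF C] bilinear_radd[OF C]
        bilinear_lmul[OF C] bilinear_rmul[OF C] algebra_simps)+
qed

lemma ricci_trace:
  assumes "x \<in> S" "orthonormal_for (G x) e"
  shows "ricci G X x = (\<Sum>b\<in>Basis. curvature_at G x (X x) (e b) (e b))"
  using frame_near_trace[where B = "curvature_at G x (X x)", OF assms curvature_at_linear(2,3)[OF assms(1)]]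
  by (simp add: ricci_def Let_def)

end

section \<open>Vector fields along a map\<close>

abbreviation pcov ::
  "'b::euclidean_space metric_field \<Rightarrow> ('a::euclidean_space \<Rightarrow> 'b) \<Rightarrow> ('a \<Rightarrow> 'b) \<Rightarrow> 'a \<Rightarrow> 'a \<Rightarrow> 'b" where
  "pcov H F V x u \<equiv> D V x u + christoffel H (F x) (D F x u) (V x)"

text \<open>The covariant derivative of the section \<open>A\<close> of \<open>T\<^sup>*P \<otimes> F\<^sup>*TQ\<close>, with respect to the connection
  induced by the metrics \<open>K\<close> of the source and \<open>H\<close> of the target.\<close>

definition cov_hess ::
  "'a::euclidean_space metric_field \<Rightarrow> 'b::euclidean_space metric_field \<Rightarrow> ('a \<Rightarrow> 'b) \<Rightarrow> ('a \<Rightarrow> 'a \<Rightarrow> 'b)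
    \<Rightarrow> 'a \<Rightarrow> 'a \<Rightarrow> 'a \<Rightarrow> 'b" where
  "cov_hess K H F A x u v =
     D (\<lambda>y. A y v) x u + christoffel H (F x) (D F x u) (A x v) - A x (christoffel K x u v)"

text \<open>The product rule produces \<open>A x (D e x (e x))\<close>, and the same vector is the
  non-tensorial part of \<open>A x (nabla K e e x)\<close>. After this cancellation only the value
  \<open>e x\<close> is left.\<close>

lemma cov_hess_frame:
  assumes "open W" "linear_field_on W A" "smooth_on W e" "x \<in> W"
  shows "D (\<lambda>y. A y (e y)) x (e x) + christoffel H (F x) (D F x (e x)) (A x (e x)) - A x (nabla K e e x)
    = cov_hess K H F A x (e x) (e x)"
proof -
  have "linear (A x)" using assms by (simp add: linear_field_on_def)
  then show ?thesis
    by (simp add: D_linear_field[OF assms] cov_hess_def nabla_def linear_add)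
qed

lemma linear_field_subset: "linear_field_on S A \<Longrightarrow> T \<subseteq> S \<Longrightarrow> linear_field_on T A"
  by (auto simp: linear_field_on_def intro: smooth_on_subset)

locale map_domain = K: metric_domain S K + H: metric_domain S' H
  for S :: "'a::euclidean_space set" and K and S' :: "'b::euclidean_space set" and H +
  fixes F :: "'a \<Rightarrow> 'b"
  assumes smooth_map: "smooth_on S F" and maps: "F ` S \<subseteq> S'"
begin

lemma F_in: "x \<in> S \<Longrightarrow> F x \<in> S'" using maps by blast

lemma linear_D_map: "x \<in> S \<Longrightarrow> linear (D F x)"
  by (rule D_linear[OF smooth_on_differentiable[OF smooth_map]])

lemma christoffel_along: "bilinear_field_on S (\<lambda>x. christoffel H (F x))"
  by (rule bilinear_field_compose[OF K.open_dom H.christoffel_field smooth_map maps])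

lemma linear_field_pcov:
  assumes "smooth_on S V"
  shows "linear_field_on S (pcov H F V)"
proof -
  have lf: "linear_field_on S (\<lambda>x w. christoffel H (F x) w (V x))"
    by (rule bilinear_field_left[OF K.open_dom christoffel_along assms])
  have "linear (pcov H F V x)" if "x \<in> S" for x
  proof -
    have "linear (\<lambda>u. christoffel H (F x) (D F x u) (V x))"
      using linear_compose[OF linear_D_map[OF that], of "\<lambda>w. christoffel H (F x) w (V x)"] lf that
      by (simp add: linear_field_on_def o_def)
    then show ?thesis
      using D_linear[OF smooth_on_differentiable[OF assms that]] by (rule linear_compose_add[rotated])
  qed
  moreover have "smooth_on S (\<lambda>x. pcov H F V x u)" for u
    by (intro smooth_on_add K.open_dom smooth_on_D assms
        linear_field_smooth[OF K.open_dom lf smooth_on_D[OF smooth_map]])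
  ultimately show ?thesis by (simp add: linear_field_on_def)
qed

lemma bilinear_cov_hess:
  assumes "linear_field_on S A" "x \<in> S"
  shows "linear (\<lambda>u. cov_hess K H F A x u v)" "linear (cov_hess K H F A x u)"
proof -
  have "smooth_on S (\<lambda>y. A y v)" for v using assms by (simp add: linear_field_on_def)
  then have 1: "linear (D (\<lambda>y. A y v) x)" for v
    by (rule D_linear[OF smooth_on_differentiable[OF _ assms(2)]])
  have 2: "linear (\<lambda>v. D (\<lambda>y. A y v) x u)" for u
    by (rule linear_D_linear_field[OF K.open_dom assms])
  have 3: "linear (A x)" using assms by (simp add: linear_field_on_def)
  note 4 = linear_D_map[OF assms(2)] and 5 = K.christoffel_bilinear[OF assms(2)]
    and 6 = H.christoffel_bilinear[OF F_in[OF assms(2)]]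
  show "linear (\<lambda>u. cov_hess K H F A x u v)" "linear (cov_hess K H F A x u)"
    unfolding cov_hess_def
    by (intro linearI; simp add: linear_add[OF 1] linear_add[OF 2] linear_add[OF 3] linear_add[OF 4]
        linear_scale[OF 1] linear_scale[OF 2] linear_scale[OF 3] linear_scale[OF 4]
        bilinear_ladd[OF 5] bilinear_radd[OF 5] bilinear_lmul[OF 5] bilinear_rmul[OF 5]
        bilinear_ladd[OF 6] bilinear_radd[OF 6] bilinear_lmul[OF 6] bilinear_rmul[OF 6] algebra_simps)+
qed

text \<open>One statement for all second-order traces: \<open>A = D F\<close> gives the tension
  field, \<open>A = pcov H F V\<close> the trace of the second derivative of \<open>V\<close>.
  Derivatives of the chosen frame cancel on its own neighbourhood \<open>W\<close>; what remains is
  the trace of a bilinear form, and the basis can be changed.\<close>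

lemma frame_trace:
  assumes A: "linear_field_on S A" and "x \<in> S" "orthonormal_for (K x) e"
  shows "(\<Sum>b\<in>Basis. D (\<lambda>y. A y (frame_near K x b y)) x (frame_near K x b x)
      + christoffel H (F x) (D F x (frame_near K x b x)) (A x (frame_near K x b x))
      - A x (nabla K (frame_near K x b) (frame_near K x b) x))
    = (\<Sum>b\<in>Basis. cov_hess K H F A x (e b) (e b))"
proof -
  obtain W where W: "open W" "x \<in> W" "W \<subseteq> S" and sm: "\<forall>b\<in>Basis. smooth_on W (frame_near K x b)"
    using K.frame_near_smooth[OF assms(2)] .
  have tr: "(\<Sum>b\<in>Basis. cov_hess K H F A x (frame_near K x b x) (frame_near K x b x))
      = (\<Sum>b\<in>Basis. cov_hess K H F A x (e b) (e b))"
    by (rule K.frame_near_trace[where B = "cov_hess K H F A x", OF assms(2,3) bilinear_cov_hess[OF A assms(2)]])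
  show ?thesis
    unfolding tr[symmetric]
    by (intro sum.cong refl cov_hess_frame[OF W(1) linear_field_subset[OF A W(3)] _ W(2)]) (use sm in blast)
qed

lemma tension_trace:
  assumes "x \<in> S" "orthonormal_for (K x) e"
  shows "tension K H F x = (\<Sum>b\<in>Basis. cov_hess K H F (D F) x (e b) (e b))"
  using frame_trace[OF linear_field_D[OF smooth_map] assms]
  by (simp add: tension_def Let_def pullback_nabla_def)

lemma pullback_trace_nabla2_trace:
  assumes "smooth_on S V" "x \<in> S" "orthonormal_for (K x) e"
  shows "pullback_trace_nabla2 K H F V x = (\<Sum>b\<in>Basis. cov_hess K H F (pcov H F V) x (e b) (e b))"
  using frame_trace[OF linear_field_pcov[OF assms(1)] assms(2,3)]
  by (simp add: pullback_trace_nabla2_def Let_def pullback_nabla_def[abs_def])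

lemma curvature_trace:
  assumes "x \<in> S" "orthonormal_for (K x) e"
  shows "(let e = frame_near K x in
         \<Sum>b\<in>Basis. curvature_at H (F x) t (D F x (e b x)) (D F x (e b x)))
    = (\<Sum>b\<in>Basis. curvature_at H (F x) t (D F x (e b)) (D F x (e b)))"
proof -
  let ?B = "\<lambda>u v. curvature_at H (F x) t (D F x u) (D F x v)"
  have lin: "linear (\<lambda>u. ?B u v)" "linear (?B u)" for u v
    using linear_compose[OF linear_D_map[OF assms(1)] H.curvature_at_linear(2)[OF F_in[OF assms(1)]]]
      linear_compose[OF linear_D_map[OF assms(1)] H.curvature_at_linear(3)[OF F_in[OF assms(1)]]]
    by (simp_all add: o_def)
  show ?thesis
    using K.frame_near_trace[where B = ?B, OF assms lin] by (simp add: Let_def)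
qed

end

text \<open>A vector field is a field along the identity map, so this is an instance of the
  statement for maps.\<close>

lemma (in metric_domain) trace_nabla2_trace:
  assumes "smooth_on S X" "x \<in> S" "orthonormal_for (G x) e"
  shows "trace_nabla2 G X x
    = (\<Sum>b\<in>Basis. cov_hess G G (\<lambda>x. x) (cov G X) x (e b) (e b))"
proof -
  interpret I: map_domain S G S G "\<lambda>x. x"
    by unfold_locales simp_all
  show ?thesis
    using I.pullback_trace_nabla2_trace[OF assms]
    by (simp add: trace_nabla2_def pullback_trace_nabla2_def Let_def pullback_nabla_def[abs_def] nabla_def[abs_def])
qed


section \<open>Local isometries\<close>

locale isometry_domain = map_domain S g S' g' T
  for S S' :: "'e::euclidean_space set" and g g' T +
  assumes isometric: "x \<in> S \<Longrightarrow> g x u v = g' (T x) (D T x u) (D T x v)"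
begin

lemma inj_D:
  assumes "x \<in> S"
  shows "inj (D T x)"
proof -
  have "u = 0" if "D T x u = 0" for u
  proof -
    have "g x u u = 0" using isometric[OF assms, of u u] that
      by (simp add: bilinear_lzero[OF H.bilinear_at[OF F_in[OF assms]]])
    then show ?thesis using K.inner_form_at[OF assms] unfolding inner_form_def by (metis less_irrefl)
  qed
  then show ?thesis using linear_D_map[OF assms] linear_injective_0 by blast
qed

lemma surj_D: "x \<in> S \<Longrightarrow> surj (D T x)"
  by (rule linear_injective_imp_surjective[OF linear_D_map inj_D refl])

lemma D_eq_0_iff: "x \<in> S \<Longrightarrow> D T x u = 0 \<longleftrightarrow> u = 0"
  using inj_D linear_D_map linear_injective_0 linear_0 by blast

lemma D_metric_pullback:
  assumes "x \<in> S"
  shows "D (\<lambda>y. g y p q) x z = D (\<lambda>w. g' w (D T x p) (D T x q)) (T x) (D T x z)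
    + g' (T x) (D (\<lambda>y. D T y p) x z) (D T x q) + g' (T x) (D T x p) (D (\<lambda>y. D T y q) x z)"
proof -
  have bf: "bilinear_field_on S (\<lambda>x. g' (T x))"
    by (rule bilinear_field_compose[OF K.open_dom H.bilinear_field smooth_map maps])
  have "D (\<lambda>y. g y p q) x z = D (\<lambda>y. g' (T y) (D T y p) (D T y q)) x z"
    by (rule fun_cong[OF D_cong[OF K.open_dom assms]]) (rule isometric)
  also have "\<dots> = D (\<lambda>y. g' (T y) (D T x p) (D T x q)) x z
    + g' (T x) (D (\<lambda>y. D T y p) x z) (D T x q) + g' (T x) (D T x p) (D (\<lambda>y. D T y q) x z)"
    by (rule D_bilinear_field[OF K.open_dom bf smooth_on_D[OF smooth_map] smooth_on_D[OF smooth_map] assms])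
  also have "D (\<lambda>y. g' (T y) (D T x p) (D T x q)) x z = D (\<lambda>w. g' w (D T x p) (D T x q)) (T x) (D T x z)"
    by (rule D_field_compose[OF smooth_map assms H.smooth_const F_in[OF assms]])
  finally show ?thesis .
qed

text \<open>Isometries preserve the Levi-Civita connection. As \<open>D T x\<close> is surjective,
  it is enough to test against vectors \<open>D T x z\<close>. When the Koszul expression of
  \<open>g\<close> is pulled back, second derivatives of \<open>T\<close> appear in every term, but
  only those in the directions \<open>u\<close> and \<open>v\<close> survive.\<close>

lemma christoffel_transform:
  assumes "x \<in> S"
  shows "D (\<lambda>y. D T y v) x u + christoffel g' (T x) (D T x u) (D T x v) = D T x (christoffel g x u v)"
proof (rule H.eqI[OF F_in[OF assms]])
  fix z'
  obtain z where z': "z' = D T x z" using surj_D[OF assms] by (auto elim: surjE)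
  note bl = H.bilinear_at[OF F_in[OF assms]]
  have s: "D (\<lambda>y. D T y p) x q = D (\<lambda>y. D T y q) x p" for p q
    by (rule D_symmetric[OF K.open_dom smooth_map assms])
  have gs: "g' (T x) a b = g' (T x) b a" for a b by (rule H.sym[OF F_in[OF assms]])
  have "g' (T x) (D T x (christoffel g x u v)) z' = koszul g x u v z"
    unfolding z' isometric[OF assms, symmetric] by (rule K.christoffel_koszul[OF assms])
  also have "\<dots> = koszul g' (T x) (D T x u) (D T x v) (D T x z) + g' (T x) (D (\<lambda>y. D T y v) x u) (D T x z)"
    unfolding koszul_def D_metric_pullback[OF assms] s[of z u] s[of z v] s[of u v]
    by (simp add: field_simps gs[of "D T x u" "D (\<lambda>y. D T y z) x v"] gs[of "D T x u" "D (\<lambda>y. D T y v) x z"]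
       gs[of "D T x v"] s)
  also have "\<dots> = g' (T x) (D (\<lambda>y. D T y v) x u + christoffel g' (T x) (D T x u) (D T x v)) z'"
    by (simp add: z' bilinear_ladd[OF bl] H.christoffel_koszul[OF F_in[OF assms]])
  finally show "g' (T x) (D (\<lambda>y. D T y v) x u + christoffel g' (T x) (D T x u) (D T x v)) z'
    = g' (T x) (D T x (christoffel g x u v)) z'" by simp
qed

text \<open>Differentiating \<open>D T y (X y)\<close> brings in the second derivative of
  \<open>T\<close>, which \<open>christoffel_transform\<close> trades for the Christoffel form of
  \<open>g\<close>.\<close>

lemma pcov_pushforward:
  assumes "smooth_on S X" "x \<in> S"
  shows "pcov g' T (\<lambda>y. D T y (X y)) x u = D T x (cov g X x u)"
  using christoffel_transform[OF assms(2), of "X x" u] linear_add[OF linear_D_map[OF assms(2)]]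
  by (simp add: D_linear_field[OF K.open_dom linear_field_D[OF smooth_map] assms] algebra_simps)

text \<open>Differentiate the identity \<open>christoffel_transform\<close> covariantly and antisymmetrize: the third derivatives of \<open>T\<close> cancel.\<close>

lemma curvature_transform:
  assumes "x \<in> S"
  shows "curvature_at g' (T x) (D T x u) (D T x v) (D T x w) = D T x (curvature_at g x u v w)"
proof -
  let ?G = "christoffel g" and ?G' = "christoffel g' (T x)"
  let ?t = "D T x" and ?w = "\<lambda>y. D T y w"
  \<comment> \<open>The covariant derivative along \<open>u\<close> of the left-hand side of
    \<open>christoffel_transform\<close> for \<open>v\<close> and \<open>w\<close>. Fact
    \<open>1\<close> evaluates it through the right-hand side of that law, fact \<open>2\<close> by
    the product rule.\<close>
  let ?P = "\<lambda>u v. D (\<lambda>y. D ?w y v + christoffel g' (T y) (D T y v) (D T y w)) x u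
    + ?G' (?t u) (D ?w x v + ?G' (?t v) (?t w))"
  note lin = linear_D_map[OF assms] and C' = H.christoffel_bilinear[OF F_in[OF assms]]
  have W: "smooth_on S ?w" by (rule smooth_on_D[OF smooth_map])
  have 1: "?P u v = ?t (D (\<lambda>y. ?G y v w) x u + ?G x u (?G x v w))" for u v
  proof -
    have "D (\<lambda>y. D ?w y v + christoffel g' (T y) (D T y v) (D T y w)) x u = D (\<lambda>y. D T y (?G y v w)) x u"
      by (rule fun_cong[OF D_cong[OF K.open_dom assms]]) (rule christoffel_transform)
    also have "\<dots> = D (\<lambda>y. D T y (?G x v w)) x u + ?t (D (\<lambda>y. ?G y v w) x u)"
      by (rule D_linear_field[OF K.open_dom linear_field_D[OF smooth_map] K.smooth_christoffel assms])
    finally show ?thesis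
      using christoffel_transform[OF assms, of "?G x v w" u] christoffel_transform[OF assms, of w v]
      by (simp add: linear_add[OF lin] algebra_simps)
  qed
  have 2: "?P u v = D (\<lambda>y. D ?w y v) x u + D (\<lambda>z. christoffel g' z (?t v) (?t w)) (T x) (?t u)
     + ?G' (D (\<lambda>y. D T y v) x u) (?t w) + ?G' (?t v) (D ?w x u)
     + ?G' (?t u) (D ?w x v) + ?G' (?t u) (?G' (?t v) (?t w))" for u v
  proof -
    have sm: "smooth_on S (\<lambda>y. christoffel g' (T y) (D T y v) (D T y w))"
      by (rule bilinear_field_smooth[OF K.open_dom christoffel_along smooth_on_D[OF smooth_map] W])
    have "D (\<lambda>y. D ?w y v + christoffel g' (T y) (D T y v) (D T y w)) x u
      = D (\<lambda>y. D ?w y v) x u + D (\<lambda>y. christoffel g' (T y) (D T y v) (D T y w)) x u"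
      by (rule D_add[OF smooth_on_differentiable[OF smooth_on_D[OF W] assms] smooth_on_differentiable[OF sm assms]])
    also have "D (\<lambda>y. christoffel g' (T y) (D T y v) (D T y w)) x u
      = D (\<lambda>y. christoffel g' (T y) (?t v) (?t w)) x u + ?G' (D (\<lambda>y. D T y v) x u) (?t w) + ?G' (?t v) (D ?w x u)"
      by (rule D_bilinear_field[OF K.open_dom christoffel_along smooth_on_D[OF smooth_map] W assms])
    also have "D (\<lambda>y. christoffel g' (T y) (?t v) (?t w)) x u = D (\<lambda>z. christoffel g' z (?t v) (?t w)) (T x) (?t u)"
      by (rule D_field_compose[OF smooth_map assms H.smooth_christoffel F_in[OF assms]])
    finally show ?thesis by (simp add: bilinear_radd[OF C'])
  qed
  have "D T x (curvature_at g x u v w) = ?P u v - ?P v u"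
    unfolding 1 K.curvature_at_christoffel[OF assms] linear_diff[OF lin, symmetric] by (simp add: algebra_simps)
  also have "\<dots> = curvature_at g' (T x) (?t u) (?t v) (?t w)"
    unfolding 2 H.curvature_at_christoffel[OF F_in[OF assms]]
    using D_symmetric[OF K.open_dom W assms, of v u] D_symmetric[OF K.open_dom smooth_map assms, of v u]
    by (simp add: algebra_simps)
  finally show ?thesis by simp
qed

end


section \<open>Warped products\<close>

text \<open>One form for source and target: with \<open>L = (\<lambda>_. 1)\<close> it is the
  product metric.\<close>

definition warped_metric ::
  "'e::euclidean_space metric_field \<Rightarrow> ('e \<Rightarrow> real) \<Rightarrow> 'k::euclidean_space metric_field \<Rightarrow> ('e \<times> 'k) metric_field"
  where "warped_metric g L h = (\<lambda>z U V. g (fst z) (fst U) (fst V) + (L (fst z))\<^sup>2 * h (snd z) (snd U) (snd V))"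

lemma smooth_on_compose_fst:
  assumes "open A" "open B" "smooth_on A f"
  shows "smooth_on (A \<times> B) (\<lambda>z. f (fst z))"
  by (rule smooth_on_compose[OF open_Times[OF assms(1,2)] smooth_on_fst assms(3)]) auto

lemma smooth_on_compose_snd:
  assumes "open A" "open B" "smooth_on B f"
  shows "smooth_on (A \<times> B) (\<lambda>z. f (snd z))"
  by (rule smooth_on_compose[OF open_Times[OF assms(1,2)] smooth_on_snd assms(3)]) auto

lemma sum_Basis_prod:
  fixes r :: "'a::euclidean_space \<times> 'b::euclidean_space \<Rightarrow> 'c::comm_monoid_add"
  shows "(\<Sum>p\<in>Basis. r p) = (\<Sum>b\<in>Basis. r (b, 0)) + (\<Sum>c\<in>Basis. r (0, c))"
proof -
  have "(\<Sum>p\<in>Basis. r p) = (\<Sum>p\<in>(\<lambda>u. (u, 0)) ` Basis. r p) + (\<Sum>p\<in>(\<lambda>v. (0, v)) ` Basis. r p)"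
    unfolding Basis_prod_def by (rule sum.union_disjoint) auto
  then show ?thesis by (simp add: sum.reindex inj_on_def)
qed

locale warped_domain = g: metric_domain A g + h: metric_domain B h
  for A :: "'e::euclidean_space set" and g and B :: "'k::euclidean_space set" and h +
  fixes L :: "'e \<Rightarrow> real"
  assumes smooth_L: "smooth_on A L" and L_pos: "x \<in> A \<Longrightarrow> L x > 0"
begin

abbreviation K where "K \<equiv> warped_metric g L h"

lemma K_smooth: "smooth_on (A \<times> B) (\<lambda>z. K z U V)"
  unfolding warped_metric_def
  by (intro smooth_on_add smooth_on_mult smooth_on_power2 open_Times g.open_dom h.open_dom
      smooth_on_compose_fst[OF g.open_dom h.open_dom] smooth_on_compose_snd[OF g.open_dom h.open_dom]
      g.smooth_const h.smooth_const smooth_L)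

lemma K_metric: "metric_field_on (A \<times> B) K"
  unfolding metric_field_on_def
proof (intro conjI ballI allI impI)
  fix z assume z: "z \<in> A \<times> B"
  then have x: "fst z \<in> A" and y: "snd z \<in> B" by auto
  note bg = g.bilinear_at[OF x] and bh = h.bilinear_at[OF y]
  show "bilinear (K z)"
    unfolding bilinear_def
    by (intro conjI allI linearI) (simp_all add: warped_metric_def bilinear_ladd[OF bg] bilinear_radd[OF bg]
      bilinear_lmul[OF bg] bilinear_rmul[OF bg] bilinear_ladd[OF bh] bilinear_radd[OF bh]
      bilinear_lmul[OF bh] bilinear_rmul[OF bh] algebra_simps)
  show "K z U V = K z V U" for U V
    by (simp add: warped_metric_def g.sym[OF x, of "fst U"] h.sym[OF y, of "snd U"])
  show "K z U U > 0" if "U \<noteq> 0" for U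
  proof -
    have pos: "L (fst z) > 0" by (rule L_pos[OF x])
    have g0: "g (fst z) u u \<ge> 0" "u \<noteq> 0 \<Longrightarrow> g (fst z) u u > 0" for u
      using g.inner_form_at[OF x] bilinear_lzero[OF bg, of 0] by (cases "u = 0"; force simp: inner_form_def)+
    have h0: "h (snd z) u u \<ge> 0" "u \<noteq> 0 \<Longrightarrow> h (snd z) u u > 0" for u
      using h.inner_form_at[OF y] bilinear_lzero[OF bh, of 0] by (cases "u = 0"; force simp: inner_form_def)+
    have "fst U \<noteq> 0 \<or> snd U \<noteq> 0" using that by (auto simp: prod_eq_iff)
    then show ?thesis
      unfolding warped_metric_def
      using g0(1)[of "fst U"] g0(2)[of "fst U"] h0(1)[of "snd U"] h0(2)[of "snd U"] pos
      by (metis add_nonneg_pos add_pos_nonneg mult_nonneg_nonneg mult_pos_pos zero_le_power2 zero_less_power)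
  qed
qed (rule K_smooth)

sublocale K: metric_domain "A \<times> B" K
  by unfold_locales (simp_all add: K_metric open_Times g.open_dom h.open_dom)

lemma D_K:
  assumes "x \<in> A" "y \<in> B"
  shows "D (\<lambda>z. K z (a, b) (c, d)) (x, y) (u, v)
    = D (\<lambda>x. g x a c) x u + 2 * L x * D L x u * h y b d + (L x)\<^sup>2 * D (\<lambda>y. h y b d) y v"
proof -
  note dL = smooth_on_differentiable[OF smooth_L assms(1)]
  note dg = smooth_on_differentiable[OF g.smooth_const assms(1)]
  note dh = smooth_on_differentiable[OF h.smooth_const assms(2)]
  have xy: "(x, y) \<in> A \<times> B" using assms by simp
  have o: "open (A \<times> B)" by (rule open_Times[OF g.open_dom h.open_dom])
  have sL: "smooth_on (A \<times> B) (\<lambda>z. (L (fst z))\<^sup>2)"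
    by (intro smooth_on_power2 smooth_on_compose_fst[OF g.open_dom h.open_dom] smooth_L o)
  have sg: "smooth_on (A \<times> B) (\<lambda>z. g (fst z) a c)"
    by (intro smooth_on_compose_fst[OF g.open_dom h.open_dom] g.smooth_const)
  have sh: "smooth_on (A \<times> B) (\<lambda>z. h (snd z) b d)"
    by (intro smooth_on_compose_snd[OF g.open_dom h.open_dom] h.smooth_const)
  have dL2: "D (\<lambda>z. (L (fst z))\<^sup>2) (x, y) (u, v) = 2 * L x * D L x u"
    using D_compose_fst[of "\<lambda>x. (L x)\<^sup>2" "(x, y)" "(u, v)"] dL
      smooth_on_differentiable[OF smooth_on_power2[OF g.open_dom smooth_L] assms(1)]
    by (simp add: D_power2)
  have "D (\<lambda>z. K z (a, b) (c, d)) (x, y) (u, v)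
    = D (\<lambda>z. g (fst z) a c) (x, y) (u, v) + D (\<lambda>z. (L (fst z))\<^sup>2 * h (snd z) b d) (x, y) (u, v)"
    unfolding warped_metric_def fst_conv snd_conv
    by (rule D_add[OF smooth_on_differentiable[OF sg xy] smooth_on_differentiable[OF smooth_on_mult[OF o sL sh] xy]])
  also have "D (\<lambda>z. (L (fst z))\<^sup>2 * h (snd z) b d) (x, y) (u, v)
    = (L x)\<^sup>2 * D (\<lambda>z. h (snd z) b d) (x, y) (u, v) + 2 * L x * D L x u * h y b d"
    using D_mult[OF smooth_on_differentiable[OF sL xy] smooth_on_differentiable[OF sh xy], of "(u, v)"]
    by (simp add: dL2)
  also have "D (\<lambda>z. h (snd z) b d) (x, y) (u, v) = D (\<lambda>y. h y b d) y v"
    using D_compose_snd[of "\<lambda>y. h y b d" "(x, y)" "(u, v)"] dh by simp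
  also have "D (\<lambda>z. g (fst z) a c) (x, y) (u, v) = D (\<lambda>x. g x a c) x u"
    using D_compose_fst[of "\<lambda>x. g x a c" "(x, y)" "(u, v)"] dg by simp
  finally show ?thesis by simp
qed

text \<open>O'Neill's formulas, confirmed by checking the Koszul identity. Derivatives of the
  squared warping factor account both for the gradient term in the base and for the logarithmic
  derivatives in the fibre.\<close>

lemma christoffel_warped:
  assumes "x \<in> A" "y \<in> B"
  shows "christoffel K (x, y) (u, v) (u', v')
    = (christoffel g x u u' - (L x * h y v v') *\<^sub>R gradient g L x,
       christoffel h y v v' + (D L x u / L x) *\<^sub>R v' + (D L x u' / L x) *\<^sub>R v)"
proof (rule K.christoffel_eqI)
  show "(x, y) \<in> A \<times> B" using assms by simp
  fix z :: "'e \<times> 'k"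
  obtain c d where z: "z = (c, d)" by (cases z)
  note bg = g.bilinear_at[OF assms(1)] and bh = h.bilinear_at[OF assms(2)]
  have "L x > 0" by (rule L_pos[OF assms(1)])
  then show "K (x, y) (christoffel g x u u' - (L x * h y v v') *\<^sub>R gradient g L x,
       christoffel h y v v' + (D L x u / L x) *\<^sub>R v' + (D L x u' / L x) *\<^sub>R v) z
    = koszul K (x, y) (u, v) (u', v') z"
    unfolding z koszul_def D_K[OF assms]
    by (simp add: warped_metric_def bilinear_lsub[OF bg] bilinear_ladd[OF bh] bilinear_lmul[OF bg] bilinear_lmul[OF bh]
      g.christoffel_koszul[OF assms(1)] h.christoffel_koszul[OF assms(2)]
      g.gradient_metric[OF assms(1) smooth_on_differentiable[OF smooth_L assms(1)]] koszul_def
      power2_eq_square field_simps)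
qed

lemma gradient_ln:
  assumes "x \<in> A"
  shows "gradient g (\<lambda>x. ln (L x)) x = (1 / L x) *\<^sub>R gradient g L x"
proof (rule g.gradient_eqI[OF assms])
  note dL = smooth_on_differentiable[OF smooth_L assms]
  show "g x ((1 / L x) *\<^sub>R gradient g L x) v = D (\<lambda>x. ln (L x)) x v" for v
    by (simp add: D_ln[OF dL L_pos[OF assms]] bilinear_lmul[OF g.bilinear_at[OF assms]]
      g.gradient_metric[OF assms dL])
qed

text \<open>The test \<open>snd p = 0\<close> separates horizontal from vertical basis vectors of
  the product. The factor \<open>1 / L x\<close> is frozen at \<open>x\<close>: a trace asks for
  orthonormality at one point.\<close>

definition warped_frame :: "'e \<Rightarrow> ('e \<Rightarrow> 'e) \<Rightarrow> ('k \<Rightarrow> 'k) \<Rightarrow> 'e \<times> 'k \<Rightarrow> 'e \<times> 'k" where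
  "warped_frame x e \<epsilon> p = (if snd p = 0 then (e (fst p), 0) else (0, (1 / L x) *\<^sub>R \<epsilon> (snd p)))"

lemma sum_warped_frame:
  fixes r :: "'e \<times> 'k \<Rightarrow> 'c::comm_monoid_add"
  shows "(\<Sum>p\<in>Basis. r (warped_frame x e \<epsilon> p))
    = (\<Sum>b\<in>Basis. r (e b, 0)) + (\<Sum>c\<in>Basis. r (0, (1 / L x) *\<^sub>R \<epsilon> c))"
  by (simp add: sum_Basis_prod warped_frame_def nonzero_Basis)

lemma warped_frame_orthonormal:
  assumes "x \<in> A" "y \<in> B" "orthonormal_for (g x) e" "orthonormal_for (h y) \<epsilon>"
  shows "orthonormal_for (K (x, y)) (warped_frame x e \<epsilon>)"
proof -
  note bg = g.bilinear_at[OF assms(1)] and bh = h.bilinear_at[OF assms(2)]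
  show ?thesis
    using assms(3,4) L_pos[OF assms(1)] unfolding orthonormal_for_def Basis_prod_def
    by (auto simp: warped_frame_def warped_metric_def nonzero_Basis bilinear_lzero[OF bg] bilinear_rzero[OF bg]
      bilinear_lzero[OF bh] bilinear_rzero[OF bh] bilinear_lmul[OF bh] bilinear_rmul[OF bh] power2_eq_square)
      (metis zero_neq_one)+
qed

lemma h_frame: "y \<in> B \<Longrightarrow> orthonormal_for (h y) \<epsilon> \<Longrightarrow> c \<in> Basis \<Longrightarrow> h y ((1 / r) *\<^sub>R \<epsilon> c) ((1 / r) *\<^sub>R \<epsilon> c) = 1 / r\<^sup>2"
  using bilinear_lmul[OF h.bilinear_at] bilinear_rmul[OF h.bilinear_at]
  by (simp add: orthonormal_for_def power2_eq_square)

end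

text \<open>The warped product with factor 1; its connection is inherited from the warped case,
  where the gradient of the factor vanishes.\<close>

locale product_domain = g: metric_domain A g + h: metric_domain B h
  for A :: "'e::euclidean_space set" and g and B :: "'k::euclidean_space set" and h
begin

sublocale warped_domain A g B h "\<lambda>_. 1"
  by unfold_locales simp_all

abbreviation H where "H \<equiv> warped_metric g (\<lambda>_. 1) h"

lemma christoffel_product:
  assumes "x \<in> A" "y \<in> B"
  shows "christoffel H (x, y) U V = (christoffel g x (fst U) (fst V), christoffel h y (snd U) (snd V))"
proof -
  have "gradient g (\<lambda>_. 1) x = 0"
    using bilinear_lzero[OF g.bilinear_at[OF assms(1)]] by (intro g.gradient_eqI[OF assms(1)]) simp
  then show ?thesis
    using christoffel_warped[OF assms, of "fst U" "snd U" "fst V" "snd V"] by simp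
qed

lemma D_christoffel_product:
  assumes "x \<in> A" "y \<in> B"
  shows "D (\<lambda>z. christoffel H z U V) (x, y) W
    = (D (\<lambda>x. christoffel g x (fst U) (fst V)) x (fst W), D (\<lambda>y. christoffel h y (snd U) (snd V)) y (snd W))"
proof -
  have o: "open (A \<times> B)" by (rule open_Times[OF g.open_dom h.open_dom])
  have xy: "(x, y) \<in> A \<times> B" using assms by simp
  have sg: "smooth_on (A \<times> B) (\<lambda>z. christoffel g (fst z) (fst U) (fst V))"
    by (rule smooth_on_compose_fst[OF g.open_dom h.open_dom g.smooth_christoffel])
  have sh: "smooth_on (A \<times> B) (\<lambda>z. christoffel h (snd z) (snd U) (snd V))"
    by (rule smooth_on_compose_snd[OF g.open_dom h.open_dom h.smooth_christoffel])
  have "D (\<lambda>z. christoffel H z U V) (x, y) W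
    = D (\<lambda>z. (christoffel g (fst z) (fst U) (fst V), christoffel h (snd z) (snd U) (snd V))) (x, y) W"
    by (rule fun_cong[OF D_cong[OF o xy]]) (auto simp: christoffel_product)
  also have "\<dots> = (D (\<lambda>z. christoffel g (fst z) (fst U) (fst V)) (x, y) W,
      D (\<lambda>z. christoffel h (snd z) (snd U) (snd V)) (x, y) W)"
    by (rule D_Pair[OF smooth_on_differentiable[OF sg xy] smooth_on_differentiable[OF sh xy]])
  finally show ?thesis
    using D_compose_fst[of "\<lambda>x. christoffel g x (fst U) (fst V)" "(x, y)" W]
      D_compose_snd[of "\<lambda>y. christoffel h y (snd U) (snd V)" "(x, y)" W]
      smooth_on_differentiable[OF g.smooth_christoffel assms(1)]
      smooth_on_differentiable[OF h.smooth_christoffel assms(2)]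
    by simp
qed

lemma curvature_product:
  assumes "x \<in> A" "y \<in> B"
  shows "curvature_at H (x, y) U V W
    = (curvature_at g x (fst U) (fst V) (fst W), curvature_at h y (snd U) (snd V) (snd W))"
  using assms
  by (simp add: K.curvature_at_christoffel g.curvature_at_christoffel h.curvature_at_christoffel
      D_christoffel_product christoffel_product)

end


section \<open>The product map in local coordinates\<close>

text \<open>The right-hand side of the equation in one pair of charts, with the terms arranged as in
  the theorem so that unfolding identifies the two. The number n is \<open>DIM('k)\<close>.\<close>

definition bitension_pde ::
  "'e::euclidean_space metric_field \<Rightarrow> 'k::euclidean_space metric_field \<Rightarrow> ('e \<Rightarrow> real) \<Rightarrow> ('e \<times> 'k \<Rightarrow> real)
    \<Rightarrow> 'e \<Rightarrow> 'k \<Rightarrow> 'e" where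
  "bitension_pde g h L w x y = (let X = gradient g (\<lambda>x. ln (L x)) in
     w (x, y) *\<^sub>R trace_nabla2 g X x
     + (real DIM('k) / 2 * w (x, y)) *\<^sub>R gradient g (\<lambda>x. g x (X x) (X x)) x
     + w (x, y) *\<^sub>R ricci g X x
     + laplacian (warped_metric g L h) w (x, y) *\<^sub>R X x
     + 2 *\<^sub>R nabla g (gradient g (\<lambda>x. w (x, y))) X x)"

text \<open>\<open>A\<close> and \<open>B\<close> stand for the parts of two source charts that
  \<open>T\<close> and \<open>q\<close> send into the target charts \<open>A'\<close> and
  \<open>B'\<close>. \<open>F\<close> is prescribed on \<open>A \<times> B\<close> only, since a
  chart representative is arbitrary elsewhere.\<close>

locale product_map_domain =
  warped_domain A g B h L + T: isometry_domain A A' g g' T + q: map_domain B h B' h' q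
  for A A' :: "'e::euclidean_space set" and g g' and B B' :: "'k::euclidean_space set" and h h' L T q +
  fixes F :: "'e \<times> 'k \<Rightarrow> 'e \<times> 'k"
  assumes F_eq: "z \<in> A \<times> B \<Longrightarrow> F z = (T (fst z), q (snd z))"
    and harmonic: "y \<in> B \<Longrightarrow> tension h h' q y = 0"
begin

sublocale H: product_domain A' g' B' h'
  by unfold_locales

abbreviation H where "H \<equiv> warped_metric g' (\<lambda>_. 1) h'"

abbreviation X where "X \<equiv> gradient g (\<lambda>x. ln (L x))"

lemma open_prod: "open (A \<times> B)" by (rule open_Times[OF g.open_dom h.open_dom])

lemma smooth_F: "smooth_on (A \<times> B) F"
proof (rule smooth_on_cong[OF open_prod])
  show "smooth_on (A \<times> B) (\<lambda>z. (T (fst z), q (snd z)))"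
    by (intro smooth_on_Pair open_prod smooth_on_compose_fst[OF g.open_dom h.open_dom T.smooth_map]
        smooth_on_compose_snd[OF g.open_dom h.open_dom q.smooth_map])
qed (simp add: F_eq)

sublocale F: map_domain "A \<times> B" K "A' \<times> B'" H F
  using T.maps q.maps by unfold_locales (auto simp: smooth_F F_eq)

lemma D_pair_split:
  assumes "smooth_on A a" "smooth_on B b" "x \<in> A" "y \<in> B"
    and "\<And>z. z \<in> A \<times> B \<Longrightarrow> f z = (a (fst z), b (snd z))"
  shows "D f (x, y) U = (D a x (fst U), D b y (snd U))"
proof -
  have xy: "(x, y) \<in> A \<times> B" using assms by simp
  have "D f (x, y) U = D (\<lambda>z. (a (fst z), b (snd z))) (x, y) U"
    by (rule fun_cong[OF D_cong[OF open_prod xy assms(5)]])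
  also have "\<dots> = (D (\<lambda>z. a (fst z)) (x, y) U, D (\<lambda>z. b (snd z)) (x, y) U)"
    by (rule D_Pair[OF smooth_on_differentiable[OF smooth_on_compose_fst[OF g.open_dom h.open_dom assms(1)] xy]
        smooth_on_differentiable[OF smooth_on_compose_snd[OF g.open_dom h.open_dom assms(2)] xy]])
  also have "\<dots> = (D a x (fst U), D b y (snd U))"
    using D_compose_fst[of a "(x, y)" U] D_compose_snd[of b "(x, y)" U]
      smooth_on_differentiable[OF assms(1,3)] smooth_on_differentiable[OF assms(2,4)] by simp
  finally show ?thesis .
qed

lemma D_F: "x \<in> A \<Longrightarrow> y \<in> B \<Longrightarrow> D F (x, y) U = (D T x (fst U), D q y (snd U))"
  by (rule D_pair_split[OF T.smooth_map q.smooth_map _ _ F_eq])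

lemma D_D_F:
  assumes "x \<in> A" "y \<in> B"
  shows "D (\<lambda>z. D F z V) (x, y) U
    = (D (\<lambda>x. D T x (fst V)) x (fst U), D (\<lambda>y. D q y (snd V)) y (snd U))"
  by (rule D_pair_split[OF smooth_on_D[OF T.smooth_map] smooth_on_D[OF q.smooth_map] assms]) (auto simp: D_F)

lemma smooth_lnL: "smooth_on A (\<lambda>x. ln (L x))"
  by (rule smooth_on_ln[OF g.open_dom smooth_L L_pos])

lemma smooth_X: "smooth_on A X"
  by (rule g.smooth_gradient[OF smooth_lnL])

lemma X_eq: "x \<in> A \<Longrightarrow> gradient g L x = L x *\<^sub>R X x"
  using L_pos[of x] by (simp add: gradient_ln)

section \<open>Tension field of the product map\<close>

lemma christoffel_horizontal:
  assumes "x \<in> A" "y \<in> B"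
  shows "christoffel K (x, y) (u, 0) (u, 0) = (christoffel g x u u, 0)"
  using bilinear_lzero[OF h.bilinear_at[OF assms(2)]] bilinear_lzero[OF h.christoffel_bilinear[OF assms(2)]]
  by (simp add: christoffel_warped[OF assms])

text \<open>The horizontal part is the second fundamental form of the fibres, expressed through
  \<open>X\<close> by \<open>X_eq\<close>.\<close>

lemma christoffel_vertical:
  assumes "x \<in> A" "y \<in> B"
  shows "christoffel K (x, y) (0, v) (0, v) = (- ((L x)\<^sup>2 * h y v v) *\<^sub>R X x, christoffel h y v v)"
  using bilinear_lzero[OF g.christoffel_bilinear[OF assms(1)]]
    linear_0[OF D_linear[OF smooth_on_differentiable[OF smooth_L assms(1)]]]
  by (simp add: christoffel_warped[OF assms] X_eq[OF assms(1)] power2_eq_square algebra_simps)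

lemma tension_product_map:
  assumes "x \<in> A" "y \<in> B"
  shows "tension K H F (x, y) = (real DIM('k) *\<^sub>R D T x (X x), 0)"
proof -
  have xy: "(x, y) \<in> A \<times> B" using assms by simp
  have Tx: "T x \<in> A'" and qy: "q y \<in> B'" using T.F_in q.F_in assms by auto
  have Fxy: "F (x, y) = (T x, q y)" using F_eq[OF xy] by simp
  have "\<exists>e. orthonormal_for (g x) e" "\<exists>e. orthonormal_for (h y) e"
    using g.exists_orthonormal h.exists_orthonormal assms by blast+
  then obtain e \<epsilon> where e: "orthonormal_for (g x) e" and \<epsilon>: "orthonormal_for (h y) \<epsilon>" by blast
  let ?Q = "\<lambda>U. cov_hess K H F (D F) (x, y) U U"
  have DT0: "D (\<lambda>x. D T x v) x 0 = 0" for v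
    by (rule linear_0[OF D_linear[OF smooth_on_differentiable[OF smooth_on_D[OF T.smooth_map] assms(1)]]])
  have Dq0: "D (\<lambda>y. D q y v) y 0 = 0" for v
    by (rule linear_0[OF D_linear[OF smooth_on_differentiable[OF smooth_on_D[OF q.smooth_map] assms(2)]]])
  note zeros = DT0 Dq0 linear_0[OF T.linear_D_map[OF assms(1)]] linear_0[OF q.linear_D_map[OF assms(2)]]
    bilinear_lzero[OF T.H.christoffel_bilinear[OF Tx]] bilinear_lzero[OF q.H.christoffel_bilinear[OF qy]]
  \<comment> \<open>In horizontal directions only \<open>T\<close> is seen, and an isometry is
    totally geodesic.\<close>
  have hor: "?Q (u, 0) = 0" for u
    using T.christoffel_transform[OF assms(1), of u u]
    by (simp add: cov_hess_def D_D_F[OF assms] D_F[OF assms] Fxy H.christoffel_product[OF Tx qy]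
        christoffel_horizontal[OF assms] zeros)
  have ver: "?Q (0, v) = (((L x)\<^sup>2 * h y v v) *\<^sub>R D T x (X x), cov_hess h h' q (D q) y v v)" for v
    by (simp add: cov_hess_def D_D_F[OF assms] D_F[OF assms] Fxy H.christoffel_product[OF Tx qy]
        christoffel_vertical[OF assms] zeros linear_scale[OF T.linear_D_map[OF assms(1)]]
        linear_neg[OF T.linear_D_map[OF assms(1)]])
  \<comment> \<open>Rescaling to unit length removes the factor \<open>(L x)\<^sup>2\<close> from
    the base component. Every vertical frame vector thus contributes the same
    \<open>D T x (X x)\<close>, and there are \<open>DIM('k)\<close> of them.\<close>
  have Qv: "?Q (0, (1 / L x) *\<^sub>R \<epsilon> c)
      = (D T x (X x), (1 / (L x)\<^sup>2) *\<^sub>R cov_hess h h' q (D q) y (\<epsilon> c) (\<epsilon> c))" if "c \<in> Basis" for c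
  proof -
    note bc = q.bilinear_cov_hess[OF linear_field_D[OF q.smooth_map] assms(2)]
    have "cov_hess h h' q (D q) y ((1 / L x) *\<^sub>R \<epsilon> c) ((1 / L x) *\<^sub>R \<epsilon> c)
      = (1 / (L x)\<^sup>2) *\<^sub>R cov_hess h h' q (D q) y (\<epsilon> c) (\<epsilon> c)"
      using linear_scale[OF bc(1), of "1 / L x" "\<epsilon> c" "(1 / L x) *\<^sub>R \<epsilon> c"]
        linear_scale[OF bc(2), of "\<epsilon> c" "1 / L x" "\<epsilon> c"] by (simp add: power2_eq_square)
    then show ?thesis
      using h_frame[OF assms(2) \<epsilon> that, of "L x"] L_pos[OF assms(1)] by (simp add: ver)
  qed
  have "tension K H F (x, y) = (\<Sum>p\<in>Basis. ?Q (warped_frame x e \<epsilon> p))"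
    by (rule F.tension_trace[OF xy warped_frame_orthonormal[OF assms e \<epsilon>]])
  also have "\<dots> = (\<Sum>c\<in>Basis. (D T x (X x), (1 / (L x)\<^sup>2) *\<^sub>R cov_hess h h' q (D q) y (\<epsilon> c) (\<epsilon> c)))"
    unfolding sum_warped_frame[where r = ?Q] by (simp add: hor Qv)
  also have "\<dots> = (real DIM('k) *\<^sub>R D T x (X x),
      (1 / (L x)\<^sup>2) *\<^sub>R (\<Sum>c\<in>Basis. cov_hess h h' q (D q) y (\<epsilon> c) (\<epsilon> c)))"
    by (simp add: prod_eq_iff fst_sum snd_sum scaleR_sum_right sum_constant_scaleR)
  also have "(\<Sum>c\<in>Basis. cov_hess h h' q (D q) y (\<epsilon> c) (\<epsilon> c)) = 0"
    using q.tension_trace[OF assms(2) \<epsilon>] harmonic[OF assms(2)] by simp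
  finally show ?thesis by simp
qed

section \<open>The f-bitension field of the product map\<close>

context
  fixes w :: "'e \<times> 'k \<Rightarrow> real"
  assumes smooth_w: "smooth_on (A \<times> B) w"
begin

text \<open>The covariant derivative along \<open>U\<close> of \<open>w\<close> times
  \<open>X\<close>, where \<open>X\<close> is lifted to the product but differentiated with the
  connection of \<open>g\<close>. By \<open>pcov_V\<close> it is, up to \<open>D T\<close> and the
  factor n, the derivative of the weighted tension field.\<close>

definition Y :: "'e \<times> 'k \<Rightarrow> 'e \<times> 'k \<Rightarrow> 'e" where
  "Y z U = D w z U *\<^sub>R X (fst z) + w z *\<^sub>R cov g X (fst z) (fst U)"

lemma smooth_cov_X: "smooth_on A (\<lambda>x. cov g X x u)"
  using g.linear_field_cov[OF smooth_X] by (simp add: linear_field_on_def)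

lemma smooth_Y: "smooth_on (A \<times> B) (\<lambda>z. Y z U)"
  unfolding Y_def
  by (intro smooth_on_add smooth_on_scaleR open_prod smooth_on_D smooth_w
      smooth_on_compose_fst[OF g.open_dom h.open_dom smooth_X]
      smooth_on_compose_fst[OF g.open_dom h.open_dom smooth_cov_X])

text \<open>Argument and direction are the same \<open>U\<close>, because only diagonal values enter
  a trace.\<close>

lemma D_Y:
  assumes "x \<in> A" "y \<in> B"
  shows "D (\<lambda>z. Y z U) (x, y) U = D (\<lambda>z. D w z U) (x, y) U *\<^sub>R X x + D w (x, y) U *\<^sub>R D X x (fst U)
    + D w (x, y) U *\<^sub>R cov g X x (fst U) + w (x, y) *\<^sub>R D (\<lambda>x. cov g X x (fst U)) x (fst U)"
proof -
  have xy: "(x, y) \<in> A \<times> B" using assms by simp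
  let ?X = "\<lambda>z. X (fst z)" and ?C = "\<lambda>z. cov g X (fst z) (fst U)"
  have sX: "smooth_on (A \<times> B) ?X" and sC: "smooth_on (A \<times> B) ?C"
    using smooth_on_compose_fst[OF g.open_dom h.open_dom smooth_X]
      smooth_on_compose_fst[OF g.open_dom h.open_dom smooth_cov_X] .
  note d = smooth_on_differentiable[OF _ xy]
  have "D (\<lambda>z. Y z U) (x, y) U = D (\<lambda>z. D w z U *\<^sub>R ?X z) (x, y) U + D (\<lambda>z. w z *\<^sub>R ?C z) (x, y) U"
    unfolding Y_def
    by (rule D_add[OF d[OF smooth_on_scaleR[OF open_prod smooth_on_D[OF smooth_w] sX]]
        d[OF smooth_on_scaleR[OF open_prod smooth_w sC]]])
  also have "D (\<lambda>z. D w z U *\<^sub>R ?X z) (x, y) U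
      = D w (x, y) U *\<^sub>R D ?X (x, y) U + D (\<lambda>z. D w z U) (x, y) U *\<^sub>R X x"
    using D_scaleR[OF d[OF smooth_on_D[OF smooth_w]] d[OF sX], of U U] by simp
  also have "D (\<lambda>z. w z *\<^sub>R ?C z) (x, y) U = w (x, y) *\<^sub>R D ?C (x, y) U + D w (x, y) U *\<^sub>R cov g X x (fst U)"
    using D_scaleR[OF d[OF smooth_w] d[OF sC], of U] by simp
  also have "D ?X (x, y) U = D X x (fst U)"
    using D_compose_fst[of X "(x, y)" U] smooth_on_differentiable[OF smooth_X assms(1)] by simp
  also have "D ?C (x, y) U = D (\<lambda>x. cov g X x (fst U)) x (fst U)"
    using D_compose_fst[of "\<lambda>x. cov g X x (fst U)" "(x, y)" U]
      smooth_on_differentiable[OF smooth_cov_X assms(1)] by simp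
  finally show ?thesis by (simp add: algebra_simps)
qed

abbreviation V where "V \<equiv> \<lambda>z. w z *\<^sub>R tension K H F z"

lemma V_eq: "z \<in> A \<times> B \<Longrightarrow> V z = w z *\<^sub>R (real DIM('k) *\<^sub>R D T (fst z) (X (fst z)), 0)"
  by (cases z) (simp add: tension_product_map)

lemma smooth_TX: "smooth_on A (\<lambda>x. D T x (X x))"
  by (rule linear_field_smooth[OF g.open_dom linear_field_D[OF T.smooth_map] smooth_X])

lemma smooth_push: "smooth_on (A \<times> B) (\<lambda>z. (real DIM('k) *\<^sub>R D T (fst z) (X (fst z)), 0 :: 'k))"
  by (intro smooth_on_Pair smooth_on_scaleR smooth_on_const open_prod
      smooth_on_compose_fst[OF g.open_dom h.open_dom smooth_TX])

lemma smooth_V: "smooth_on (A \<times> B) V"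
  by (rule smooth_on_cong[OF open_prod _ smooth_on_scaleR[OF open_prod smooth_w smooth_push]])
    (rule V_eq[symmetric])

text \<open>The target metric is a product, so no Christoffel term reaches the fibre component; in
  the base, \<open>pcov_pushforward\<close> pulls the derivative back through
  \<open>T\<close>.\<close>

lemma pcov_V:
  assumes "x \<in> A" "y \<in> B"
  shows "pcov H F V (x, y) U = (real DIM('k) *\<^sub>R D T x (Y (x, y) U), 0)"
proof -
  have xy: "(x, y) \<in> A \<times> B" using assms by simp
  have Tx: "T x \<in> A'" and qy: "q y \<in> B'" using T.F_in q.F_in assms by auto
  have Fxy: "F (x, y) = (T x, q y)" using F_eq[OF xy] by simp
  let ?n = "real DIM('k)"
  note lin = T.linear_D_map[OF assms(1)]
  have "D V (x, y) U = D (\<lambda>z. w z *\<^sub>R (?n *\<^sub>R D T (fst z) (X (fst z)), 0)) (x, y) U"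
    by (rule fun_cong[OF D_cong[OF open_prod xy V_eq]])
  also have "\<dots> = w (x, y) *\<^sub>R D (\<lambda>z. (?n *\<^sub>R D T (fst z) (X (fst z)), 0)) (x, y) U
      + D w (x, y) U *\<^sub>R (?n *\<^sub>R D T x (X x), 0)"
    using D_scaleR[OF smooth_on_differentiable[OF smooth_w xy] smooth_on_differentiable[OF smooth_push xy], of U]
    by simp
  also have "D (\<lambda>z. (?n *\<^sub>R D T (fst z) (X (fst z)), 0)) (x, y) U
      = (?n *\<^sub>R D (\<lambda>x. D T x (X x)) x (fst U), 0)"
    using D_pair_split[where f = "\<lambda>z. (?n *\<^sub>R D T (fst z) (X (fst z)), 0)" and U = U,
        OF smooth_on_scaleR[OF g.open_dom smooth_on_const smooth_TX] smooth_on_const assms refl]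
      D_bounded_linear[OF bounded_linear_scaleR_right smooth_on_differentiable[OF smooth_TX assms(1)], of ?n "fst U"]
    by simp
  finally have DV: "D V (x, y) U = (?n *\<^sub>R (w (x, y) *\<^sub>R D (\<lambda>x. D T x (X x)) x (fst U) + D w (x, y) U *\<^sub>R D T x (X x)), 0)"
    by (simp add: algebra_simps)
  have "christoffel H (F (x, y)) (D F (x, y) U) (V (x, y))
      = (?n *\<^sub>R w (x, y) *\<^sub>R christoffel g' (T x) (D T x (fst U)) (D T x (X x)), 0)"
    using bilinear_rzero[OF q.H.christoffel_bilinear[OF qy]]
    by (simp add: Fxy V_eq[OF xy] D_F[OF assms] H.christoffel_product[OF Tx qy]
        bilinear_rmul[OF T.H.christoffel_bilinear[OF Tx]] mult.commute)
  moreover have "D T x (Y (x, y) U) = D w (x, y) U *\<^sub>R D T x (X x) + w (x, y) *\<^sub>R D T x (cov g X x (fst U))"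
    by (simp only: Y_def fst_conv linear_add[OF lin, of "D w (x, y) U *\<^sub>R X x"] linear_scale[OF lin])
  ultimately show ?thesis
    unfolding DV T.pcov_pushforward[OF smooth_X assms(1), symmetric] by (simp add: algebra_simps)
qed

text \<open>Again the second derivative of \<open>T\<close> joins with the Christoffel form of
  \<open>g'\<close> to give that of \<open>g\<close>. From here on the computation takes place on
  the source, under a single \<open>D T x\<close>.\<close>

lemma cov_hess_V:
  assumes "x \<in> A" "y \<in> B"
  shows "cov_hess K H F (pcov H F V) (x, y) U U
    = (real DIM('k) *\<^sub>R D T x (D (\<lambda>z. Y z U) (x, y) U + christoffel g x (fst U) (Y (x, y) U)
        - Y (x, y) (christoffel K (x, y) U U)), 0)"
proof -
  have xy: "(x, y) \<in> A \<times> B" using assms by simp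
  have Tx: "T x \<in> A'" and qy: "q y \<in> B'" using T.F_in q.F_in assms by auto
  have Fxy: "F (x, y) = (T x, q y)" using F_eq[OF xy] by simp
  let ?n = "real DIM('k)" and ?Y = "\<lambda>z. Y z U"
  note lin = T.linear_D_map[OF assms(1)]
  have lf: "linear_field_on (A \<times> B) (\<lambda>z. D T (fst z))"
    using linear_field_compose[OF open_prod linear_field_D[OF T.smooth_map] smooth_on_fst] by auto
  have sTY: "smooth_on (A \<times> B) (\<lambda>z. D T (fst z) (?Y z))"
    by (rule linear_field_smooth[OF open_prod lf smooth_Y])
  have "D (\<lambda>z. pcov H F V z U) (x, y) U = D (\<lambda>z. (?n *\<^sub>R D T (fst z) (?Y z), 0)) (x, y) U"
    by (rule fun_cong[OF D_cong[OF open_prod xy]]) (auto simp: pcov_V)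
  also have "\<dots> = (?n *\<^sub>R D (\<lambda>z. D T (fst z) (?Y z)) (x, y) U, 0)"
    using D_Pair[OF smooth_on_differentiable[OF smooth_on_scaleR[OF open_prod smooth_on_const sTY] xy]
        smooth_on_differentiable[OF smooth_on_const xy], of ?n 0 U]
      D_bounded_linear[OF bounded_linear_scaleR_right smooth_on_differentiable[OF sTY xy], of ?n U]
    by simp
  also have "D (\<lambda>z. D T (fst z) (?Y z)) (x, y) U
      = D (\<lambda>z. D T (fst z) (?Y (x, y))) (x, y) U + D T x (D ?Y (x, y) U)"
    using D_linear_field[OF open_prod lf smooth_Y xy, of U] by simp
  also have "D (\<lambda>z. D T (fst z) (?Y (x, y))) (x, y) U = D (\<lambda>a. D T a (?Y (x, y))) x (fst U)"
    using D_compose_fst[of "\<lambda>a. D T a (?Y (x, y))" "(x, y)" U]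
      smooth_on_differentiable[OF smooth_on_D[OF T.smooth_map] assms(1)] by simp
  finally have DV: "D (\<lambda>z. pcov H F V z U) (x, y) U
      = (?n *\<^sub>R (D (\<lambda>a. D T a (?Y (x, y))) x (fst U) + D T x (D ?Y (x, y) U)), 0)" .
  have "christoffel H (F (x, y)) (D F (x, y) U) (pcov H F V (x, y) U)
      = (?n *\<^sub>R christoffel g' (T x) (D T x (fst U)) (D T x (?Y (x, y))), 0)"
    using bilinear_rzero[OF q.H.christoffel_bilinear[OF qy]]
    by (simp only: pcov_V[OF assms]) (simp add: Fxy D_F[OF assms] H.christoffel_product[OF Tx qy]
        bilinear_rmul[OF T.H.christoffel_bilinear[OF Tx]])
  moreover have law: "D (\<lambda>a. D T a (?Y (x, y))) x (fst U)
      = D T x (christoffel g x (fst U) (?Y (x, y))) - christoffel g' (T x) (D T x (fst U)) (D T x (?Y (x, y)))"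
    using T.christoffel_transform[OF assms(1), of "?Y (x, y)" "fst U"] by (simp add: eq_diff_eq)
  ultimately show ?thesis
    unfolding cov_hess_def DV law pcov_V[OF assms]
    by (simp add: linear_add[OF lin] linear_diff[OF lin] algebra_simps)
qed

lemma f_bitension_product_map:
  assumes "x \<in> A" "y \<in> B"
  shows "f_bitension K H w F (x, y) = - (real DIM('k) *\<^sub>R D T x (bitension_pde g h L w x y), 0)"
proof -
  have xy: "(x, y) \<in> A \<times> B" using assms by simp
  have Tx: "T x \<in> A'" and qy: "q y \<in> B'" using T.F_in q.F_in assms by auto
  have Fxy: "F (x, y) = (T x, q y)" using F_eq[OF xy] by simp
  let ?n = "real DIM('k)"
  have "\<exists>e. orthonormal_for (g x) e" "\<exists>e. orthonormal_for (h y) e"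
    using g.exists_orthonormal h.exists_orthonormal assms by blast+
  then obtain e \<epsilon> where e: "orthonormal_for (g x) e" and \<epsilon>: "orthonormal_for (h y) \<epsilon>" by blast
  let ?E = "warped_frame x e \<epsilon>"
  note E = warped_frame_orthonormal[OF assms e \<epsilon>]
  note lin = T.linear_D_map[OF assms(1)]
  have lcov: "linear (cov g X x)"
    using g.linear_field_cov[OF smooth_X] assms(1) by (simp add: linear_field_on_def)
  have cov0: "cov g X a 0 = 0" if "a \<in> A" for a
    using linear_0[of "cov g X a"] g.linear_field_cov[OF smooth_X] that by (simp add: linear_field_on_def)
  have DX0: "D X x 0 = 0"
    by (rule linear_0[OF D_linear[OF smooth_on_differentiable[OF smooth_X assms(1)]]])
  have Dcov0: "D (\<lambda>a. cov g X a 0) x 0 = 0"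
    by (rule linear_0[OF D_linear[OF smooth_on_differentiable[OF smooth_cov_X assms(1)]]])
  \<comment> \<open>\<open>lap U\<close> is the Hessian of \<open>w\<close> in the warped metric,
    whose trace is the Laplacian; \<open>Z U\<close> is the second covariant derivative of
    \<open>w\<close> times \<open>X\<close>. Both are on the diagonal.\<close>
  define lap where "lap = (\<lambda>U. D (\<lambda>z. D w z U) (x, y) U - D w (x, y) (christoffel K (x, y) U U))"
  define Z where "Z = (\<lambda>U. D (\<lambda>z. Y z U) (x, y) U + christoffel g x (fst U) (Y (x, y) U)
        - Y (x, y) (christoffel K (x, y) U U))"
  note bC = g.christoffel_bilinear[OF assms(1)]
  have Z: "Z U = lap U *\<^sub>R X x + 2 *\<^sub>R D w (x, y) U *\<^sub>R cov g X x (fst U)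
      + w (x, y) *\<^sub>R (D (\<lambda>a. cov g X a (fst U)) x (fst U) + christoffel g x (fst U) (cov g X x (fst U))
          - cov g X x (fst (christoffel K (x, y) U U)))" for U
  proof -
    \<comment> \<open>The algebra is isolated over plain variables; \<open>c = p + p'\<close> splits
      a covariant derivative of \<open>X\<close> into its coordinate and Christoffel parts. First
      derivatives of \<open>w\<close> and of \<open>X\<close> meet twice, which is the factor 2 in
      the last term of the equation.\<close>
    have vec: "a *\<^sub>R v + d *\<^sub>R p + d *\<^sub>R c + r *\<^sub>R s + (d *\<^sub>R p' + r *\<^sub>R t) - (k *\<^sub>R v + r *\<^sub>R m)
        = (a - k) *\<^sub>R v + 2 *\<^sub>R d *\<^sub>R c + r *\<^sub>R (s + t - m)" if "c = p + p'"
      for a d r k :: real and v p p' c s t m :: 'e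
      unfolding that scaleR_2 by (simp add: algebra_simps)
    have GY: "christoffel g x (fst U) (Y (x, y) U)
        = D w (x, y) U *\<^sub>R christoffel g x (fst U) (X x) + w (x, y) *\<^sub>R christoffel g x (fst U) (cov g X x (fst U))"
      by (simp only: Y_def fst_conv bilinear_radd[OF bC, of _ "D w (x, y) U *\<^sub>R X x"] bilinear_rmul[OF bC])
    have YK: "Y (x, y) (christoffel K (x, y) U U) = D w (x, y) (christoffel K (x, y) U U) *\<^sub>R X x
        + w (x, y) *\<^sub>R cov g X x (fst (christoffel K (x, y) U U))"
      by (simp only: Y_def fst_conv)
    show ?thesis
      unfolding Z_def D_Y[OF assms] lap_def GY YK by (rule vec) (rule refl)
  qed
  have Zh: "Z (u, 0) = lap (u, 0) *\<^sub>R X x + 2 *\<^sub>R D w (x, y) (u, 0) *\<^sub>R cov g X x u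
      + w (x, y) *\<^sub>R cov_hess g g (\<lambda>x. x) (cov g X) x u u" for u
    by (simp add: Z christoffel_horizontal[OF assms] cov_hess_def)
  \<comment> \<open>\<open>X\<close> lives on the base, so its derivatives in a vertical direction
    vanish. What remains besides \<open>lap\<close> is the horizontal part \<open>- X x\<close> of
    the Christoffel form, which returns as the covariant derivative of \<open>X\<close> along
    itself.\<close>
  have Zv: "Z (0, (1 / L x) *\<^sub>R \<epsilon> c) = lap (0, (1 / L x) *\<^sub>R \<epsilon> c) *\<^sub>R X x + w (x, y) *\<^sub>R cov g X x (X x)"
    if "c \<in> Basis" for c
  proof -
    have "fst (christoffel K (x, y) (0, (1 / L x) *\<^sub>R \<epsilon> c) (0, (1 / L x) *\<^sub>R \<epsilon> c)) = - X x"
      using h_frame[OF assms(2) \<epsilon> that, of "L x"] L_pos[OF assms(1)]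
      by (simp add: christoffel_vertical[OF assms])
    then show ?thesis
      by (simp only: Z fst_conv cov0[OF assms(1)] Dcov0 bilinear_lzero[OF bC] linear_neg[OF lcov])
        (simp add: DX0 add.commute)
  qed
  have "(\<Sum>p\<in>Basis. Z (?E p)) = (\<Sum>p\<in>Basis. lap (?E p)) *\<^sub>R X x
      + (\<Sum>b\<in>Basis. 2 *\<^sub>R D w (x, y) (e b, 0) *\<^sub>R cov g X x (e b))
      + w (x, y) *\<^sub>R (\<Sum>b\<in>Basis. cov_hess g g (\<lambda>x. x) (cov g X) x (e b) (e b))
      + (?n * w (x, y)) *\<^sub>R cov g X x (X x)"
    unfolding sum_warped_frame[where r = Z] sum_warped_frame[where r = lap]
    by (simp add: Zh Zv sum.distrib scaleR_sum_left scaleR_sum_right scaleR_add_left sum_constant_scaleR)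
  also have "(\<Sum>p\<in>Basis. lap (?E p)) = laplacian K w (x, y)"
    unfolding lap_def by (rule K.laplacian_trace[OF smooth_w xy E, symmetric])
  also have "(\<Sum>b\<in>Basis. cov_hess g g (\<lambda>x. x) (cov g X) x (e b) (e b)) = trace_nabla2 g X x"
    by (rule g.trace_nabla2_trace[OF smooth_X assms(1) e, symmetric])
  \<comment> \<open>Mixed terms occur for horizontal vectors only; this is why the partial gradient
    along the base enters the equation and not the full gradient of \<open>w\<close>.\<close>
  also have "(\<Sum>b\<in>Basis. 2 *\<^sub>R D w (x, y) (e b, 0) *\<^sub>R cov g X x (e b))
      = 2 *\<^sub>R nabla g (gradient g (\<lambda>x. w (x, y))) X x"
  proof -
    have dw: "D (\<lambda>x. w (x, y)) x u = D w (x, y) (u, 0)" for u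
      by (rule D_partial_fst[OF smooth_on_differentiable[OF smooth_w xy]])
    have "linear (\<lambda>u. D w (x, y) (u, 0))"
      using linear_compose[OF _ D_linear[OF smooth_on_differentiable[OF smooth_w xy]], of "\<lambda>u. (u, 0)"]
      by (simp add: o_def linear_iff)
    from riesz_orthonormal[OF g.inner_form_at[OF assms(1)] e this]
    have "gradient g (\<lambda>x. w (x, y)) x = (\<Sum>b\<in>Basis. D w (x, y) (e b, 0) *\<^sub>R e b)"
      by (intro g.gradient_eqI[OF assms(1)]) (simp add: dw)
    then have "nabla g (gradient g (\<lambda>x. w (x, y))) X x = cov g X x (\<Sum>b\<in>Basis. D w (x, y) (e b, 0) *\<^sub>R e b)"
      by (simp add: nabla_def)
    also have "\<dots> = (\<Sum>b\<in>Basis. D w (x, y) (e b, 0) *\<^sub>R cov g X x (e b))"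
      by (simp only: linear_sum[OF lcov] linear_scale[OF lcov])
    finally show ?thesis by (simp only: scaleR_sum_right)
  qed
  \<comment> \<open>Here the coefficient \<open>?n\<close> turns into n/2.\<close>
  also have "cov g X x (X x) = (1/2) *\<^sub>R gradient g (\<lambda>x. g x (X x) (X x)) x"
    using g.nabla_gradient_self[OF smooth_lnL assms(1)] by (simp add: nabla_def)
  \<comment> \<open>The Ricci term is still missing; the curvature sum below provides it.\<close>
  finally have sumZ: "(\<Sum>p\<in>Basis. Z (?E p)) = bitension_pde g h L w x y - w (x, y) *\<^sub>R ricci g X x"
    by (simp add: bitension_pde_def Let_def algebra_simps)
  have "pullback_trace_nabla2 K H F V (x, y) = (\<Sum>p\<in>Basis. cov_hess K H F (pcov H F V) (x, y) (?E p) (?E p))"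
    by (rule F.pullback_trace_nabla2_trace[OF smooth_V xy E])
  also have "\<dots> = (\<Sum>p\<in>Basis. (?n *\<^sub>R D T x (Z (?E p)), 0))"
    unfolding cov_hess_V[OF assms] Z_def ..
  also have "\<dots> = (?n *\<^sub>R D T x (\<Sum>p\<in>Basis. Z (?E p)), 0)"
    by (simp add: prod_eq_iff fst_sum snd_sum scaleR_sum_right linear_sum[OF lin])
  finally have tr: "pullback_trace_nabla2 K H F V (x, y) = (?n *\<^sub>R D T x (bitension_pde g h L w x y - w (x, y) *\<^sub>R ricci g X x), 0)"
    unfolding sumZ .
  let ?R = "\<lambda>U. curvature_at H (F (x, y)) (?n *\<^sub>R D T x (X x), 0) (D F (x, y) U) (D F (x, y) U)"
  note RT = T.H.curvature_at_linear[OF Tx] and Rq = q.H.curvature_at_linear[OF qy]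
  have Rh: "?R (u, 0) = (?n *\<^sub>R D T x (curvature_at g x (X x) u u), 0)" for u
    by (simp add: Fxy D_F[OF assms] H.curvature_product[OF Tx qy] linear_scale[OF RT(1)]
        T.curvature_transform[OF assms(1)] linear_0[OF Rq(1)])
  \<comment> \<open>The first argument is horizontal and the other two are vertical, and a product
    has no mixed curvature.\<close>
  have Rv: "?R (0, v) = 0" for v
    by (simp add: Fxy D_F[OF assms] H.curvature_product[OF Tx qy] linear_0[OF lin] linear_0[OF RT(2)] linear_0[OF Rq(1)]
        zero_prod_def)
  have "(\<Sum>p\<in>Basis. ?R (?E p)) = (?n *\<^sub>R D T x (\<Sum>b\<in>Basis. curvature_at g x (X x) (e b) (e b)), 0)"
    unfolding sum_warped_frame[where r = ?R]
    by (simp add: Rh Rv prod_eq_iff fst_sum snd_sum scaleR_sum_right linear_sum[OF lin])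
  then have "(let e = frame_near K (x, y) in \<Sum>b\<in>Basis. curvature_at H (F (x, y)) (tension K H F (x, y))
        (D F (x, y) (e b (x, y))) (D F (x, y) (e b (x, y))))
      = (?n *\<^sub>R D T x (ricci g X x), 0)"
    unfolding F.curvature_trace[OF xy E] tension_product_map[OF assms] g.ricci_trace[OF assms(1) e] .
  then show ?thesis
    unfolding f_bitension_def tr by (simp add: linear_diff[OF lin] linear_scale[OF lin] algebra_simps)
qed

end

end


context product_map_domain
begin

text \<open>The factor n can be cancelled because a Euclidean space type has positive dimension, and
  \<open>D T x\<close> because it is injective.\<close>

lemma tension_eq_0_iff:
  assumes "x \<in> A" "y \<in> B"
  shows "tension K H F (x, y) = 0 \<longleftrightarrow> X x = 0"
  by (simp add: tension_product_map[OF assms] zero_prod_def T.D_eq_0_iff[OF assms(1)])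

lemma f_bitension_eq_0_iff:
  assumes "smooth_on (A \<times> B) w" "x \<in> A" "y \<in> B"
  shows "f_bitension K H w F (x, y) = 0 \<longleftrightarrow> bitension_pde g h L w x y = 0"
  by (simp add: f_bitension_product_map[OF assms] zero_prod_def T.D_eq_0_iff[OF assms(2)])

end

section \<open>Charts\<close>

lemma metric_field_on_subset: "metric_field_on S G \<Longrightarrow> T \<subseteq> S \<Longrightarrow> metric_field_on T G"
  unfolding metric_field_on_def
  by (intro conjI ballI allI smooth_on_subset[of S _ T]) auto

lemma inj_chart: "smooth_atlas M \<Longrightarrow> inj_on (chart_map M i) (chart_dom M i)"
  unfolding smooth_atlas_def homeomorphism_def by (metis inj_on_inverseI)

lemma chart_inv_map: "smooth_atlas M \<Longrightarrow> p \<in> chart_dom M i \<Longrightarrow> chart_inv M i (chart_map M i p) = p"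
  by (simp add: chart_inv_def inj_chart)

lemma chart_inv_img:
  assumes "smooth_atlas M" "x \<in> chart_img M i"
  shows "chart_inv M i x \<in> chart_dom M i" "chart_map M i (chart_inv M i x) = x"
  using assms unfolding chart_img_def chart_inv_def by (simp_all add: inv_into_into f_inv_into_f)

lemma open_chart: "smooth_atlas M \<Longrightarrow> open (chart_dom M i)" "smooth_atlas M \<Longrightarrow> open (chart_img M i)"
  by (simp_all add: smooth_atlas_def)

lemma chart_cover:
  assumes "smooth_atlas M"
  obtains i where "p \<in> chart_dom M i"
proof -
  have "p \<in> (\<Union>i. chart_dom M i)" using assms by (simp add: smooth_atlas_def)
  then show ?thesis using that by blast
qed

lemma map_rep_dom_eq:
  assumes "smooth_atlas P"
  shows "map_rep_dom P Q \<phi> i j = {x \<in> chart_img P i. \<phi> (chart_inv P i x) \<in> chart_dom Q j}"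
  using chart_inv_map[OF assms] chart_inv_img[OF assms]
  by (force simp: map_rep_dom_def chart_img_def)

lemma open_map_rep_dom:
  assumes "smooth_atlas P" "open (chart_dom Q j)" "continuous_on UNIV \<phi>"
  shows "open (map_rep_dom P Q \<phi> i j)"
proof -
  have "continuous_on (chart_img P i) (chart_inv P i)"
    using assms(1) by (simp add: smooth_atlas_def homeomorphism_def)
  then have "continuous_on (chart_img P i) (\<lambda>x. \<phi> (chart_inv P i x))"
    using continuous_on_compose2[OF assms(3)] by auto
  from continuous_open_preimage[OF this open_chart(2)[OF assms(1)] assms(2)]
  show ?thesis by (simp add: map_rep_dom_eq[OF assms(1)] vimage_def Collect_conj_eq)
qed

lemma chart_metric_domain:
  assumes "riemannian_manifold M"
  shows "metric_domain (chart_img M i) (chart_metric M i)"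
  using assms by unfold_locales (auto simp: riemannian_manifold_def smooth_atlas_def)

text \<open>Writing a change of charts as the representative of the identity makes the facts about
  \<open>map_rep_dom\<close> available; the isometry property is the compatibility clause of
  \<open>riemannian_manifold\<close>.\<close>

lemma chart_isometry:
  assumes "riemannian_manifold M"
  shows "isometry_domain (map_rep_dom M M (\<lambda>p. p) i j) (chart_img M j) (chart_metric M i) (chart_metric M j)
    (map_rep M M (\<lambda>p. p) i j)"
proof -
  have at: "smooth_atlas M" using assms by (simp add: riemannian_manifold_def)
  have T: "map_rep M M (\<lambda>p. p) i j = chart_map M j \<circ> chart_inv M i"
    by (simp add: map_rep_def o_def)
  have dom: "map_rep_dom M M (\<lambda>p. p) i j = chart_map M i ` (chart_dom M i \<inter> chart_dom M j)"
    by (simp add: map_rep_dom_def vimage_def)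
  have sub: "map_rep_dom M M (\<lambda>p. p) i j \<subseteq> chart_img M i" by (auto simp: map_rep_dom_eq[OF at])
  interpret K: metric_domain "map_rep_dom M M (\<lambda>p. p) i j" "chart_metric M i"
    using metric_field_on_subset[OF metric_domain.metric[OF chart_metric_domain[OF assms]] sub]
      open_map_rep_dom[OF at open_chart(1)[OF at] continuous_on_id] by unfold_locales
  interpret H: metric_domain "chart_img M j" "chart_metric M j"
    by (rule chart_metric_domain[OF assms])
  show ?thesis
  proof unfold_locales
    show "smooth_on (map_rep_dom M M (\<lambda>p. p) i j) (map_rep M M (\<lambda>p. p) i j)"
      unfolding T dom using at by (simp add: smooth_atlas_def)
    show "map_rep M M (\<lambda>p. p) i j ` map_rep_dom M M (\<lambda>p. p) i j \<subseteq> chart_img M j"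
      by (auto simp: map_rep_dom_eq[OF at] map_rep_def chart_img_def)
    show "chart_metric M i x u v = chart_metric M j (map_rep M M (\<lambda>p. p) i j x)
        (D (map_rep M M (\<lambda>p. p) i j) x u) (D (map_rep M M (\<lambda>p. p) i j) x v)"
      if "x \<in> map_rep_dom M M (\<lambda>p. p) i j" for x u v
      using assms that unfolding T dom riemannian_manifold_def Let_def by blast
  qed
qed

lemma chart_map_domain:
  assumes "riemannian_manifold P" "riemannian_manifold Q" "smooth_map P Q \<phi>"
  shows "map_domain (map_rep_dom P Q \<phi> i j) (chart_metric P i) (chart_img Q j) (chart_metric Q j)
    (map_rep P Q \<phi> i j)"
proof -
  have at: "smooth_atlas P" "smooth_atlas Q" using assms by (simp_all add: riemannian_manifold_def)
  have sub: "map_rep_dom P Q \<phi> i j \<subseteq> chart_img P i" by (auto simp: map_rep_dom_eq[OF at(1)])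
  have "continuous_on UNIV \<phi>" using assms(3) by (simp add: smooth_map_def)
  then interpret K: metric_domain "map_rep_dom P Q \<phi> i j" "chart_metric P i"
    using metric_field_on_subset[OF metric_domain.metric[OF chart_metric_domain[OF assms(1)]] sub]
      open_map_rep_dom[OF at(1) open_chart(1)[OF at(2)]] by unfold_locales
  interpret H: metric_domain "chart_img Q j" "chart_metric Q j"
    by (rule chart_metric_domain[OF assms(2)])
  show ?thesis
    using assms(3) by unfold_locales
      (auto simp: smooth_map_def map_rep_dom_eq[OF at(1)] map_rep_def chart_img_def)
qed

text \<open>A vanishing derivative makes \<open>l\<close> constant on the part of a chart lying over
  a ball, hence locally constant, and connectedness does the rest.\<close>

lemma constant_on_connected_manifold:
  fixes l :: "'m::topological_space \<Rightarrow> real" and M :: "('i, 'm, 'e::euclidean_space) rmanifold"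
  assumes "riemannian_manifold M" "connected (UNIV :: 'm set)"
    and "smooth_function M l" and D0: "\<And>i x. x \<in> chart_img M i \<Longrightarrow> D (fun_rep M l i) x = (\<lambda>_. 0)"
  shows "l constant_on UNIV"
proof -
  have at: "smooth_atlas M" using assms by (simp add: riemannian_manifold_def)
  have loc: "eventually (\<lambda>p'. l p = l p') (at p within UNIV)" for p
  proof -
    obtain i where p: "p \<in> chart_dom M i" using chart_cover[OF at] .
    let ?x = "chart_map M i p"
    have x: "?x \<in> chart_img M i" using p by (simp add: chart_img_def)
    then obtain r where r: "r > 0" "ball ?x r \<subseteq> chart_img M i"
      using open_chart(2)[OF at] openE by blast
    have sm: "smooth_on (chart_img M i) (fun_rep M l i)" using assms by (simp add: smooth_function_def)
    \<comment> \<open>A ball is used because constancy follows from a zero derivative on convex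
      sets.\<close>
    have "\<exists>c. \<forall>y\<in>ball ?x r. fun_rep M l i y = c"
    proof (rule has_derivative_zero_constant[OF convex_ball])
      fix y assume "y \<in> ball ?x r"
      then have "y \<in> chart_img M i" using r by blast
      then show "(fun_rep M l i has_derivative (\<lambda>h. 0)) (at y within ball ?x r)"
        using smooth_on_has_derivative[OF sm] D0 has_derivative_at_withinI by metis
    qed
    then have c: "fun_rep M l i y = fun_rep M l i ?x" if "y \<in> ball ?x r" for y
      using that r(1) by (metis centre_in_ball)
    have "continuous_on (chart_dom M i) (chart_map M i)"
      using at by (simp add: smooth_atlas_def homeomorphism_def)
    then have "open (chart_dom M i \<inter> chart_map M i -` ball ?x r)"
      by (rule continuous_open_preimage[OF _ open_chart(1)[OF at] open_ball])
    moreover have "p \<in> chart_dom M i \<inter> chart_map M i -` ball ?x r" using p r by simp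
    moreover have "l p = l p'" if "p' \<in> chart_dom M i \<inter> chart_map M i -` ball ?x r" for p'
      using c[of "chart_map M i p'"] that p by (simp add: fun_rep_def chart_inv_map[OF at])
    ultimately show ?thesis unfolding eventually_at_topological by blast
  qed
  have "l p = l p'" for p p'
    by (rule connected_local_const[OF assms(2)]) (use loc in auto)
  then show ?thesis unfolding constant_on_def by blast
qed

section \<open>Globalization\<close>

locale warped_product_map =
  fixes M :: "('i, 'm::topological_space, 'e::euclidean_space) rmanifold"
    and N :: "('j, 'n::topological_space, 'k::euclidean_space) rmanifold"
    and l :: "'m \<Rightarrow> real" and \<psi> :: "'n \<Rightarrow> 'n"
  assumes M: "riemannian_manifold M" and N: "riemannian_manifold N"
    and smooth_l: "smooth_function M l" and l_pos: "l p > 0"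
    and harmonic_psi: "harmonic_map N N \<psi>"
begin

abbreviation P where "P \<equiv> warped_product M l N"
abbreviation Q where "Q \<equiv> product_manifold M N"
abbreviation \<Psi> where "\<Psi> \<equiv> \<lambda>(x, y). (x, \<psi> y)"
abbreviation T where "T \<equiv> map_rep M M (\<lambda>p. p)"
abbreviation T_dom where "T_dom \<equiv> map_rep_dom M M (\<lambda>p. p)"
abbreviation q where "q \<equiv> map_rep N N \<psi>"
abbreviation q_dom where "q_dom \<equiv> map_rep_dom N N \<psi>"

lemma atlas: "smooth_atlas M" "smooth_atlas N"
  using M N by (simp_all add: riemannian_manifold_def)

lemma smooth_psi: "smooth_map N N \<psi>"
  using harmonic_psi by (simp add: harmonic_map_def)

lemma P_metric: "chart_metric P (i, j) = warped_metric (chart_metric M i) (fun_rep M l i) (chart_metric N j)"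
  by (auto simp: fun_eq_iff warped_product_def warped_metric_def fun_rep_def)

lemma Q_metric: "chart_metric Q (i, j) = warped_metric (chart_metric M i) (\<lambda>_. 1) (chart_metric N j)"
  by (auto simp: fun_eq_iff product_manifold_def warped_metric_def)

lemma P_img: "chart_img P (i, j) = chart_img M i \<times> chart_img N j"
  by (auto simp: chart_img_def warped_product_def image_iff)

lemma P_inv:
  assumes "x \<in> chart_img M i" "y \<in> chart_img N j"
  shows "chart_inv P (i, j) (x, y) = (chart_inv M i x, chart_inv N j y)"
proof -
  have "inj_on (map_prod (chart_map M i) (chart_map N j)) (chart_dom M i \<times> chart_dom N j)"
    using inj_chart[OF atlas(1)] inj_chart[OF atlas(2)] by (rule map_prod_inj_on)
  then have "inv_into (chart_dom M i \<times> chart_dom N j) (map_prod (chart_map M i) (chart_map N j)) (x, y)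
      = (chart_inv M i x, chart_inv N j y)"
    using chart_inv_img[OF atlas(1) assms(1)] chart_inv_img[OF atlas(2) assms(2)]
    by (intro inv_into_f_eq) auto
  then show ?thesis by (simp add: chart_inv_def warped_product_def)
qed

lemma Psi_dom: "map_rep_dom P Q \<Psi> (i, j) (i', j') = T_dom i i' \<times> q_dom j j'"
  by (force simp: map_rep_dom_def warped_product_def product_manifold_def)

lemma T_dom_sub: "T_dom i i' \<subseteq> chart_img M i" and q_dom_sub: "q_dom j j' \<subseteq> chart_img N j"
  by (auto simp: map_rep_dom_def chart_img_def)

lemma Psi_rep:
  assumes "z \<in> T_dom i i' \<times> q_dom j j'"
  shows "map_rep P Q \<Psi> (i, j) (i', j') z = (T i i' (fst z), q j j' (snd z))"
proof -
  have "fst z \<in> chart_img M i" "snd z \<in> chart_img N j" using assms T_dom_sub[of i i'] q_dom_sub[of j j'] by auto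
  from P_inv[OF this] show ?thesis
    by (simp add: map_rep_def product_manifold_def)
qed

lemma smooth_l_rep: "smooth_on (chart_img M i) (fun_rep M l i)"
  using smooth_l by (simp add: smooth_function_def)

lemma l_rep_pos: "fun_rep M l i x > 0"
  by (simp add: fun_rep_def l_pos)

lemma local_map:
  "product_map_domain (T_dom i i') (chart_img M i') (chart_metric M i) (chart_metric M i')
     (q_dom j j') (chart_img N j') (chart_metric N j) (chart_metric N j')
     (fun_rep M l i) (T i i') (q j j') (map_rep P Q \<Psi> (i, j) (i', j'))"
proof -
  interpret T: isometry_domain "T_dom i i'" "chart_img M i'" "chart_metric M i" "chart_metric M i'" "T i i'"
    by (rule chart_isometry[OF M])
  interpret q: map_domain "q_dom j j'" "chart_metric N j" "chart_img N j'" "chart_metric N j'" "q j j'"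
    by (rule chart_map_domain[OF N N smooth_psi])
  show ?thesis
    using smooth_on_subset[OF smooth_l_rep T_dom_sub] l_rep_pos Psi_rep harmonic_psi
    by unfold_locales (auto simp: harmonic_map_def)
qed

lemma smooth_Psi: "smooth_map P Q \<Psi>"
  unfolding smooth_map_def
proof (intro conjI allI)
  have "continuous_on UNIV \<psi>" using smooth_psi by (simp add: smooth_map_def)
  then have "continuous_on UNIV (\<lambda>z. \<psi> (snd z))"
    by (rule continuous_on_compose2) (auto intro: continuous_intros)
  then show "continuous_on UNIV \<Psi>"
    unfolding case_prod_unfold by (intro continuous_intros)
  fix I J :: "'i \<times> 'j"
  obtain i j i' j' where "I = (i, j)" "J = (i', j')" by (meson surj_pair)
  then show "smooth_on (map_rep_dom P Q \<Psi> I J) (map_rep P Q \<Psi> I J)"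
    using product_map_domain.smooth_F[OF local_map] by (simp add: Psi_dom)
qed

text \<open>\<open>X\<close> lives on \<open>M\<close>, yet the tension field is evaluated on the
  product, so some point of the fibre is required; the type \<open>'n\<close> has one.\<close>

lemma ex_point:
  obtains j j' y where "y \<in> q_dom j j'"
proof -
  obtain j where "undefined \<in> chart_dom N j" using chart_cover[OF atlas(2)] .
  moreover obtain j' where "\<psi> undefined \<in> chart_dom N j'" using chart_cover[OF atlas(2)] .
  ultimately show ?thesis using that[of "chart_map N j undefined" j j'] by (auto simp: map_rep_dom_def)
qed

text \<open>The equation refers to one chart of \<open>N\<close>, the bitension also to a chart
  around the image under \<open>\<psi>\<close>, which is supplied here.\<close>

lemma ex_target:
  assumes "y \<in> chart_img N j"
  obtains j' where "y \<in> q_dom j j'"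
  using chart_cover[OF atlas(2)] assms by (metis (no_types, lifting) map_rep_dom_eq[OF atlas(2)] mem_Collect_eq)

lemma T_dom_self: "T_dom i i = chart_img M i"
  by (simp add: map_rep_dom_def chart_img_def vimage_def)

abbreviation X where "X i \<equiv> gradient (chart_metric M i) (\<lambda>x. ln (fun_rep M l i x))"

lemma harmonic_Psi_iff: "harmonic_map P Q \<Psi> \<longleftrightarrow> (\<forall>i. \<forall>x\<in>chart_img M i. X i x = 0)"
proof
  assume harm: "harmonic_map P Q \<Psi>"
  show "\<forall>i. \<forall>x\<in>chart_img M i. X i x = 0"
  proof (intro allI ballI)
    fix i x assume x: "x \<in> chart_img M i"
    obtain j j' y where y: "y \<in> q_dom j j'" using ex_point .
    \<comment> \<open>Taking the same chart of \<open>M\<close> for source and target makes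
      \<open>T_dom\<close> the whole chart image, so every \<open>x\<close> is reached.\<close>
    have "(x, y) \<in> map_rep_dom P Q \<Psi> (i, j) (i, j')" using x y by (simp add: Psi_dom T_dom_self)
    then have "tension (chart_metric P (i, j)) (chart_metric Q (i, j')) (map_rep P Q \<Psi> (i, j) (i, j')) (x, y) = 0"
      using harm unfolding harmonic_map_def by blast
    then show "X i x = 0"
      using product_map_domain.tension_eq_0_iff[OF local_map, of x i i y j j'] x y
      by (simp add: P_metric Q_metric T_dom_self)
  qed
next
  assume X: "\<forall>i. \<forall>x\<in>chart_img M i. X i x = 0"
  show "harmonic_map P Q \<Psi>"
    unfolding harmonic_map_def
  proof (intro conjI allI ballI smooth_Psi)
    fix I J :: "'i \<times> 'j" and z assume z: "z \<in> map_rep_dom P Q \<Psi> I J"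
    obtain i j i' j' where IJ: "I = (i, j)" "J = (i', j')" by (meson surj_pair)
    obtain x y where xy: "z = (x, y)" "x \<in> T_dom i i'" "y \<in> q_dom j j'" using z by (auto simp: IJ Psi_dom)
    show "tension (chart_metric P I) (chart_metric Q J) (map_rep P Q \<Psi> I J) z = 0"
      using product_map_domain.tension_eq_0_iff[OF local_map xy(2,3)] X xy T_dom_sub[of i i']
      unfolding IJ P_metric Q_metric by auto
  qed
qed

text \<open>Since \<open>l\<close> is positive, the gradient of its logarithm vanishes exactly when
  its derivative does; connectedness then passes from the derivative to \<open>l\<close>.\<close>

lemma l_constant_iff:
  assumes "connected (UNIV :: 'm set)"
  shows "l constant_on UNIV \<longleftrightarrow> (\<forall>i. \<forall>x\<in>chart_img M i. X i x = 0)"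
proof
  assume "l constant_on UNIV"
  then obtain c where "\<And>p. l p = c" by (auto simp: constant_on_def)
  then have c: "fun_rep M l i = (\<lambda>_. c)" for i by (auto simp: fun_rep_def)
  show "\<forall>i. \<forall>x\<in>chart_img M i. X i x = 0"
  proof (intro allI ballI)
    fix i x assume x: "x \<in> chart_img M i"
    interpret metric_domain "chart_img M i" "chart_metric M i" by (rule chart_metric_domain[OF M])
    show "X i x = 0"
      by (rule gradient_eqI[OF x]) (simp add: c bilinear_lzero[OF bilinear_at[OF x]])
  qed
next
  assume X: "\<forall>i. \<forall>x\<in>chart_img M i. X i x = 0"
  show "l constant_on UNIV"
  proof (rule constant_on_connected_manifold[OF M assms smooth_l])
    fix i x assume x: "x \<in> chart_img M i"
    interpret metric_domain "chart_img M i" "chart_metric M i" by (rule chart_metric_domain[OF M])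
    have "smooth_on (chart_img M i) (\<lambda>x. ln (fun_rep M l i x))"
      by (rule smooth_on_ln[OF open_dom smooth_l_rep l_rep_pos])
    from gradient_metric[OF x smooth_on_differentiable[OF this x]]
    have "D (\<lambda>x. ln (fun_rep M l i x)) x v = 0" for v
      using X x by (simp add: bilinear_lzero[OF bilinear_at[OF x]])
    then show "D (fun_rep M l i) x = (\<lambda>_. 0)"
      using D_ln[OF smooth_on_differentiable[OF smooth_l_rep x] l_rep_pos] l_rep_pos[of i x] by (auto simp: fun_eq_iff)
  qed
qed

text \<open>The target charts do not occur in the equation. For one direction a single convenient
  choice of them is therefore enough, and for the other the equation settles all choices at
  once.\<close>

lemma f_biharmonic_Psi_iff:
  assumes "smooth_function P f" "\<forall>p. f p > 0"
  shows "f_biharmonic_map P Q f \<Psi> \<longleftrightarrow>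
    (\<forall>i j. \<forall>x\<in>chart_img M i. \<forall>y\<in>chart_img N j.
      bitension_pde (chart_metric M i) (chart_metric N j) (fun_rep M l i) (fun_rep P f (i, j)) x y = 0)"
proof -
  have f: "smooth_on (T_dom i i' \<times> q_dom j j') (fun_rep P f (i, j))" for i i' j j'
  proof (rule smooth_on_subset)
    show "smooth_on (chart_img P (i, j)) (fun_rep P f (i, j))"
      using assms(1) by (simp add: smooth_function_def)
    show "T_dom i i' \<times> q_dom j j' \<subseteq> chart_img P (i, j)"
      unfolding P_img by (intro Sigma_mono T_dom_sub q_dom_sub)
  qed
  note key = product_map_domain.f_bitension_eq_0_iff[OF local_map f, folded P_metric Q_metric]
  show ?thesis
  proof (intro iffI allI ballI)
    fix i j x y assume bih: "f_biharmonic_map P Q f \<Psi>" and x: "x \<in> chart_img M i" and y: "y \<in> chart_img N j"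
    obtain j' where y': "y \<in> q_dom j j'" using ex_target[OF y] .
    have x': "x \<in> T_dom i i" using x by (simp add: T_dom_self)
    have "(x, y) \<in> map_rep_dom P Q \<Psi> (i, j) (i, j')" using x' y' by (simp add: Psi_dom)
    then have "f_bitension (chart_metric P (i, j)) (chart_metric Q (i, j')) (fun_rep P f (i, j))
        (map_rep P Q \<Psi> (i, j) (i, j')) (x, y) = 0"
      using bih unfolding f_biharmonic_map_def by blast
    then show "bitension_pde (chart_metric M i) (chart_metric N j) (fun_rep M l i) (fun_rep P f (i, j)) x y = 0"
      unfolding key[OF x' y'] .
  next
    assume pde: "\<forall>i j. \<forall>x\<in>chart_img M i. \<forall>y\<in>chart_img N j.
      bitension_pde (chart_metric M i) (chart_metric N j) (fun_rep M l i) (fun_rep P f (i, j)) x y = 0"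
    show "f_biharmonic_map P Q f \<Psi>"
      unfolding f_biharmonic_map_def
    proof (intro conjI allI ballI smooth_Psi assms)
      show "f p > 0" for p using assms(2) by blast
      fix I J :: "'i \<times> 'j" and z assume z: "z \<in> map_rep_dom P Q \<Psi> I J"
      obtain i j i' j' where IJ: "I = (i, j)" "J = (i', j')" by (meson surj_pair)
      obtain x y where xy: "z = (x, y)" "x \<in> T_dom i i'" "y \<in> q_dom j j'" using z by (auto simp: IJ Psi_dom)
      show "f_bitension (chart_metric P I) (chart_metric Q J) (fun_rep P f I) (map_rep P Q \<Psi> I J) z = 0"
        unfolding IJ xy(1) key[OF xy(2,3)] using pde xy T_dom_sub q_dom_sub by blast
    qed
  qed
qed

end

theorem proposition6p8:
  fixes M :: "('i, 'm::{t2_space,second_countable_topology}, 'e::euclidean_space) rmanifold"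
    and N :: "('j, 'n::{t2_space,second_countable_topology}, 'k::euclidean_space) rmanifold"
    and l :: "'m \<Rightarrow> real" and \<psi> :: "'n \<Rightarrow> 'n" and f :: "'m \<times> 'n \<Rightarrow> real"
  assumes "riemannian_manifold M" and "connected (UNIV :: 'm set)"
    and "riemannian_manifold N"
    and "smooth_function M l" and "\<forall>x. l x > 0"
    and "harmonic_map N N \<psi>"
    and "smooth_function (warped_product M l N) f" and "\<forall>p. f p > 0"
    and "\<not> f constant_on UNIV"
  shows "nontrivial_f_biharmonic_map (warped_product M l N) (product_manifold M N) f
            (\<lambda>(x, y). (x, \<psi> y))
         \<longleftrightarrow>
         \<not> l constant_on UNIV \<and>
         (\<forall>i j. \<forall>x \<in> chart_img M i. \<forall>y \<in> chart_img N j.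
            let P = warped_product M l N;
                n = real DIM('k);
                g = chart_metric M i;
                F = fun_rep P f (i, j);
                X = gradient g (\<lambda>x. ln (fun_rep M l i x))
            in 0 = F (x, y) *\<^sub>R trace_nabla2 g X x
                 + (n / 2 * F (x, y)) *\<^sub>R gradient g (\<lambda>x. g x (X x) (X x)) x
                 + F (x, y) *\<^sub>R ricci g X x
                 + laplacian (chart_metric P (i, j)) F (x, y) *\<^sub>R X x
                 + 2 *\<^sub>R nabla g (gradient g (\<lambda>x. F (x, y))) X x)"
proof -
  interpret warped_product_map M N l \<psi>
    using assms by unfold_locales auto
  show ?thesis
    \<comment> \<open>Non-harmonicity of the map and non-constancy of \<open>l\<close> both become
      the statement that \<open>X\<close> does not vanish identically; non-constancy of
      \<open>f\<close> is given.\<close>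
    unfolding nontrivial_f_biharmonic_map_def f_biharmonic_Psi_iff[OF assms(7,8)] harmonic_Psi_iff
      l_constant_iff[OF assms(2)] bitension_pde_def P_metric Let_def
    using assms(9) by (auto simp: eq_commute[of 0])
qed

end
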